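(* Let $T,L>0$. Then there exist boundary controls $u,v,w:[0,T]\to\mathbb{R}$ and a solution $y\in C([0,T];H^2(0,L))$ of $$\begin{cases} y_t+y_x+y_{xxx}+yy_x=0, & x\in[0,L],\ t\in[0,T],\\ y(0,t)=u(t),\quad y(L,t)=v(t),\quad y_x(L,t)=w(t), & t\in[0,T],\\ y(x,0)=0, & x\in[0,L],\end{cases}$$ such that the flow $\Phi$ associated to $y$ satisfies $$\frac{\partial \Phi}{\partial t}(x,0)=0\quad \text{for all } x\in[0,L],$$ $$\frac{\partial \Phi}{\partial t}(x,T)=0\quad \text{for all } x\in[0,L],$$ $$\Phi(x,t)\ge L\quad \text{for all } x\in[0,L],\ t\in[T,\infty).$$
   Context: Flow associated to a solution $y$: extend $y$ to all $x\in\mathbb{R}$ by $$\hat y(x,t)=\begin{cases} y(0,t), & x\le 0,\\ y(x,t), & x\in[0,L],\\ y(L,t), & x\ge L,\end{cases}$$ and let $\Phi$ be the solution of $$\frac{\partial\Phi}{\partial t}(x,t)=\hat y(\Phi(x,t),t),\qquad \Phi(x,0)=x,\qquad x\in\mathbb{R},\ t\ge 0.$$ For times $t\ge T$ the function $y$ is continued by $0$ (the solution is at rest at time $T$ and remains at rest). The equation is understood in the sense of distributions on $(0,L)\times(0,T)$; since $y\in C([0,T];H^2(0,L))$, the initial and boundary values are attained pointwise as traces. *)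

theory Defs
  imports "HOL-Analysis.Analysis"
begin

section \<open>Test functions and distributions\<close>

primrec C_k :: "nat \<Rightarrow> ('a::euclidean_space \<Rightarrow> real) \<Rightarrow> bool" where
  "C_k 0 f \<longleftrightarrow> continuous_on UNIV f"
| "C_k (Suc k) f \<longleftrightarrow>
     (\<forall>z. f differentiable (at z)) \<and> (\<forall>v. C_k k (\<lambda>z. frechet_derivative f (at z) v))"

definition test_function :: "'a::euclidean_space set \<Rightarrow> ('a \<Rightarrow> real) \<Rightarrow> bool" where
  "test_function \<Omega> \<phi> \<longleftrightarrow>
     (\<forall>k. C_k k \<phi>) \<and> compact (closure {z. \<phi> z \<noteq> 0}) \<and> closure {z. \<phi> z \<noteq> 0} \<subseteq> \<Omega>"

text \<open>Distributions are represented by their action on test functions; only their values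
  on \<open>test_function \<Omega>\<close> are meaningful.\<close>

type_synonym 'a distribution = "('a \<Rightarrow> real) \<Rightarrow> real"

definition regular_distr ::
    "'a::euclidean_space set \<Rightarrow> ('a \<Rightarrow> real) \<Rightarrow> 'a distribution" where
  "regular_distr \<Omega> f = (\<lambda>\<phi>. integral\<^sup>L (lebesgue_on \<Omega>) (\<lambda>z. f z * \<phi> z))"

definition distr_deriv ::
    "'a::euclidean_space \<Rightarrow> 'a distribution \<Rightarrow> 'a distribution" where
  "distr_deriv v F = (\<lambda>\<phi>. - F (\<lambda>z. frechet_derivative \<phi> (at z) v))"


section \<open>Sobolev spaces on an open interval\<close>

definition L2 :: "real set \<Rightarrow> (real \<Rightarrow> real) \<Rightarrow> bool" where
  "L2 I f \<longleftrightarrow> f \<in> borel_measurable (lebesgue_on I) \<and> integrable (lebesgue_on I) (\<lambda>x. (f x)\<^sup>2)"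

definition has_weak_deriv :: "real set \<Rightarrow> nat \<Rightarrow> (real \<Rightarrow> real) \<Rightarrow> (real \<Rightarrow> real) \<Rightarrow> bool" where
  "has_weak_deriv I k f g \<longleftrightarrow>
     (\<forall>\<phi>. test_function I \<phi> \<longrightarrow>
        (distr_deriv 1 ^^ k) (regular_distr I f) \<phi> = regular_distr I g \<phi>)"

definition sobolev :: "real set \<Rightarrow> nat \<Rightarrow> (real \<Rightarrow> real) \<Rightarrow> bool" where
  "sobolev I k f \<longleftrightarrow> L2 I f \<and> (\<forall>j\<le>k. \<exists>g. L2 I g \<and> has_weak_deriv I j f g)"

text \<open>Weak derivatives are unique up to null sets, so the integrals in \<open>sobolev_norm\<close> do not
  depend on the representative chosen here.\<close>

definition weak_deriv :: "real set \<Rightarrow> nat \<Rightarrow> (real \<Rightarrow> real) \<Rightarrow> real \<Rightarrow> real" where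
  "weak_deriv I k f = (SOME g. L2 I g \<and> has_weak_deriv I k f g)"

definition sobolev_norm :: "real set \<Rightarrow> nat \<Rightarrow> (real \<Rightarrow> real) \<Rightarrow> real" where
  "sobolev_norm I k f =
     sqrt (\<Sum>j\<le>k. integral\<^sup>L (lebesgue_on I) (\<lambda>x. (weak_deriv I j f x)\<^sup>2))"

text \<open>The space \<open>C([0,T]; H\<^sup>2(0,L))\<close>.  A function is written \<open>y x t\<close>, space variable first.
  An element of \<open>H\<^sup>2(0,L)\<close> is identified with its continuous representative on \<open>[0,L]\<close> (which
  is then automatically \<open>C\<^sup>1\<close> on \<open>[0,L]\<close>), so that the pointwise values of \<open>y\<close> and of its
  space derivative on the closed interval are the traces.\<close>

definition C_H2 :: "real \<Rightarrow> real \<Rightarrow> (real \<Rightarrow> real \<Rightarrow> real) \<Rightarrow> bool" where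
  "C_H2 T L y \<longleftrightarrow>
     (\<forall>t\<in>{0..T}. continuous_on {0..L} (\<lambda>x. y x t) \<and> sobolev {0<..<L} 2 (\<lambda>x. y x t)) \<and>
     (\<forall>s\<in>{0..T}. ((\<lambda>t. sobolev_norm {0<..<L} 2 (\<lambda>x. y x t - y x s)) \<longlongrightarrow> 0)
        (at s within {0..T}))"


section \<open>The Korteweg-de Vries equation and the flow of a solution\<close>

text \<open>The equation in the sense of distributions on \<open>(0,L) \<times> (0,T)\<close>.  For \<open>C_H2 T L y\<close> the
  product \<open>y y\<^sub>x\<close> is a continuous function, in which \<open>y\<^sub>x\<close> is the classical derivative of the
  \<open>C\<^sup>1\<close> representative (equal to the weak one).\<close>

definition KdV :: "real \<Rightarrow> real \<Rightarrow> (real \<Rightarrow> real \<Rightarrow> real) \<Rightarrow> bool" where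
  "KdV T L y \<longleftrightarrow>
     (let \<Omega> = {0<..<L} \<times> {0<..<T};
          Y = regular_distr \<Omega> (\<lambda>(x, t). y x t);
          NL = regular_distr \<Omega> (\<lambda>(x, t). y x t * deriv (\<lambda>\<xi>. y \<xi> t) x);
          Dx = distr_deriv (1, 0);
          Dt = distr_deriv (0, 1)
      in \<forall>\<phi>. test_function \<Omega> \<phi> \<longrightarrow> Dt Y \<phi> + Dx Y \<phi> + Dx (Dx (Dx Y)) \<phi> + NL \<phi> = 0)"

text \<open>Constant continuation outside \<open>[0,L]\<close> in space, continuation by \<open>0\<close> after time \<open>T\<close>.
  At \<open>t = T\<close> the value of \<open>y\<close> itself is used; for a solution at rest at time \<open>T\<close> it is \<open>0\<close>.\<close>

definition y_hat :: "real \<Rightarrow> real \<Rightarrow> (real \<Rightarrow> real \<Rightarrow> real) \<Rightarrow> real \<Rightarrow> real \<Rightarrow> real" where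
  "y_hat T L y x t =
     (if t \<le> T then (if x \<le> 0 then y 0 t else if x \<le> L then y x t else y L t) else 0)"

definition is_flow ::
    "real \<Rightarrow> real \<Rightarrow> (real \<Rightarrow> real \<Rightarrow> real) \<Rightarrow> (real \<Rightarrow> real \<Rightarrow> real) \<Rightarrow> bool" where
  "is_flow T L y \<Phi> \<longleftrightarrow>
     (\<forall>x. \<Phi> x 0 = x \<and>
        (\<forall>t\<ge>0. (\<Phi> x has_real_derivative y_hat T L y (\<Phi> x t) t) (at t within {0..})))"

end

theory Submission
  imports Defs "HOL-Real_Asymp.Real_Asymp"
begin

text \<open>In the moving frame \<open>Y(X, t) = y(X + t, t)\<close> the equation becomes \<open>Y\<^sub>t + Y\<^sub>X\<^sub>X\<^sub>X + Y Y\<^sub>X = 0\<close>. All three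
  boundary values are free, so the equation can be solved as a Cauchy problem in \<open>X\<close>, with data on
  \<open>X = 0\<close> that are small and of Gevrey order \<open>2\<close> in time; the power series in \<open>X\<close> then converges
  on the whole domain.

  Take a soliton with a large parameter \<open>\<kappa>\<close> which is centred in the domain at time \<open>T / 2\<close>. Up to the
  time \<open>T / 4\<close> only a tail of size about \<open>exp (- \<kappa>\<^sup>3 T)\<close> meets the domain. Multiplying the Cauchy data of
  this tail by a Gevrey cutoff gives a solution that starts at rest and equals the soliton at time
  \<open>T / 4\<close>. It is continued by the soliton up to time \<open>T / 2\<close> and afterwards by the symmetry
  \<open>(x, t) \<mapsto> (L - x, T - t)\<close>, which brings it back to rest at time \<open>T\<close>.

  The crest moves with velocity \<open>4 \<kappa>\<^sup>2 + 1\<close> while the particles on it have velocity \<open>12 \<kappa>\<^sup>2\<close>. Hence a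
  particle that starts in \<open>x \<ge> 0\<close> stays ahead of the crest, and is at a point \<open>> L / 2\<close> at time \<open>T / 2\<close>.
  If it were at a point \<open>< L\<close> at time \<open>T\<close>, its reflection in space and time would start in \<open>x > 0\<close> and
  also be at a point \<open>> L / 2\<close> at time \<open>T / 2\<close>, which is absurd.\<close>

section \<open>Leibniz products and derivative towers\<close>

text \<open>Solving in \<open>X\<close> costs one time derivative for every three space derivatives,
  so the series tolerates time data of Gevrey order \<open>3\<close>, with a constant that limits
  the radius of convergence. Data of order \<open>2\<close> leave a spare \<open>fact n\<close>,
  which beats any geometric growth: the series reaches across a domain of any length, at the price
  of a constant factor in the amplitude. This factor must not depend on \<kappa>, although each time
  derivative of the travelling soliton costs \<open>4 * \<kappa>\<^sup>2\<close>. In the tail there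
  is room for an analyticity radius proportional to \<open>\<kappa>\<^sup>2\<close>, which cancels
  this cost. The amplitude, of order \<open>\<kappa>\<^sup>2 * exp (- (\<kappa> ^ 3 * T))\<close>,
  is then as small as desired. It has to be small even against \<open>1 / \<kappa>\<close>: before
  \<open>T / 4\<close> a particle may drift out of the domain on the left, where it feels the
  boundary value at \<open>0\<close>. When the crest reaches it, that value must still be close to
  the maximum of the soliton, so the drift has to stay below a fraction of the width of the
  soliton.\<close>

definition leib :: "(nat \<Rightarrow> real) \<Rightarrow> (nat \<Rightarrow> real) \<Rightarrow> nat \<Rightarrow> real" where
  "leib f g n = (\<Sum>j\<le>n. real (n choose j) * f j * g (n - j))"

lemma leib_0 [simp]: "leib f g 0 = f 0 * g 0"
  by (simp add: leib_def)

lemma leib_Suc: "leib f g (Suc n) = leib (\<lambda>j. f (Suc j)) g n + leib f (\<lambda>j. g (Suc j)) n"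
proof -
  have "leib f g (Suc n)
      = f 0 * g (Suc n) + (\<Sum>j\<le>n. real (Suc n choose Suc j) * f (Suc j) * g (n - j))"
    unfolding leib_def by (subst sum.atMost_Suc_shift) simp
  also have "(\<Sum>j\<le>n. real (Suc n choose Suc j) * f (Suc j) * g (n - j))
      = leib (\<lambda>j. f (Suc j)) g n + (\<Sum>j\<le>n. real (n choose Suc j) * f (Suc j) * g (n - j))"
    unfolding leib_def by (simp add: sum.distrib [symmetric] algebra_simps)
  also have "f 0 * g (Suc n) + (leib (\<lambda>j. f (Suc j)) g n
       + (\<Sum>j\<le>n. real (n choose Suc j) * f (Suc j) * g (n - j)))
      = leib (\<lambda>j. f (Suc j)) g n + (\<Sum>j\<le>Suc n. real (n choose j) * f j * g (Suc n - j))"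
    by (subst sum.atMost_Suc_shift) simp
  also have "(\<Sum>j\<le>Suc n. real (n choose j) * f j * g (Suc n - j)) = leib f (\<lambda>j. g (Suc j)) n"
    unfolding leib_def by (simp add: Suc_diff_le)
  finally show ?thesis .
qed

lemma leib_geometric:
  "leib (\<lambda>j. a * c ^ j * f j) (\<lambda>j. b * c ^ j * g j) n = a * b * c ^ n * leib f g n"
  unfolding leib_def sum_distrib_left
proof (rule sum.cong)
  fix j assume "j \<in> {..n}"
  then have "c ^ n = c ^ j * c ^ (n - j)"
    by (simp flip: power_add)
  then show "real (n choose j) * (a * c ^ j * f j) * (b * c ^ (n - j) * g (n - j)) =
         a * b * c ^ n * (real (n choose j) * f j * g (n - j))"
    by simp
qed simp

text \<open>All orders are carried together because the recursion in space consumes time derivatives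
  of every order. Derivatives are taken within \<open>S\<close>, hence one-sided at the ends of a
  time interval.\<close>

definition tower :: "real set \<Rightarrow> (nat \<Rightarrow> real \<Rightarrow> real) \<Rightarrow> bool" where
  "tower S F \<longleftrightarrow> (\<forall>n. \<forall>t\<in>S. (F n has_real_derivative F (Suc n) t) (at t within S))"

lemma towerD: "tower S F \<Longrightarrow> t \<in> S \<Longrightarrow> (F n has_real_derivative F (Suc n) t) (at t within S)"
  by (simp add: tower_def)

lemma tower_shift: "tower S F \<Longrightarrow> tower S (\<lambda>n. F (n + m))"
  by (simp add: tower_def)

lemma leib_has_derivative:
  assumes "tower S F" "tower S G" "t \<in> S"
  shows "((\<lambda>t. leib (\<lambda>j. F j t) (\<lambda>j. G j t) n) has_real_derivative
           leib (\<lambda>j. F j t) (\<lambda>j. G j t) (Suc n)) (at t within S)"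
proof -
  have "((\<lambda>t. leib (\<lambda>j. F j t) (\<lambda>j. G j t) n) has_real_derivative
      (\<Sum>j\<le>n. real (n choose j) * (F (Suc j) t * G (n - j) t + F j t * G (Suc (n - j)) t)))
      (at t within S)"
    unfolding leib_def
    by (intro DERIV_sum)
       (auto intro!: derivative_eq_intros towerD[OF assms(1) assms(3)] towerD[OF assms(2) assms(3)]
             simp: algebra_simps)
  moreover have "(\<Sum>j\<le>n. real (n choose j) * (F (Suc j) t * G (n - j) t + F j t * G (Suc (n - j)) t))
      = leib (\<lambda>j. F j t) (\<lambda>j. G j t) (Suc n)"
    unfolding leib_Suc by (simp add: leib_def sum.distrib algebra_simps)
  ultimately show ?thesis by simp
qed

lemma tower_leib:
  "tower S F \<Longrightarrow> tower S G \<Longrightarrow> tower S (\<lambda>n t. leib (\<lambda>j. F j t) (\<lambda>j. G j t) n)"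
  using leib_has_derivative unfolding tower_def by blast

lemma tower_unique_open:
  assumes "tower S F" "tower S G" "open S" and "\<And>t. t \<in> S \<Longrightarrow> F 0 t = G 0 t" and "t \<in> S"
  shows "F n t = G n t"
  using assms(5)
proof (induction n arbitrary: t)
  case (Suc n)
  have "(F n has_real_derivative F (Suc n) t) (at t)" "(G n has_real_derivative G (Suc n) t) (at t)"
    using towerD[OF assms(1) Suc.prems] towerD[OF assms(2) Suc.prems] at_within_open[OF Suc.prems assms(3)]
    by auto
  moreover have "(F n has_real_derivative G (Suc n) t) (at t)"
    by (rule has_field_derivative_transform_within_open[OF calculation(2) assms(3) Suc.prems])
       (simp add: Suc.IH)
  ultimately show ?case
    using DERIV_unique by blast
qed (simp add: assms)

section \<open>Power series solutions of the Korteweg-de Vries equation in the space variable\<close>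

text \<open>\<open>kdv_coeff c k n\<close> stands for the \<open>n\<close>-th time derivative of the coefficient of \<open>X\<^sup>k\<close> in a
  solution of \<open>Y\<^sub>t + Y\<^sub>X\<^sub>X\<^sub>X + Y Y\<^sub>X = 0\<close>; the Cauchy data on \<open>X = 0\<close> are \<open>c 0\<close>, \<open>c 1\<close>, \<open>c 2\<close>.\<close>

function kdv_coeff :: "(nat \<Rightarrow> nat \<Rightarrow> real) \<Rightarrow> nat \<Rightarrow> nat \<Rightarrow> real" where
  "kdv_coeff c k = (if k < 3 then c k else (\<lambda>n.
     - (kdv_coeff c (k - 3) (Suc n)
        + (\<Sum>i\<le>k - 3. real (k - 2 - i) * leib (kdv_coeff c i) (kdv_coeff c (k - 2 - i)) n))
     / real (k * (k - 1) * (k - 2))))"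
  by auto
termination
  by (relation "Wellfounded.measure (\<lambda>(c, k). k)") auto

declare kdv_coeff.simps [simp del]

lemma kdv_coeff_init: "k < 3 \<Longrightarrow> kdv_coeff c k = c k"
  by (simp add: kdv_coeff.simps)

lemma kdv_coeff_step:
  "kdv_coeff c (k + 3) n =
     - (kdv_coeff c k (Suc n)
        + (\<Sum>i\<le>k. real (k + 1 - i) * leib (kdv_coeff c i) (kdv_coeff c (k + 1 - i)) n))
     / real ((k + 3) * (k + 2) * (k + 1))"
proof -
  have *: "k + 3 - 1 = k + 2" "k + 3 - 2 = k + 1" "k + 3 - 3 = k" "\<not> k + 3 < 3"
    by auto
  show ?thesis
    by (subst kdv_coeff.simps) (simp only: * if_False)
qed

lemma nat_induct3_below:
  assumes "\<And>k::nat. k < 3 \<Longrightarrow> P k" and "\<And>k. (\<And>i. i \<le> k + 2 \<Longrightarrow> P i) \<Longrightarrow> P (k + 3)"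
  shows "P k"
proof (induction k rule: less_induct)
  case (less k)
  show ?case
  proof (cases "k < 3")
    case False
    then obtain m where "k = m + 3"
      by (metis add.commute le_add_diff_inverse not_less)
    then show ?thesis using assms(2)[of m] less by auto
  qed (rule assms(1))
qed

text \<open>Serves to sum the series in closed form for two kinds of data: zero data, and the Taylor
  data of the soliton.\<close>

lemma kdv_coeff_unique:
  assumes "\<And>k n. k < 3 \<Longrightarrow> Z k n = c k n"
    and "\<And>k n. real ((k + 3) * (k + 2) * (k + 1)) * Z (k + 3) n =
      - (Z k (Suc n) + (\<Sum>i\<le>k. real (k + 1 - i) * leib (Z i) (Z (k + 1 - i)) n))"
  shows "kdv_coeff c k = Z k"
proof (induction k rule: nat_induct3_below)
  case (1 k)
  then show ?case using assms(1) by (auto simp: kdv_coeff_init)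
next
  case (2 k)
  show ?case
  proof
    fix n
    have "(\<Sum>i\<le>k. real (k + 1 - i) * leib (kdv_coeff c i) (kdv_coeff c (k + 1 - i)) n)
        = (\<Sum>i\<le>k. real (k + 1 - i) * leib (Z i) (Z (k + 1 - i)) n)"
      by (rule sum.cong) (simp_all add: 2)
    then have "kdv_coeff c (k + 3) n = real ((k + 3) * (k + 2) * (k + 1)) * Z (k + 3) n
        / real ((k + 3) * (k + 2) * (k + 1))"
      unfolding kdv_coeff_step assms(2) using 2[of k] by simp
    also have "\<dots> = Z (k + 3) n"
      by (rule nonzero_mult_div_cancel_left) (unfold of_nat_eq_0_iff, simp)
    finally show "kdv_coeff c (k + 3) n = Z (k + 3) n" .
  qed
qed

text \<open>In \<open>kdv_coeff\<close> the index \<open>n\<close> is formal, since the recursion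
  acts on numbers at one fixed time. Here it becomes a genuine order of differentiation, as the
  Leibniz sums commute with the derivative.\<close>

lemma kdv_coeff_has_derivative:
  assumes "\<And>k. k < 3 \<Longrightarrow> tower S (\<lambda>n t. c t k n)"
  shows "tower S (\<lambda>n t. kdv_coeff (c t) k n)"
proof (induction k rule: nat_induct3_below)
  case (1 k)
  then show ?case using assms by (simp add: kdv_coeff_init)
next
  case (2 k)
  show ?case
    unfolding tower_def
  proof (intro allI ballI)
    fix n t assume t: "t \<in> S"
    have "((\<lambda>t. leib (kdv_coeff (c t) i) (kdv_coeff (c t) (k + 1 - i)) n) has_real_derivative
        leib (kdv_coeff (c t) i) (kdv_coeff (c t) (k + 1 - i)) (Suc n)) (at t within S)"
      if "i \<le> k" for i
      using leib_has_derivative[OF 2[of i] 2[of "k + 1 - i"] t] that by simp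
    then have *: "((\<lambda>t. \<Sum>i\<le>k. real (k + 1 - i) * leib (kdv_coeff (c t) i) (kdv_coeff (c t) (k + 1 - i)) n)
        has_real_derivative
        (\<Sum>i\<le>k. real (k + 1 - i) * leib (kdv_coeff (c t) i) (kdv_coeff (c t) (k + 1 - i)) (Suc n)))
        (at t within S)"
      by (intro DERIV_sum DERIV_cmult) auto
    show "((\<lambda>t. kdv_coeff (c t) (k + 3) n) has_real_derivative kdv_coeff (c t) (k + 3) (Suc n))
        (at t within S)"
      unfolding kdv_coeff_step
      by (intro DERIV_cdivide DERIV_minus DERIV_add * towerD[OF 2[of k] t]) simp
  qed
qed

section \<open>Binomial inequalities and factorial majorants\<close>

lemma binomial_mult_le: "(a choose i) * (b choose j) \<le> (a + b) choose (i + j)"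
proof -
  have "(a choose i) * (b choose (i + j - i)) \<le> (\<Sum>l\<le>i + j. (a choose l) * (b choose (i + j - l)))"
    by (rule member_le_sum[of i "{..i+j}" "\<lambda>l. (a choose l) * (b choose (i + j - l))"]) auto
  then show ?thesis by (simp add: vandermonde)
qed

text \<open>Makes the majorants below compatible with Leibniz products. The inserted factor
  \<open>(2 * n) choose (2 * j)\<close>, which is at least \<open>1\<close>, raises the upper index
  from \<open>n + m\<close> to \<open>3 * n + m\<close>.\<close>

lemma binomial_pair_fact_le:
  assumes "j \<le> n" "i \<le> m"
  shows "(n choose j) * (m choose i) * (fact (3 * j + i) * fact (3 * (n - j) + (m - i)))
    \<le> (fact (3 * n + m) :: nat)"
proof -
  have "(n choose j) * (m choose i) \<le> (n + m) choose (j + i)"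
    by (rule binomial_mult_le)
  also have "\<dots> \<le> ((n + m) choose (j + i)) * ((2 * n) choose (2 * j))"
    using assms by (simp add: Suc_le_eq)
  also have "\<dots> \<le> (n + m + 2 * n) choose (j + i + 2 * j)"
    by (rule binomial_mult_le)
  finally have le: "(n choose j) * (m choose i) \<le> (3 * n + m) choose (3 * j + i)"
    by (simp add: algebra_simps)
  have "3 * j + i \<le> 3 * n + m" "3 * n + m - (3 * j + i) = 3 * (n - j) + (m - i)"
    using assms by auto
  then have "fact (3 * j + i) * fact (3 * (n - j) + (m - i)) * ((3 * n + m) choose (3 * j + i))
      = (fact (3 * n + m) :: nat)"
    using binomial_fact_lemma[of "3 * j + i" "3 * n + m"] by simp
  then show ?thesis
    using mult_right_mono[OF le, of "fact (3 * j + i) * fact (3 * (n - j) + (m - i))"]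
    by (simp add: mult.commute)
qed

text \<open>Gevrey bounds of order \<open>3\<close> in time with a decay \<open>B\<^sup>k\<close> in the space index: the recursion, which
  trades three space derivatives for one time derivative, preserves them.\<close>

definition kdv_majorant :: "real \<Rightarrow> real \<Rightarrow> real \<Rightarrow> nat \<Rightarrow> nat \<Rightarrow> real" where
  "kdv_majorant e A B k n = e * A ^ n * B ^ k * fact (3 * n + k) / fact k"

lemma kdv_majorant_nonneg: "0 \<le> e \<Longrightarrow> 0 \<le> A \<Longrightarrow> 0 \<le> B \<Longrightarrow> 0 \<le> kdv_majorant e A B k n"
  by (simp add: kdv_majorant_def)

text \<open>All \<open>n + 1\<close> terms of the Leibniz sum obey the same bound, however
  \<open>m\<close> is split. The factor \<open>n + 1\<close> remains, to be absorbed by the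
  factorial in the recursion.\<close>

lemma leib_majorant_le:
  assumes e: "0 \<le> e" and A: "0 \<le> A" and B: "0 \<le> B"
    and f: "\<And>n. \<bar>f n\<bar> \<le> kdv_majorant e A B i n" and g: "\<And>n. \<bar>g n\<bar> \<le> kdv_majorant e A B (m - i) n"
    and i: "i \<le> m"
  shows "\<bar>leib f g n\<bar> \<le> e\<^sup>2 * A ^ n * B ^ m * real (n + 1) * fact (3 * n + m) / fact m"
proof -
  have "\<bar>real (n choose j) * f j * g (n - j)\<bar> \<le> e\<^sup>2 * A ^ n * B ^ m * fact (3 * n + m) / fact m"
    if j: "j \<le> n" for j
  proof -
    have "real ((n choose j) * (m choose i) * (fact (3 * j + i) * fact (3 * (n - j) + (m - i))))
        \<le> real (fact (3 * n + m))"
      using binomial_pair_fact_le[OF j i] by (simp only: of_nat_le_iff)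
    moreover have "real (m choose i) = fact m / (fact i * fact (m - i))"
      by (rule binomial_fact[OF i])
    ultimately have le: "real (n choose j) * (fact (3 * j + i) * fact (3 * (n - j) + (m - i)))
        / (fact i * fact (m - i)) \<le> fact (3 * n + m) / fact m"
      by (simp add: field_simps)
    have "\<bar>f j\<bar> * \<bar>g (n - j)\<bar> \<le> kdv_majorant e A B i j * kdv_majorant e A B (m - i) (n - j)"
      by (rule mult_mono) (use f g kdv_majorant_nonneg[OF e A B] in auto)
    then have "\<bar>real (n choose j) * f j * g (n - j)\<bar>
        \<le> real (n choose j) * (kdv_majorant e A B i j * kdv_majorant e A B (m - i) (n - j))"
      by (simp add: abs_mult mult.assoc mult_left_mono)
    also have "\<dots> = (e\<^sup>2 * (A ^ j * A ^ (n - j)) * (B ^ i * B ^ (m - i))) *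
        (real (n choose j) * (fact (3 * j + i) * fact (3 * (n - j) + (m - i)))
        / (fact i * fact (m - i)))"
      by (simp add: kdv_majorant_def power2_eq_square)
    also have "\<dots> \<le> (e\<^sup>2 * (A ^ j * A ^ (n - j)) * (B ^ i * B ^ (m - i))) * (fact (3 * n + m) / fact m)"
      by (rule mult_left_mono[OF le]) (use A B in auto)
    also have "A ^ j * A ^ (n - j) = A ^ n"
      using j by (simp flip: power_add)
    also have "B ^ i * B ^ (m - i) = B ^ m"
      using i by (simp flip: power_add)
    finally show ?thesis by simp
  qed
  then have "\<bar>leib f g n\<bar> \<le> (\<Sum>j\<le>n. e\<^sup>2 * A ^ n * B ^ m * fact (3 * n + m) / fact m)"
    unfolding leib_def by (intro order_trans[OF sum_abs] sum_mono) auto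
  then show ?thesis by (simp add: mult_ac)
qed

text \<open>Passing from \<open>n\<close> to \<open>Suc n\<close> and from \<open>k\<close> to
  \<open>k + 3\<close> raise the factorial argument equally, so the linear term leaves only the
  ratio of \<open>A\<close> to \<open>B ^ 3\<close>. The quadratic term reaches
  \<open>3 * n + k + 1\<close> only; the two missing factors of the factorial absorb
  \<open>n + 1\<close> and the number of summands, and the ratio of \<open>e\<close> to
  \<open>B\<^sup>2\<close> is left.\<close>

lemma kdv_coeff_majorant:
  assumes e: "0 \<le> e" "2 * e \<le> B\<^sup>2" and A: "0 \<le> A" "2 * A \<le> B ^ 3" and B: "0 < B"
    and init: "\<And>k n. k < 3 \<Longrightarrow> \<bar>c k n\<bar> \<le> kdv_majorant e A B k n"
  shows "\<bar>kdv_coeff c k n\<bar> \<le> kdv_majorant e A B k n"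
proof (induction k arbitrary: n rule: nat_induct3_below)
  case (1 k)
  then show ?case using init by (simp add: kdv_coeff_init)
next
  case (2 k)
  define D where "D = real ((k + 3) * (k + 2) * (k + 1))"
  \<comment> \<open>\<open>W / D\<close> is the desired majorant; each of the two terms of the
    recursion may use half of \<open>W\<close>.\<close>
  define W where "W = e * A ^ n * B ^ (k + 3) * fact (3 * n + k + 3) / fact k"
  have D: "D > 0" unfolding D_def of_nat_0_less_iff by simp
  have W: "kdv_majorant e A B (k + 3) n = W / D"
  proof -
    have "fact (k + 3) = D * fact k"
      by (simp add: D_def eval_nat_numeral algebra_simps)
    then show ?thesis using D by (simp add: kdv_majorant_def W_def add.assoc)
  qed
  have first: "\<bar>kdv_coeff c k (Suc n)\<bar> \<le> W / 2"
  proof -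
    have "\<bar>kdv_coeff c k (Suc n)\<bar> \<le> (e * A ^ n * B ^ k * fact (3 * n + k + 3) / fact k) * A"
      using 2[of k "Suc n"] by (simp add: kdv_majorant_def algebra_simps)
    also have "\<dots> \<le> (e * A ^ n * B ^ k * fact (3 * n + k + 3) / fact k) * (B ^ 3 / 2)"
      using A e B by (intro mult_left_mono) auto
    finally show ?thesis by (simp add: W_def power_add mult_ac)
  qed
  have second: "\<bar>\<Sum>i\<le>k. real (k + 1 - i) * leib (kdv_coeff c i) (kdv_coeff c (k + 1 - i)) n\<bar> \<le> W / 2"
  proof -
    define V where "V = e\<^sup>2 * A ^ n * B ^ (k + 1) * real (n + 1) * fact (3 * n + (k + 1)) / fact (k + 1)"
    have V0: "V \<ge> 0" using A B by (simp add: V_def)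
    have "\<bar>real (k + 1 - i) * leib (kdv_coeff c i) (kdv_coeff c (k + 1 - i)) n\<bar> \<le> real (k + 1) * V"
      if "i \<le> k" for i
    proof -
      have "\<bar>leib (kdv_coeff c i) (kdv_coeff c (k + 1 - i)) n\<bar> \<le> V"
        unfolding V_def using that A e B by (intro leib_majorant_le[where i = i]) (auto intro!: 2)
      moreover have "real (k + 1 - i) \<le> real (k + 1)" by simp
      ultimately show ?thesis
        unfolding abs_mult abs_of_nat by (intro mult_mono) auto
    qed
    then have "\<bar>\<Sum>i\<le>k. real (k + 1 - i) * leib (kdv_coeff c i) (kdv_coeff c (k + 1 - i)) n\<bar>
        \<le> (\<Sum>i\<le>k. real (k + 1) * V)"
      by (intro order_trans[OF sum_abs] sum_mono) auto
    also have "\<dots> = (e * A ^ n * B ^ (k + 1) * fact (3 * n + k + 1) / fact k) * (real (n + 1) * real (k + 1)) * e"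
    proof -
      have "fact (k + 1) = real (k + 1) * fact k" by simp
      then have "real (k + 1) * V = e\<^sup>2 * A ^ n * B ^ (k + 1) * real (n + 1) * fact (3 * n + (k + 1)) / fact k"
        by (simp only: V_def) (simp del: fact_Suc of_nat_add of_nat_Suc)
      then show ?thesis
        by (simp add: power2_eq_square mult_ac del: fact_Suc of_nat_add of_nat_Suc power_Suc)
    qed
    also have "\<dots> \<le> (e * A ^ n * B ^ (k + 1) * fact (3 * n + k + 1) / fact k)
        * (real (3 * n + k + 3) * real (3 * n + k + 2)) * (B\<^sup>2 / 2)"
      using e A B by (intro mult_mono) auto
    also have "\<dots> = W / 2"
    proof -
      have "(fact (3 * n + k + 3) :: real) = real (3 * n + k + 3) * real (3 * n + k + 2) * fact (3 * n + k + 1)"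
        by (simp add: eval_nat_numeral algebra_simps)
      then show ?thesis
        by (simp add: W_def eval_nat_numeral mult_ac)
    qed
    finally show ?thesis .
  qed
  have "\<bar>kdv_coeff c (k + 3) n\<bar> = \<bar>kdv_coeff c k (Suc n)
      + (\<Sum>i\<le>k. real (k + 1 - i) * leib (kdv_coeff c i) (kdv_coeff c (k + 1 - i)) n)\<bar> / D"
    unfolding kdv_coeff_step D_def by (simp only: abs_divide abs_minus_cancel abs_of_nat)
  also have "\<dots> \<le> W / D"
    using first second D by (intro divide_right_mono) auto
  finally show ?case by (simp add: W)
qed


section \<open>Power series with geometrically decaying coefficients\<close>

lemma summable_poly_geometric:
  fixes q :: real
  assumes "0 \<le> q" "q < 1"
  shows "summable (\<lambda>k. real (Suc k) ^ p * q ^ k)"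
  using assms
proof (induction p arbitrary: q)
  case 0
  then show ?case by (simp add: summable_geometric)
next
  case (Suc p)
  \<comment> \<open>Differentiating the series for \<open>p\<close> supplies one more factor
    \<open>Suc k\<close>; the index shift only enlarges the other factors.\<close>
  have "summable (\<lambda>k. diffs (\<lambda>k. real (Suc k) ^ p) k * q ^ k)"
  proof (rule termdiff_converges[where K = 1])
    fix x :: real assume "norm x < 1"
    then show "summable (\<lambda>n. real (Suc n) ^ p * x ^ n)"
      by (intro summable_rabs_cancel[OF Suc.IH[of "\<bar>x\<bar>", THEN back_subst[where P = summable]]])
         (auto simp: abs_mult power_abs)
  qed (use Suc.prems in simp)
  then show ?case
  proof (rule summable_comparison_test_ev[rotated])
    have "real (Suc k) * real (Suc k) ^ p * q ^ k \<le> real (Suc k) * real (Suc (Suc k)) ^ p * q ^ k" for k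
      using Suc.prems by (intro mult_right_mono mult_left_mono power_mono) auto
    then show "\<forall>\<^sub>F k in sequentially. norm (real (Suc k) ^ Suc p * q ^ k)
        \<le> diffs (\<lambda>k. real (Suc k) ^ p) k * q ^ k"
      using Suc.prems by (intro always_eventually allI) (simp add: diffs_def abs_mult)
  qed
qed

text \<open>Coefficient families of power series in \<open>X\<close> that converge on \<open>\<bar>X\<bar> < 2 R\<close>, locally
  uniformly and uniformly in the parameter \<open>t \<in> S\<close>.\<close>

definition geom_bounded :: "real set \<Rightarrow> real \<Rightarrow> (nat \<Rightarrow> real \<Rightarrow> real) \<Rightarrow> bool" where
  "geom_bounded S R f \<longleftrightarrow>
     (\<exists>C p. 0 \<le> C \<and> (\<forall>k. \<forall>t\<in>S. \<bar>f k t\<bar> * R ^ k \<le> C * real (Suc k) ^ p * (1/2) ^ k))"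

text \<open>The reason for the polynomial factor in \<open>geom_bounded\<close>: a derivative in
  \<open>X\<close> raises its degree by one and leaves \<open>R\<close> unchanged.\<close>

lemma geom_bounded_diffs:
  assumes "geom_bounded S R f" "R > 0"
  shows "geom_bounded S R (\<lambda>k t. diffs (\<lambda>k. f k t) k)"
proof -
  obtain C p where C: "0 \<le> C"
    "\<And>k t. t \<in> S \<Longrightarrow> \<bar>f k t\<bar> * R ^ k \<le> C * real (Suc k) ^ p * (1/2) ^ k"
    using assms(1) unfolding geom_bounded_def by blast
  have "\<bar>diffs (\<lambda>k. f k t) k\<bar> * R ^ k \<le> (C * 2 ^ p / R) * real (Suc k) ^ Suc p * (1/2) ^ k"
    if "t \<in> S" for k t
  proof -
    have "\<bar>diffs (\<lambda>k. f k t) k\<bar> * R ^ k = real (Suc k) / R * (\<bar>f (Suc k) t\<bar> * R ^ Suc k)"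
      using assms(2) by (simp add: diffs_def abs_mult)
    also have "\<dots> \<le> real (Suc k) / R * (C * real (Suc (Suc k)) ^ p * (1/2) ^ Suc k)"
      by (rule mult_left_mono[OF C(2)[OF that]]) (use assms(2) in simp)
    also have "\<dots> \<le> real (Suc k) / R * (C * (2 * real (Suc k)) ^ p * (1/2) ^ k)"
      using C(1) assms(2) by (intro mult_left_mono mult_mono power_mono) auto
    finally show ?thesis by (simp only: power_mult_distrib) (simp add: mult_ac)
  qed
  moreover have "0 \<le> C * 2 ^ p / R" using C(1) assms(2) by simp
  ultimately show ?thesis unfolding geom_bounded_def by blast
qed

lemma geom_bounded_summable:
  assumes "geom_bounded S R f" "R > 0" "t \<in> S" "\<bar>x\<bar> < 2 * R"
  shows "summable (\<lambda>k. \<bar>f k t * x ^ k\<bar>)"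
proof -
  obtain C p where C: "0 \<le> C"
    "\<And>k t. t \<in> S \<Longrightarrow> \<bar>f k t\<bar> * R ^ k \<le> C * real (Suc k) ^ p * (1/2) ^ k"
    using assms(1) unfolding geom_bounded_def by blast
  define q where "q = \<bar>x\<bar> / (2 * R)"
  have q: "0 \<le> q" "q < 1" using assms by (auto simp: q_def)
  have "summable (\<lambda>k. C * (real (Suc k) ^ p * q ^ k))"
    by (intro summable_mult summable_poly_geometric q)
  then show ?thesis
  proof (rule summable_comparison_test_ev[rotated])
    have "\<bar>f k t * x ^ k\<bar> \<le> C * (real (Suc k) ^ p * q ^ k)" for k
    proof -
      have "\<bar>f k t * x ^ k\<bar> = (\<bar>f k t\<bar> * R ^ k) * (2 * q) ^ k"
        using assms(2) by (simp add: q_def abs_mult power_abs power_divide)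
      also have "\<dots> \<le> (C * real (Suc k) ^ p * (1/2) ^ k) * (2 * q) ^ k"
        using C(2)[OF assms(3)] q by (intro mult_right_mono) auto
      finally show ?thesis by (simp add: power_divide power_mult_distrib)
    qed
    then show "\<forall>\<^sub>F k in sequentially. norm \<bar>f k t * x ^ k\<bar> \<le> C * (real (Suc k) ^ p * q ^ k)"
      by simp
  qed
qed

text \<open>On half the radius of convergence the decay \<open>(1/2) ^ k\<close> is still available,
  uniformly in \<open>x\<close> and \<open>t\<close>.\<close>

lemma geom_bounded_m_test:
  assumes "geom_bounded S R f" "R > 0"
  obtains M where "summable M" "\<And>k t x. t \<in> S \<Longrightarrow> \<bar>x\<bar> \<le> R \<Longrightarrow> \<bar>f k t * x ^ k\<bar> \<le> M k"
proof -
  obtain C p where C: "0 \<le> C"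
    "\<And>k t. t \<in> S \<Longrightarrow> \<bar>f k t\<bar> * R ^ k \<le> C * real (Suc k) ^ p * (1/2) ^ k"
    using assms(1) unfolding geom_bounded_def by blast
  have "summable (\<lambda>k. C * (real (Suc k) ^ p * (1/2) ^ k))"
    by (intro summable_mult summable_poly_geometric) auto
  moreover have "\<bar>f k t * x ^ k\<bar> \<le> C * (real (Suc k) ^ p * (1/2) ^ k)" if "t \<in> S" "\<bar>x\<bar> \<le> R" for k t x
  proof -
    have "\<bar>f k t * x ^ k\<bar> \<le> \<bar>f k t\<bar> * R ^ k"
      using that by (simp add: abs_mult power_abs mult_left_mono power_mono)
    then show ?thesis using C(2)[OF that(1), of k] by simp
  qed
  ultimately show ?thesis by (rule that)
qed

lemma geom_bounded_has_derivative:
  assumes "geom_bounded S R f" "R > 0" "t \<in> S" "\<bar>x\<bar> \<le> R"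
  shows "((\<lambda>x. \<Sum>k. f k t * x ^ k) has_real_derivative (\<Sum>k. diffs (\<lambda>k. f k t) k * x ^ k)) (at x)"
proof (rule termdiffs_strong'[where K = "2 * R"])
  fix z :: real assume "norm z < 2 * R"
  then show "summable (\<lambda>n. f n t * z ^ n)"
    using geom_bounded_summable[OF assms(1-3)] summable_rabs_cancel by simp
qed (use assms in auto)

lemma geom_bounded_continuous:
  assumes "geom_bounded S R f" "R > 0" and cont: "\<And>k. continuous_on S (f k)"
    and D: "\<And>x t. (x, t) \<in> D \<Longrightarrow> t \<in> S \<and> \<bar>x - t\<bar> \<le> R"
  shows "continuous_on D (\<lambda>(x, t). \<Sum>k. f k t * (x - t) ^ k)"
proof -
  obtain M where M: "summable M" "\<And>k t x. t \<in> S \<Longrightarrow> \<bar>x\<bar> \<le> R \<Longrightarrow> \<bar>f k t * x ^ k\<bar> \<le> M k"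
    using geom_bounded_m_test[OF assms(1,2)] by metis
  define g where "g = (\<lambda>k p. f k (snd p) * (fst p - snd p) ^ k)"
  have "uniform_limit D (\<lambda>n p. \<Sum>k<n. g k p) (\<lambda>p. \<Sum>k. g k p) sequentially"
    by (rule Weierstrass_m_test[OF _ M(1)]) (use M(2) D in \<open>auto simp: g_def\<close>)
  moreover have "continuous_on D (g k)" for k
  proof -
    have "continuous_on D (\<lambda>p. f k (snd p))"
      by (rule continuous_on_compose2[OF cont]) (use D in \<open>auto intro!: continuous_intros\<close>)
    then show ?thesis unfolding g_def by (intro continuous_intros)
  qed
  ultimately have "continuous_on D (\<lambda>p. \<Sum>k. g k p)"
    by (intro uniform_limit_theorem[OF always_eventually]) (auto intro!: continuous_intros)
  then show ?thesis by (simp add: g_def case_prod_beta)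
qed

text \<open>The space derivatives are continuous up to the boundary and one-sided there, so
  solutions on adjacent time intervals can be glued and boundary values read off. The time
  derivative is given by the equation itself.\<close>

definition classical_KdV :: "real \<Rightarrow> real \<Rightarrow> real \<Rightarrow> (real \<Rightarrow> real \<Rightarrow> real) \<Rightarrow> bool" where
  "classical_KdV L a b y \<longleftrightarrow> (\<exists>y1 y2 y3.
     continuous_on ({0..L} \<times> {a..b}) (\<lambda>(x, t). y x t) \<and>
     continuous_on ({0..L} \<times> {a..b}) (\<lambda>(x, t). y1 x t) \<and>
     continuous_on ({0..L} \<times> {a..b}) (\<lambda>(x, t). y2 x t) \<and>
     continuous_on ({0..L} \<times> {a..b}) (\<lambda>(x, t). y3 x t) \<and>
     (\<forall>x\<in>{0..L}. \<forall>t\<in>{a..b}.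
        ((\<lambda>x. y x t) has_real_derivative y1 x t) (at x within {0..L}) \<and>
        ((\<lambda>x. y1 x t) has_real_derivative y2 x t) (at x within {0..L}) \<and>
        ((\<lambda>x. y2 x t) has_real_derivative y3 x t) (at x within {0..L}) \<and>
        (y x has_real_derivative - (y1 x t + y3 x t + y x t * y1 x t)) (at t within {a..b})))"

lemma kdv_majorant_0: "kdv_majorant e A B k 0 = e * B ^ k"
  by (simp add: kdv_majorant_def)

lemma kdv_majorant_1: "kdv_majorant e A B k 1 = e * A * real ((k + 1) * (k + 2) * (k + 3)) * B ^ k"
proof -
  have "(fact (k + 3) :: real) = real ((k + 1) * (k + 2) * (k + 3)) * fact k"
    by (simp add: eval_nat_numeral algebra_simps)
  then show ?thesis by (simp add: kdv_majorant_def add.commute)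
qed

text \<open>The recursion at \<open>n = 0\<close>, read as the coefficient of \<open>X ^ k\<close>
  in the equation; the sum is the Cauchy product of the series with its derivative.\<close>

lemma kdv_series_coeff_identity:
  fixes f :: "nat \<Rightarrow> real"
  assumes "\<And>k. f k = kdv_coeff c k 0"
  shows "kdv_coeff c k 1 = - (diffs (diffs (diffs f)) k + (\<Sum>i\<le>k. f i * diffs f (k - i)))"
proof -
  have "(\<Sum>i\<le>k. real (k + 1 - i) * leib (kdv_coeff c i) (kdv_coeff c (k + 1 - i)) 0)
      = (\<Sum>i\<le>k. f i * diffs f (k - i))"
    by (rule sum.cong) (auto simp: assms diffs_def Suc_diff_le)
  moreover have "diffs (diffs (diffs f)) k = real ((k + 3) * (k + 2) * (k + 1)) * kdv_coeff c (k + 3) 0"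
    by (simp add: diffs_def assms eval_nat_numeral algebra_simps)
  moreover have "real ((k + 3) * (k + 2) * (k + 1)) * kdv_coeff c (k + 3) 0 =
     - (kdv_coeff c k 1
        + (\<Sum>i\<le>k. real (k + 1 - i) * leib (kdv_coeff c i) (kdv_coeff c (k + 1 - i)) 0))"
  proof -
    have "real ((k + 3) * (k + 2) * (k + 1)) \<noteq> 0" unfolding of_nat_eq_0_iff by simp
    moreover have "a = b / X \<Longrightarrow> X \<noteq> 0 \<Longrightarrow> X * a = b" for a b X :: real
      by simp
    ultimately show ?thesis
      using kdv_coeff_step[of c k 0, folded One_nat_def] by blast
  qed
  ultimately show ?thesis by simp
qed

text \<open>The condition \<open>2 * B * R \<le> 1\<close> keeps the box within half the radius of
  convergence, where the geometric series of ratio \<open>1/2\<close> gives the bound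
  \<open>2 * e\<close>. The expansion point \<open>x = t\<close> moves, so differentiation in time
  at fixed \<open>x\<close> yields an additional \<open>- Y_X\<close>, which is the transport
  term.\<close>

lemma classical_KdV_series:
  fixes c :: "real \<Rightarrow> nat \<Rightarrow> nat \<Rightarrow> real"
  assumes e: "0 \<le> e" "2 * e \<le> B\<^sup>2" and A: "0 \<le> A" "2 * A \<le> B ^ 3" and B: "0 < B" "2 * B * R \<le> 1"
    and R: "R > 0"
    and box: "\<And>x t. x \<in> {0..L} \<Longrightarrow> t \<in> {a..b} \<Longrightarrow> \<bar>x - t\<bar> \<le> R"
    and tow: "\<And>k. k < 3 \<Longrightarrow> tower {a..b} (\<lambda>n t. c t k n)"
    and init: "\<And>k n t. k < 3 \<Longrightarrow> t \<in> {a..b} \<Longrightarrow> \<bar>c t k n\<bar> \<le> kdv_majorant e A B k n"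
  defines "y \<equiv> \<lambda>x t. \<Sum>k. kdv_coeff (c t) k 0 * (x - t) ^ k"
  shows "classical_KdV L a b y" (is ?classical)
    and "\<And>x t. x \<in> {0..L} \<Longrightarrow> t \<in> {a..b} \<Longrightarrow> \<bar>y x t\<bar> \<le> 2 * e" (is "\<And>x t. _ \<Longrightarrow> _ \<Longrightarrow> ?bound x t")
proof -
  let ?S = "{a..b}"
  define f where "f = (\<lambda>k t. kdv_coeff (c t) k 0)"
  define g where "g = (\<lambda>k t. kdv_coeff (c t) k 1)"
  have maj: "\<bar>kdv_coeff (c t) k n\<bar> \<le> kdv_majorant e A B k n" if "t \<in> ?S" for t k n
    by (rule kdv_coeff_majorant) (use assms that in auto)
  have BR: "0 \<le> B * R" "B * R \<le> 1/2" using B R by auto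
  then have BRk: "B ^ k * R ^ k \<le> (1/2) ^ k" for k
    by (metis power_mono power_mult_distrib)
  have f_le: "\<bar>f k t\<bar> * R ^ k \<le> e * (1/2) ^ k" if "t \<in> ?S" for k t
  proof -
    have "\<bar>f k t\<bar> * R ^ k \<le> e * B ^ k * R ^ k"
      using maj[OF that, of k 0] R by (intro mult_right_mono) (auto simp: f_def kdv_majorant_0)
    also have "\<dots> \<le> e * (1/2) ^ k"
      using mult_left_mono[OF BRk e(1)] by (simp add: mult.assoc)
    finally show ?thesis .
  qed
  have gf: "geom_bounded ?S R f"
    unfolding geom_bounded_def using f_le e by (intro exI[of _ e] exI[of _ 0]) auto
  have gg: "geom_bounded ?S R g"
  proof -
    have "\<bar>g k t\<bar> * R ^ k \<le> (e * A * 6) * real (Suc k) ^ 3 * (1/2) ^ k" if "t \<in> ?S" for k t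
    proof -
      have "real ((k + 1) * (k + 2) * (k + 3)) \<le> real ((k + 1) * (2 * (k + 1)) * (3 * (k + 1)))"
        unfolding of_nat_le_iff by (intro mult_le_mono) auto
      then have 6: "real ((k + 1) * (k + 2) * (k + 3)) \<le> 6 * real (Suc k) ^ 3"
        by (simp add: power3_eq_cube algebra_simps)
      have "\<bar>g k t\<bar> * R ^ k \<le> e * A * real ((k + 1) * (k + 2) * (k + 3)) * B ^ k * R ^ k"
        using maj[OF that, of k 1] R unfolding kdv_majorant_1
        by (intro mult_right_mono) (auto simp: g_def)
      also have "\<dots> = (e * A * real ((k + 1) * (k + 2) * (k + 3))) * (B ^ k * R ^ k)"
        by simp
      also have "\<dots> \<le> (e * A * (6 * real (Suc k) ^ 3)) * (1/2) ^ k"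
        by (intro mult_mono BRk mult_left_mono 6) (use e A B R in auto)
      finally show ?thesis by (simp add: mult_ac)
    qed
    moreover have "0 \<le> e * A * 6" using e A by simp
    ultimately show ?thesis unfolding geom_bounded_def by blast
  qed
  have ft: "(f k has_real_derivative g k t) (at t within ?S)" if "t \<in> ?S" for k t
    using towerD[OF kdv_coeff_has_derivative[where c = c and k = k, OF tow] that, where n = 0] by (simp add: f_def g_def)
  have cf: "continuous_on ?S (f k)" for k
    by (rule DERIV_continuous_on[OF ft])
  define d :: "(nat \<Rightarrow> real \<Rightarrow> real) \<Rightarrow> nat \<Rightarrow> real \<Rightarrow> real"
    where "d = (\<lambda>h k t. diffs (\<lambda>k. h k t) k)"
  define s :: "(nat \<Rightarrow> real \<Rightarrow> real) \<Rightarrow> real \<Rightarrow> real \<Rightarrow> real"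
    where "s = (\<lambda>h x t. \<Sum>k. h k t * (x - t) ^ k)"
  have cd: "continuous_on ?S (d h k)" if "\<And>k. continuous_on ?S (h k)" for h k
    unfolding d_def diffs_def by (intro continuous_intros that)
  have gd: "geom_bounded ?S R (d h)" if "geom_bounded ?S R h" for h
    using geom_bounded_diffs[OF that R] by (simp add: d_def)
  have contS: "continuous_on ({0..L} \<times> ?S) (\<lambda>(x, t). s h x t)"
    if "geom_bounded ?S R h" "\<And>k. continuous_on ?S (h k)" for h
    unfolding s_def by (rule geom_bounded_continuous[OF that(1) R that(2)]) (use box in auto)
  have derS: "((\<lambda>x. s h x t) has_real_derivative s (d h) x t) (at x within {0..L})"
    if "geom_bounded ?S R h" "x \<in> {0..L}" "t \<in> ?S" for h x t
  proof -
    have "((\<lambda>x. x - t) has_real_derivative 1) (at x within {0..L})"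
      by (auto intro!: derivative_eq_intros)
    from DERIV_chain2[OF geom_bounded_has_derivative[OF that(1) R that(3) box[OF that(2,3)]] this]
    show ?thesis by (simp add: s_def d_def)
  qed
  have ys: "y = s f" by (simp add: y_def s_def f_def)
  have summ: "summable (\<lambda>k. \<bar>h k t * (x - t) ^ k\<bar>)"
    if "geom_bounded ?S R h" "x \<in> {0..L}" "t \<in> ?S" for h x t
    using geom_bounded_summable[OF that(1) R that(3)] box[OF that(2,3)] R by auto
  \<comment> \<open>Compare coefficients in the moving frame, then subtract the transport term
    \<open>s (d f) x t\<close> on both sides.\<close>
  have eqn: "s g x t - s (d f) x t = - (s (d f) x t + s (d (d (d f))) x t + s f x t * s (d f) x t)"
    if xt: "x \<in> {0..L}" "t \<in> ?S" for x t
  proof -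
    define z where "z = x - t"
    have "(\<lambda>k. \<Sum>i\<le>k. (f i t * z ^ i) * (d f (k - i) t * z ^ (k - i))) sums (s f x t * s (d f) x t)"
      unfolding s_def z_def
      by (rule Cauchy_product_sums) (use summ[OF gf xt] summ[OF gd[OF gf] xt] in auto)
    moreover have "(\<Sum>i\<le>k. (f i t * z ^ i) * (d f (k - i) t * z ^ (k - i)))
        = (\<Sum>i\<le>k. f i t * d f (k - i) t) * z ^ k" for k
      unfolding sum_distrib_right
    proof (rule sum.cong)
      fix i assume "i \<in> {..k}"
      then have "z ^ k = z ^ i * z ^ (k - i)" by (simp flip: power_add)
      then show "f i t * z ^ i * (d f (k - i) t * z ^ (k - i)) = f i t * d f (k - i) t * z ^ k" by simp
    qed simp
    ultimately have "(\<lambda>k. (\<Sum>i\<le>k. f i t * d f (k - i) t) * z ^ k) sums (s f x t * s (d f) x t)"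
      by simp
    moreover have "(\<lambda>k. d (d (d f)) k t * z ^ k) sums s (d (d (d f))) x t"
      unfolding s_def z_def using summ[OF gd[OF gd[OF gd[OF gf]]] xt]
      by (rule summable_sums[OF summable_rabs_cancel])
    ultimately have "(\<lambda>k. - (d (d (d f)) k t * z ^ k + (\<Sum>i\<le>k. f i t * d f (k - i) t) * z ^ k))
        sums - (s (d (d (d f))) x t + s f x t * s (d f) x t)"
      by (intro sums_minus sums_add)
    moreover have "- (d (d (d f)) k t * z ^ k + (\<Sum>i\<le>k. f i t * d f (k - i) t) * z ^ k)
        = g k t * z ^ k" for k
    proof -
      have "g k t = - (d (d (d f)) k t + (\<Sum>i\<le>k. f i t * d f (k - i) t))"
        using kdv_series_coeff_identity[where f = "\<lambda>k. f k t" and c = "c t" and k = k]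
        by (simp add: f_def g_def d_def)
      then show ?thesis by (simp add: distrib_right left_diff_distrib)
    qed
    ultimately have "s g x t = - (s (d (d (d f))) x t + s f x t * s (d f) x t)"
      unfolding s_def z_def[symmetric] by (simp add: sums_iff)
    then show ?thesis by simp
  qed
  have derT: "(s f x has_real_derivative s g x t - s (d f) x t) (at t within ?S)"
    if xt: "x \<in> {0..L}" "t \<in> ?S" for x t
  proof -
    \<comment> \<open>The time derivative of the term of index \<open>k\<close>. Its second part is
      the term of index \<open>k - 1\<close> of the series \<open>d f\<close>; hence the majorant
      \<open>N'\<close> is \<open>N\<close> shifted by one, with value \<open>0\<close> at
      \<open>0\<close>.\<close>
    define h where "h = (\<lambda>k t. g k t * (x - t) ^ k - real k * f k t * (x - t) ^ (k - Suc 0))"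
    obtain M where M: "summable M" "\<And>k t x. t \<in> ?S \<Longrightarrow> \<bar>x\<bar> \<le> R \<Longrightarrow> \<bar>g k t * x ^ k\<bar> \<le> M k"
      using geom_bounded_m_test[OF gg R] by metis
    obtain N where N: "summable N" "\<And>k t x. t \<in> ?S \<Longrightarrow> \<bar>x\<bar> \<le> R \<Longrightarrow> \<bar>d f k t * x ^ k\<bar> \<le> N k"
      using geom_bounded_m_test[OF gd[OF gf] R] by metis
    define N' where "N' = (\<lambda>k. case k of 0 \<Rightarrow> 0 | Suc k \<Rightarrow> N k)"
    have "summable N'"
      using N(1) by (subst summable_Suc_iff[symmetric]) (simp add: N'_def)
    have hb: "norm (h k r) \<le> M k + N' k" if "r \<in> ?S" for k r
    proof -
      have "\<bar>real k * f k r * (x - r) ^ (k - Suc 0)\<bar> \<le> N' k"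
        using N(2)[OF that box[OF xt(1) that], of "k - 1"]
        by (cases k) (auto simp: N'_def d_def diffs_def)
      then show ?thesis
        using M(2)[OF that box[OF xt(1) that], of k] by (auto simp: h_def abs_le_iff)
    qed
    have hs: "(\<lambda>k. h k r) sums (s g x r - s (d f) x r)" if r: "r \<in> ?S" for r
      unfolding h_def
    proof (rule sums_diff)
      show "(\<lambda>k. g k r * (x - r) ^ k) sums s g x r"
        unfolding s_def using summ[OF gg xt(1) r] by (rule summable_sums[OF summable_rabs_cancel])
      show "(\<lambda>n. real n * f n r * (x - r) ^ (n - Suc 0)) sums s (d f) x r"
        unfolding s_def d_def
        by (rule diffs_equiv) (rule summable_rabs_cancel, use summ[OF gd[OF gf] xt(1) r] in \<open>simp add: d_def\<close>)
    qed
    have "uniform_limit ?S (\<lambda>n r. \<Sum>k<n. h k r) (\<lambda>r. suminf (\<lambda>k. h k r)) sequentially"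
      by (rule Weierstrass_m_test[OF hb summable_add[OF M(1) \<open>summable N'\<close>]])
    then have ul: "uniform_limit ?S (\<lambda>n r. \<Sum>k<n. h k r) (\<lambda>r. s g x r - s (d f) x r) sequentially"
      by (rule uniform_limit_cong'[THEN iffD1, rotated -1]) (use hs in \<open>auto simp: sums_iff\<close>)
    have "\<exists>G. \<forall>r\<in>?S. (\<lambda>k. f k r * (x - r) ^ k) sums G r \<and>
        (G has_field_derivative s g x r - s (d f) x r) (at r within ?S)"
    proof (rule has_field_derivative_series[OF _ _ ul])
      show "((\<lambda>r. f k r * (x - r) ^ k) has_field_derivative h k r) (at r within ?S)" if "r \<in> ?S" for k r
        unfolding h_def by (auto intro!: derivative_eq_intros ft[OF that])
      show "summable (\<lambda>n. f n t * (x - t) ^ n)"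
        using summ[OF gf xt] by (rule summable_rabs_cancel)
    qed (use xt in auto)
    then obtain G where G: "\<And>r. r \<in> ?S \<Longrightarrow> (\<lambda>k. f k r * (x - r) ^ k) sums G r"
        "\<And>r. r \<in> ?S \<Longrightarrow> (G has_field_derivative s g x r - s (d f) x r) (at r within ?S)"
      by blast
    show ?thesis
      by (rule has_field_derivative_transform_within[OF G(2)[OF xt(2)] zero_less_one xt(2)])
         (use G(1) in \<open>auto simp: s_def sums_iff\<close>)
  qed
  have derT': "(s f x has_real_derivative - (s (d f) x t + s (d (d (d f))) x t + s f x t * s (d f) x t))
      (at t within ?S)" if "x \<in> {0..L}" "t \<in> ?S" for x t
    using derT[OF that] unfolding eqn[OF that] .
  note g1 = gd[OF gf] and g2 = gd[OF gd[OF gf]] and g3 = gd[OF gd[OF gd[OF gf]]]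
    and c1 = cd[of f, OF cf] and c2 = cd[of "d f", OF cd[of f, OF cf]]
    and c3 = cd[of "d (d f)", OF cd[of "d f", OF cd[of f, OF cf]]]
  show ?classical
    unfolding classical_KdV_def ys
    by (rule exI[of _ "s (d f)"], rule exI[of _ "s (d (d f))"], rule exI[of _ "s (d (d (d f)))"],
        intro conjI ballI)
       (erule (1) derS[OF gf] derS[OF g1] derS[OF g2] derT'
         | rule contS[OF gf cf] contS[OF g1 c1] contS[OF g2 c2] contS[OF g3 c3])+
  show "?bound x t" if xt: "x \<in> {0..L}" "t \<in> ?S" for x t
  proof -
    have "\<bar>f k t * (x - t) ^ k\<bar> \<le> e * (1/2) ^ k" for k
    proof -
      have "\<bar>f k t * (x - t) ^ k\<bar> \<le> \<bar>f k t\<bar> * R ^ k"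
        using box[OF xt] by (simp add: abs_mult power_abs mult_left_mono power_mono)
      then show ?thesis using f_le[OF xt(2), of k] by simp
    qed
    moreover have "(\<lambda>k. e * (1/2 :: real) ^ k) sums (e * 2)"
      using sums_mult[OF geometric_sums[of "1/2::real"], of e] by simp
    ultimately have "\<bar>\<Sum>k. f k t * (x - t) ^ k\<bar> \<le> e * 2"
      using norm_suminf_le[of "\<lambda>k. f k t * (x - t) ^ k" "\<lambda>k. e * (1/2) ^ k"] by (simp add: sums_iff)
    then show ?thesis by (simp add: ys s_def)
  qed
qed

section \<open>A Gevrey cutoff function\<close>

text \<open>\<open>flat n j\<close> is the \<open>n\<close>-th derivative of the function \<open>t\<^sup>-\<^sup>j exp (- 1 / t)\<close>, continued by \<open>0\<close>
  to \<open>t \<le> 0\<close>.\<close>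

primrec flat :: "nat \<Rightarrow> nat \<Rightarrow> real \<Rightarrow> real" where
  "flat 0 j t = (if t > 0 then exp (- inverse t) * inverse t ^ j else 0)"
| "flat (Suc n) j t = flat n (j + 2) t - real j * flat n (j + 1) t"

text \<open>One term of the exponential series. It gives the Gevrey order of the cutoff, the
  analytic bounds for the soliton tail, and the absorption of geometric growth by
  \<open>fact n\<close>.\<close>

lemma power_le_fact_exp:
  fixes x :: real
  assumes "x \<ge> 0"
  shows "x ^ n \<le> fact n * exp x"
proof -
  have "(\<Sum>k\<in>{n}. x ^ k /\<^sub>R fact k) \<le> (\<Sum>k. x ^ k /\<^sub>R fact k)"
    by (rule sum_le_suminf[OF summable_exp_generic]) (use assms in auto)
  then show ?thesis by (simp add: exp_def field_simps)
qed

text \<open>Each derivative raises the exponent \<open>j\<close> by at most \<open>2\<close>, whence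
  Gevrey order \<open>2\<close>; the powers of \<open>2\<close> count the two terms of the
  recursion.\<close>

lemma flat_bound: "\<bar>flat n j t\<bar> \<le> 2 ^ n * fact (2 * n + j)"
proof (induction n arbitrary: j)
  case 0
  show ?case
  proof (cases "t > 0")
    case True
    then have "inverse t ^ j * exp (- inverse t) \<le> (fact j * exp (inverse t)) * exp (- inverse t)"
      by (intro mult_right_mono power_le_fact_exp) auto
    also have "\<dots> = fact j" by (simp flip: exp_add)
    finally show ?thesis using True by (simp add: mult.commute)
  qed simp
next
  case (Suc n)
  have "\<bar>real j * flat n (j + 1) t\<bar> \<le> real (2 * n + j + 2) * (2 ^ n * fact (2 * n + (j + 1)))"
    unfolding abs_mult by (rule mult_mono[OF _ Suc]) auto
  also have "\<dots> = 2 ^ n * fact (2 * n + (j + 2))"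
    by (simp add: algebra_simps)
  finally have "\<bar>flat (Suc n) j t\<bar> \<le> 2 ^ n * fact (2 * n + (j + 2)) + 2 ^ n * fact (2 * n + (j + 2))"
    using Suc[of "j + 2"] abs_triangle_ineq4[of "flat n (j + 2) t" "real j * flat n (j + 1) t"]
    by (simp del: fact_Suc)
  then show ?case by (simp add: algebra_simps)
qed

lemma flat_nonpos: "t \<le> 0 \<Longrightarrow> flat n j t = 0"
  by (induction n arbitrary: j) auto

text \<open>Only the origin is delicate: for \<open>h > 0\<close> the quotient
  \<open>flat 0 j h / h\<close> equals \<open>flat 0 (j + 2) h * h\<close>, whose first factor is
  bounded.\<close>

lemma flat_0_has_derivative: "(flat 0 j has_real_derivative flat 1 j t) (at t)"
proof -
  consider "t > 0" | "t < 0" | "t = 0" by linarith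
  then show ?thesis
  proof cases
    case 1
    have "((\<lambda>t. exp (- inverse t) * inverse t ^ j) has_real_derivative flat 1 j t) (at t)"
    proof (cases j)
      case 0
      then show ?thesis
        using 1 by (auto intro!: derivative_eq_intros simp: power2_eq_square)
    next
      case (Suc i)
      have "real i * (inverse t * inverse t ^ (i - Suc 0)) = real i * inverse t ^ i"
        by (cases i) auto
      with Suc show ?thesis
        using 1 by (auto intro!: derivative_eq_intros simp: power2_eq_square algebra_simps)
    qed
    then show ?thesis
      by (rule has_field_derivative_transform_within_open[of _ _ _ "{0<..}"]) (use 1 in auto)
  next
    case 2
    have "((\<lambda>t. 0) has_real_derivative flat 1 j t) (at t)"
      using flat_nonpos[of t 1 j] 2 by simp
    then show ?thesis
      by (rule has_field_derivative_transform_within_open[of _ _ _ "{..<0}"]) (use 2 in auto)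
  next
    case 3
    have "(\<lambda>h. flat 0 j h / h) \<midarrow>0\<rightarrow> 0"
    proof (rule Lim_null_comparison)
      have "norm (flat 0 j h / h) \<le> fact (j + 2) * \<bar>h\<bar>" if "h \<noteq> 0" for h
      proof (cases "h > 0")
        case True
        then have "flat 0 j h / h = flat 0 (j + 2) h * h"
          by (simp add: field_simps)
        then show ?thesis using flat_bound[of 0 "j + 2" h] by (simp add: abs_mult mult_right_mono)
      next
        case False
        have "0 \<le> fact (j + 2) * \<bar>h\<bar>" by (rule mult_nonneg_nonneg) auto
        then show ?thesis using False by (simp del: fact_Suc)
      qed
      then show "\<forall>\<^sub>F h in at 0. norm (flat 0 j h / h) \<le> fact (j + 2) * \<bar>h\<bar>"
        by (auto simp: eventually_at_filter)
      show "(\<lambda>h::real. fact (j + 2) * \<bar>h\<bar>) \<midarrow>0\<rightarrow> 0"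
        by (auto intro!: tendsto_eq_intros)
    qed
    then show ?thesis
      unfolding DERIV_def using 3 by (simp add: flat_nonpos)
  qed
qed

lemma flat_has_derivative: "(flat n j has_real_derivative flat (Suc n) j t) (at t within S)"
proof (induction n arbitrary: j)
  case 0
  show ?case unfolding One_nat_def[symmetric] by (rule has_field_derivative_at_within[OF flat_0_has_derivative])
next
  case (Suc n)
  have "((\<lambda>t. flat n (j + 2) t - real j * flat n (j + 1) t) has_real_derivative
      flat (Suc n) (j + 2) t - real j * flat (Suc n) (j + 1) t) (at t within S)"
    by (intro DERIV_diff DERIV_cmult Suc)
  moreover have "flat (Suc n) j = (\<lambda>t. flat n (j + 2) t - real j * flat n (j + 1) t)"
    by auto
  ultimately show ?case by simp
qed

text \<open>One factor \<open>n choose j\<close> is dominated by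
  \<open>(2 * n) choose (2 * j)\<close>, so every term fits under \<open>fact (2 * n)\<close>. The
  number \<open>n + 1\<close> of terms is at most \<open>2 ^ n\<close>, which doubles
  \<open>r\<close>.\<close>

lemma leib_gevrey_le:
  assumes f: "\<And>j. \<bar>f j\<bar> \<le> a * r ^ j * fact (2 * j)" and g: "\<And>j. \<bar>g j\<bar> \<le> b * r ^ j * fact (2 * j)"
    and r: "0 \<le> r" and a: "0 \<le> a" and b: "0 \<le> b"
  shows "\<bar>leib f g n\<bar> \<le> a * b * (2 * r) ^ n * fact (2 * n)"
proof -
  have "\<bar>real (n choose j) * f j * g (n - j)\<bar> \<le> a * b * r ^ n * fact (2 * n)" if j: "j \<le> n" for j
  proof -
    have "(n choose j) * 1 \<le> (n choose j) * (n choose j)"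
      using j by (intro mult_le_mono2) (simp add: Suc_le_eq)
    also have "\<dots> \<le> (n + n) choose (j + j)" by (rule binomial_mult_le)
    finally have "(n choose j) * (fact (2 * j) * fact (2 * n - 2 * j))
        \<le> fact (2 * j) * fact (2 * n - 2 * j) * ((2 * n) choose (2 * j))"
      by (simp add: mult_2[symmetric] mult.commute[of _ 2] mult.commute[of "n choose j"])
    also have "\<dots> = fact (2 * n)"
      by (rule binomial_fact_lemma) (use j in simp)
    finally have "real ((n choose j) * (fact (2 * j) * fact (2 * n - 2 * j))) \<le> real (fact (2 * n))"
      by (simp only: of_nat_le_iff)
    then have le: "real (n choose j) * (fact (2 * j) * fact (2 * (n - j))) \<le> fact (2 * n)"
      by (simp add: diff_mult_distrib2)
    have "\<bar>f j\<bar> * \<bar>g (n - j)\<bar> \<le> (a * r ^ j * fact (2 * j)) * (b * r ^ (n - j) * fact (2 * (n - j)))"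
      by (rule mult_mono) (use f g r a b in auto)
    then have "\<bar>real (n choose j) * f j * g (n - j)\<bar>
        \<le> real (n choose j) * ((a * r ^ j * fact (2 * j)) * (b * r ^ (n - j) * fact (2 * (n - j))))"
      by (simp add: abs_mult mult.assoc mult_left_mono)
    also have "\<dots> = (a * b * (r ^ j * r ^ (n - j))) * (real (n choose j) * (fact (2 * j) * fact (2 * (n - j))))"
      by simp
    also have "\<dots> \<le> (a * b * (r ^ j * r ^ (n - j))) * fact (2 * n)"
      by (rule mult_left_mono[OF le]) (use r a b in auto)
    also have "r ^ j * r ^ (n - j) = r ^ n" using j by (simp flip: power_add)
    finally show ?thesis .
  qed
  then have "\<bar>leib f g n\<bar> \<le> (\<Sum>j\<le>n. a * b * r ^ n * fact (2 * n))"
    unfolding leib_def by (intro order_trans[OF sum_abs] sum_mono) auto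
  also have "\<dots> = real (n + 1) * (a * b * r ^ n * fact (2 * n))" by simp
  also have "\<dots> \<le> 2 ^ n * (a * b * r ^ n * fact (2 * n))"
  proof (rule mult_right_mono)
    have "n + 1 \<le> 2 ^ n" by (simp add: Suc_leI)
    then have "real (n + 1) \<le> real (2 ^ n)" by (simp only: of_nat_le_iff)
    then show "real (n + 1) \<le> 2 ^ n" by simp
  qed (use r a b in auto)
  finally show ?thesis by (simp add: power_mult_distrib mult_ac)
qed

text \<open>The cutoff is the normalised primitive of
  \<open>exp (- 1 / t) * exp (- 1 / (\<tau> - t))\<close>, which is flat at both ends. The constant
  \<open>4\<close> is the \<open>2\<close> of \<open>flat_bound\<close>, doubled by the Leibniz
  product.\<close>

lemma gevrey_cutoff:
  fixes \<tau> :: real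
  assumes "\<tau> > 0"
  obtains \<theta> :: "nat \<Rightarrow> real \<Rightarrow> real" and K :: real where
    "tower {0..\<tau>} \<theta>" "\<And>n. \<theta> n 0 = 0" "\<theta> 0 \<tau> = 1" "\<And>n. \<theta> (Suc n) \<tau> = 0"
    "K > 0" "\<And>n t. t \<in> {0..\<tau>} \<Longrightarrow> \<bar>\<theta> n t\<bar> \<le> K * 4 ^ n * fact (2 * n)"
proof -
  define F where "F = (\<lambda>n. flat n 0)"
  define G where "G = (\<lambda>n t. (-1) ^ n * flat n 0 (\<tau> - t))"
  define h where "h = (\<lambda>n t. leib (\<lambda>j. F j t) (\<lambda>j. G j t) n)"
  have "tower UNIV F" by (simp add: tower_def F_def flat_has_derivative del: flat.simps)
  moreover have "tower UNIV G"
    unfolding tower_def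
  proof (intro allI ballI)
    fix n t
    have "((\<lambda>t. \<tau> - t) has_real_derivative - 1) (at t)"
      by (auto intro!: derivative_eq_intros)
    from DERIV_cmult[OF DERIV_chain2[OF flat_has_derivative this], of "(-1) ^ n" n 0]
    show "(G n has_real_derivative G (Suc n) t) (at t)"
      by (simp add: G_def del: flat.simps)
  qed
  ultimately have h: "tower UNIV h" unfolding h_def by (rule tower_leib)
  have h_le: "\<bar>h n t\<bar> \<le> 4 ^ n * fact (2 * n)" for n t
  proof -
    have "\<bar>h n t\<bar> \<le> 1 * 1 * (2 * 2) ^ n * fact (2 * n)"
      unfolding h_def by (rule leib_gevrey_le)
        (use flat_bound[of _ 0] in \<open>auto simp: F_def G_def abs_mult power_abs\<close>)
    then show ?thesis by simp
  qed
  have h0: "h n t = 0" if "t \<le> 0 \<or> \<tau> \<le> t" for n t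
    using that flat_nonpos by (auto simp: h_def leib_def F_def G_def)
  have h_pos: "h 0 t > 0" if "0 < t" "t < \<tau>" for t
    using that by (simp add: h_def F_def G_def)
  have h_nonneg: "h 0 t \<ge> 0" for t
    using h_pos[of t] h0[of t 0] by (cases "0 < t \<and> t < \<tau>") auto
  have h_der: "(h n has_real_derivative h (Suc n) t) (at t within S)" for n t S
    using towerD[OF h, of t n] has_field_derivative_at_within by auto
  have cont: "continuous_on {0..\<tau>} (h 0)" by (rule DERIV_continuous_on[OF h_der])
  define P where "P = (\<lambda>t. integral {0..t} (h 0))"
  have P: "(P has_real_derivative h 0 t) (at t within {0..\<tau>})" if "t \<in> {0..\<tau>}" for t
    unfolding P_def by (rule integral_has_real_derivative[OF cont that])
  have P_le: "0 \<le> P t \<and> P t \<le> P \<tau>" if "t \<in> {0..\<tau>}" for t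
  proof
    have int: "h 0 integrable_on {0..r}" for r
      by (rule integrable_continuous_real[OF DERIV_continuous_on[OF h_der]])
    show "0 \<le> P t" unfolding P_def by (rule integral_nonneg[OF int]) (rule h_nonneg)
    show "P t \<le> P \<tau>" unfolding P_def by (rule integral_subset_le[OF _ int int]) (use that h_nonneg in auto)
  qed
  have "P 0 < P \<tau>"
  proof (rule DERIV_pos_imp_increasing_open[OF assms])
    fix t assume t: "0 < t" "t < \<tau>"
    then have "(P has_real_derivative h 0 t) (at t)"
      using P[of t] by (simp add: at_within_Icc_at)
    then show "\<exists>y. (P has_real_derivative y) (at t) \<and> 0 < y" using h_pos[OF t] by blast
  qed (rule DERIV_continuous_on[OF P])
  then have I: "P \<tau> > 0" by (simp add: P_def)
  define \<theta> where "\<theta> = (\<lambda>n t. (case n of 0 \<Rightarrow> P t | Suc m \<Rightarrow> h m t) / P \<tau>)"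
  have t1: "tower {0..\<tau>} \<theta>"
    unfolding tower_def
  proof (intro allI ballI)
    fix n t assume t: "t \<in> {0..\<tau>}"
    show "(\<theta> n has_real_derivative \<theta> (Suc n) t) (at t within {0..\<tau>})"
      unfolding \<theta>_def by (cases n) (auto intro!: DERIV_cdivide P h_der t)
  qed
  have t2: "\<bar>\<theta> n t\<bar> \<le> (1 + 1 / P \<tau>) * 4 ^ n * fact (2 * n)" if t: "t \<in> {0..\<tau>}" for n t
  proof (cases n)
    case 0
    have "P t / P \<tau> \<le> 1" using P_le[OF t] I by simp
    then show ?thesis using 0 P_le[OF t] I by (simp add: \<theta>_def add_increasing2)
  next
    case (Suc m)
    have "\<bar>h m t\<bar> \<le> 4 ^ m * fact (2 * m)" by (rule h_le)
    also have "\<dots> \<le> 4 ^ n * fact (2 * n)"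
      using Suc by (intro mult_mono power_increasing fact_mono) auto
    finally have "\<bar>\<theta> n t\<bar> \<le> (4 ^ n * fact (2 * n)) / P \<tau>"
      using I Suc by (simp add: \<theta>_def divide_right_mono)
    also have "\<dots> \<le> (1 + 1 / P \<tau>) * 4 ^ n * fact (2 * n)"
      by (simp add: algebra_simps)
    finally show ?thesis .
  qed
  show ?thesis
  proof (rule that[OF t1 _ _ _ _ t2])
    show "\<theta> n 0 = 0" for n by (cases n) (auto simp: \<theta>_def P_def h0)
    show "\<theta> 0 \<tau> = 1" using I by (simp add: \<theta>_def)
    show "\<theta> (Suc n) \<tau> = 0" for n by (simp add: \<theta>_def h0)
    show "1 + 1 / P \<tau> > 0" using I by (simp add: add_pos_pos)
  qed
qed

section \<open>The soliton\<close>

text \<open>The profile \<open>12 \<kappa>\<^sup>2 sech\<^sup>2 (\<kappa> \<xi>)\<close> and its derivative, as rational functions of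
  \<open>exp (- 2 \<kappa> \<xi>)\<close>.\<close>

definition soliton :: "real \<Rightarrow> real \<Rightarrow> real" where
  "soliton \<kappa> \<xi> = 48 * \<kappa>\<^sup>2 * exp (- 2 * \<kappa> * \<xi>) / (1 + exp (- 2 * \<kappa> * \<xi>))\<^sup>2"

definition soliton' :: "real \<Rightarrow> real \<Rightarrow> real" where
  "soliton' \<kappa> \<xi> = - 96 * \<kappa> ^ 3 * exp (- 2 * \<kappa> * \<xi>) * (1 - exp (- 2 * \<kappa> * \<xi>))
     / (1 + exp (- 2 * \<kappa> * \<xi>)) ^ 3"

lemma soliton_has_derivative: "(soliton \<kappa> has_real_derivative soliton' \<kappa> \<xi>) (at \<xi> within S)"
proof -
  have nz: "1 + exp (- 2 * \<kappa> * \<xi>) \<noteq> 0" by (smt (verit) exp_gt_zero)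
  show ?thesis
    unfolding soliton_def soliton'_def
    by (rule derivative_eq_intros refl nz power_not_zero)+
       (use nz in \<open>simp add: divide_simps\<close>, algebra)
qed

text \<open>The travelling wave equation for speed \<open>4 * \<kappa>\<^sup>2\<close>, integrated
  once with vanishing constant.\<close>

lemma soliton'_has_derivative:
  "(soliton' \<kappa> has_real_derivative 4 * \<kappa>\<^sup>2 * soliton \<kappa> \<xi> - (soliton \<kappa> \<xi>)\<^sup>2 / 2) (at \<xi> within S)"
proof -
  have nz: "1 + exp (- 2 * \<kappa> * \<xi>) \<noteq> 0" by (smt (verit) exp_gt_zero)
  show ?thesis
    unfolding soliton_def soliton'_def
    by (rule derivative_eq_intros refl nz power_not_zero)+
       (use nz in \<open>simp add: divide_simps\<close>, algebra)
qed

lemma soliton_pos: "\<kappa> > 0 \<Longrightarrow> soliton \<kappa> \<xi> > 0"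
  unfolding soliton_def by (intro divide_pos_pos mult_pos_pos zero_less_power add_pos_pos) auto

lemma soliton_even: "soliton \<kappa> (- \<xi>) = soliton \<kappa> \<xi>"
proof -
  have "exp (- 2 * \<kappa> * - \<xi>) = inverse (exp (- 2 * \<kappa> * \<xi>))"
    by (simp flip: exp_minus)
  moreover have "q \<noteq> 0 \<Longrightarrow> inverse q / (1 + inverse q)\<^sup>2 = q / (1 + q)\<^sup>2" for q :: real
  proof -
    assume q: "q \<noteq> 0"
    then have "(1 + inverse q)\<^sup>2 = (1 + q)\<^sup>2 * (inverse q)\<^sup>2"
      by (simp add: field_simps power2_eq_square)
    then show ?thesis using q by (simp add: field_simps power2_eq_square)
  qed
  ultimately show ?thesis
    unfolding soliton_def by (metis exp_not_eq_zero times_divide_eq_right)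
qed

text \<open>Near the crest \<open>q\<close> lies between \<open>1/3\<close> and \<open>3\<close>,
  because \<open>exp 1 \<le> 3\<close>. There \<open>48 * q / (1 + q)\<^sup>2\<close> is at least
  \<open>9\<close>; more than \<open>5\<close> suffices, since
  \<open>\<kappa>\<^sup>2 \<ge> 1\<close>.\<close>

lemma soliton_gt:
  assumes "\<kappa> \<ge> 1" "\<kappa> * \<bar>\<xi>\<bar> \<le> 1/2"
  shows "soliton \<kappa> \<xi> > 4 * \<kappa>\<^sup>2 + 1"
proof -
  define q where "q = exp (- 2 * \<kappa> * \<xi>)"
  have ab: "\<bar>2 * \<kappa> * \<xi>\<bar> \<le> 1"
    using assms by (simp add: abs_mult)
  have q3: "q \<le> 3"
  proof -
    have "q \<le> exp 1" unfolding q_def using ab by (simp add: abs_le_iff)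
    then show ?thesis using exp_le by simp
  qed
  have q1: "1/3 \<le> q"
  proof -
    have "exp (2 * \<kappa> * \<xi>) \<le> 3" using ab exp_le by (smt (verit) exp_le_cancel_iff)
    moreover have "q * exp (2 * \<kappa> * \<xi>) = 1" by (simp add: q_def flip: exp_add)
    moreover have "q > 0" by (simp add: q_def)
    ultimately have "q * 3 \<ge> 1" by (metis mult_left_mono less_imp_le)
    then show ?thesis by simp
  qed
  have "(q - 1/3) * (3 - q) \<ge> 0" using q1 q3 by simp
  moreover have "(q - 1/3) * (3 - q) = 10/3 * q - q\<^sup>2 - 1"
    by (simp add: field_simps power2_eq_square)
  moreover have "(1 + q)\<^sup>2 = 1 + 2 * q + q\<^sup>2"
    by (simp add: algebra_simps power2_eq_square)
  ultimately have "5 * (1 + q)\<^sup>2 < 48 * q"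
    using q1 by linarith
  then have "5 < 48 * q / (1 + q)\<^sup>2"
    using q1 by (simp add: divide_simps)
  moreover have "\<kappa>\<^sup>2 \<ge> 1" using assms(1) by simp
  ultimately have "\<kappa>\<^sup>2 * 5 < \<kappa>\<^sup>2 * (48 * q / (1 + q)\<^sup>2)"
    by (intro mult_strict_left_mono) auto
  then have "\<kappa>\<^sup>2 * 5 < soliton \<kappa> \<xi>"
    by (simp add: soliton_def q_def mult_ac)
  then show ?thesis using \<open>\<kappa>\<^sup>2 \<ge> 1\<close> by simp
qed

text \<open>On \<open>\<xi> > 0\<close> the soliton is the sum of an exponential series, which gives all its derivatives.\<close>

definition soliton_coeff :: "real \<Rightarrow> nat \<Rightarrow> nat \<Rightarrow> real" where
  "soliton_coeff \<kappa> j m = 48 * \<kappa>\<^sup>2 * (-1) ^ Suc m * real m * (- 2 * \<kappa> * real m) ^ j"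

definition soliton_deriv :: "real \<Rightarrow> nat \<Rightarrow> real \<Rightarrow> real" where
  "soliton_deriv \<kappa> j \<xi> = (\<Sum>m. soliton_coeff \<kappa> j m * exp (- 2 * \<kappa> * \<xi>) ^ m)"

lemma summable_soliton_coeff:
  assumes "\<bar>q\<bar> < 1"
  shows "summable (\<lambda>m. soliton_coeff \<kappa> j m * q ^ m)"
proof (rule summable_comparison_test_ev)
  define C where "C = 48 * \<kappa>\<^sup>2 * \<bar>2 * \<kappa>\<bar> ^ j"
  show "summable (\<lambda>m. C * (real (Suc m) ^ Suc j * \<bar>q\<bar> ^ m))"
    by (intro summable_mult summable_poly_geometric) (use assms in auto)
  have "norm (soliton_coeff \<kappa> j m * q ^ m) \<le> C * (real (Suc m) ^ Suc j * \<bar>q\<bar> ^ m)" for m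
  proof -
    have "norm (soliton_coeff \<kappa> j m * q ^ m) = C * (real m ^ Suc j * \<bar>q\<bar> ^ m)"
      by (simp add: soliton_coeff_def C_def abs_mult power_abs power_mult_distrib mult_ac)
    also have "\<dots> \<le> C * (real (Suc m) ^ Suc j * \<bar>q\<bar> ^ m)"
      by (intro mult_left_mono mult_right_mono power_mono) (auto simp: C_def)
    finally show ?thesis .
  qed
  then show "\<forall>\<^sub>F m in sequentially. norm (soliton_coeff \<kappa> j m * q ^ m) \<le> C * (real (Suc m) ^ Suc j * \<bar>q\<bar> ^ m)"
    by simp
qed

lemma exp_tail_lt_1: "\<kappa> > 0 \<Longrightarrow> \<xi> > 0 \<Longrightarrow> \<bar>exp (- 2 * \<kappa> * \<xi>)\<bar> < (1::real)"
  by simp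

lemma soliton_deriv_tower:
  assumes "\<kappa> > 0"
  shows "tower {0<..} (soliton_deriv \<kappa>)"
  unfolding tower_def
proof (intro allI ballI)
  fix j and \<xi> :: real assume "\<xi> \<in> {0<..}"
  then have \<xi>: "\<xi> > 0" by simp
  define q where "q = exp (- 2 * \<kappa> * \<xi>)"
  have q: "\<bar>q\<bar> < 1" "q \<noteq> 0" using exp_tail_lt_1[OF assms \<xi>] by (auto simp: q_def)
  have "((\<lambda>q. \<Sum>m. soliton_coeff \<kappa> j m * q ^ m) has_real_derivative
      (\<Sum>m. diffs (soliton_coeff \<kappa> j) m * q ^ m)) (at q)"
    by (rule termdiffs_strong'[where K = 1]) (use q summable_soliton_coeff in auto)
  moreover have "((\<lambda>\<xi>. exp (- 2 * \<kappa> * \<xi>)) has_real_derivative - 2 * \<kappa> * q) (at \<xi> within {0<..})"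
    by (auto intro!: derivative_eq_intros simp: q_def)
  ultimately have "(soliton_deriv \<kappa> j has_real_derivative
      (\<Sum>m. diffs (soliton_coeff \<kappa> j) m * q ^ m) * (- 2 * \<kappa> * q)) (at \<xi> within {0<..})"
    unfolding soliton_deriv_def q_def by (rule DERIV_chain2)
  moreover have "(\<Sum>m. diffs (soliton_coeff \<kappa> j) m * q ^ m) * (- 2 * \<kappa> * q) = soliton_deriv \<kappa> (Suc j) \<xi>"
  proof -
    have "summable (\<lambda>m. diffs (soliton_coeff \<kappa> j) m * q ^ m)"
      by (rule termdiff_converges[where K = 1]) (use q summable_soliton_coeff in auto)
    then have "(\<lambda>m. real m * soliton_coeff \<kappa> j m * q ^ (m - Suc 0)) sums
        (\<Sum>m. diffs (soliton_coeff \<kappa> j) m * q ^ m)"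
      by (rule diffs_equiv)
    then have "(\<lambda>m. real m * soliton_coeff \<kappa> j m * q ^ (m - Suc 0) * (- 2 * \<kappa> * q)) sums
        ((\<Sum>m. diffs (soliton_coeff \<kappa> j) m * q ^ m) * (- 2 * \<kappa> * q))"
      by (rule sums_mult2)
    moreover have "real m * soliton_coeff \<kappa> j m * q ^ (m - Suc 0) * (- 2 * \<kappa> * q)
        = soliton_coeff \<kappa> (Suc j) m * q ^ m" for m
      by (cases m) (auto simp: soliton_coeff_def)
    ultimately show ?thesis
      by (simp add: soliton_deriv_def q_def sums_iff)
  qed
  ultimately show "(soliton_deriv \<kappa> j has_real_derivative soliton_deriv \<kappa> (Suc j) \<xi>) (at \<xi> within {0<..})"
    by simp
qed

text \<open>The differentiated geometric series at \<open>- q\<close>, which is where the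
  alternating coefficients \<open>m\<close> in \<open>soliton_coeff\<close> come from.\<close>

lemma soliton_deriv_0:
  assumes "\<kappa> > 0" "\<xi> > 0"
  shows "soliton_deriv \<kappa> 0 \<xi> = soliton \<kappa> \<xi>"
proof -
  define q where "q = exp (- 2 * \<kappa> * \<xi>)"
  have "norm (- q) < 1" using exp_tail_lt_1[OF assms] by (simp add: q_def)
  from sums_mult[OF geometric_deriv_sums[OF this], of "48 * \<kappa>\<^sup>2 * q"]
  have "(\<lambda>n. soliton_coeff \<kappa> 0 (Suc n) * q ^ Suc n) sums (48 * \<kappa>\<^sup>2 * q / (1 + q)\<^sup>2)"
    by (simp add: soliton_coeff_def power_minus[of q] mult_ac)
  from sums_Suc[OF this] have "(\<lambda>n. soliton_coeff \<kappa> 0 n * q ^ n) sums (48 * \<kappa>\<^sup>2 * q / (1 + q)\<^sup>2)"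
    by (simp add: soliton_coeff_def)
  then show ?thesis by (simp add: soliton_deriv_def soliton_def q_def sums_iff)
qed

section \<open>The profile equation and the Taylor coefficients of the soliton\<close>

lemma tower_Suc_eq_open:
  assumes "tower S F" "open S" "\<And>t. t \<in> S \<Longrightarrow> F n t = g t"
    "t \<in> S" "(g has_real_derivative g') (at t)"
  shows "F (Suc n) t = g'"
proof -
  have "(F n has_real_derivative F (Suc n) t) (at t)"
    using towerD[OF assms(1,4)] at_within_open[OF assms(4,2)] by simp
  moreover have "(F n has_real_derivative g') (at t)"
    by (rule has_field_derivative_transform_within_open[OF assms(5,2,4)]) (simp add: assms(3))
  ultimately show ?thesis by (rule DERIV_unique)
qed

lemma soliton_deriv_1: "\<kappa> > 0 \<Longrightarrow> \<xi> > 0 \<Longrightarrow> soliton_deriv \<kappa> 1 \<xi> = soliton' \<kappa> \<xi>"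
  using tower_Suc_eq_open[OF soliton_deriv_tower _ soliton_deriv_0 _ soliton_has_derivative] by simp

lemma soliton_deriv_2:
  "\<kappa> > 0 \<Longrightarrow> \<xi> > 0 \<Longrightarrow> soliton_deriv \<kappa> 2 \<xi> = 4 * \<kappa>\<^sup>2 * soliton \<kappa> \<xi> - (soliton \<kappa> \<xi>)\<^sup>2 / 2"
  using tower_Suc_eq_open[OF soliton_deriv_tower _ soliton_deriv_1 _ soliton'_has_derivative]
  by (simp add: numeral_2_eq_2)

text \<open>Differentiate the profile equation: both sides are towers on an open half-line and agree
  at order \<open>0\<close>, hence at every order.\<close>

lemma soliton_deriv_rec:
  assumes "\<kappa> > 0" "\<xi> > 0"
  shows "soliton_deriv \<kappa> (n + 3) \<xi> = 4 * \<kappa>\<^sup>2 * soliton_deriv \<kappa> (n + 1) \<xi>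
    - leib (\<lambda>j. soliton_deriv \<kappa> j \<xi>) (\<lambda>j. soliton_deriv \<kappa> (j + 1) \<xi>) n"
proof -
  note T = soliton_deriv_tower[OF assms(1)]
  have 3: "soliton_deriv \<kappa> 3 \<xi> = 4 * \<kappa>\<^sup>2 * soliton' \<kappa> \<xi> - soliton \<kappa> \<xi> * soliton' \<kappa> \<xi>" if "\<xi> > 0" for \<xi>
  proof -
    have "((\<lambda>\<xi>. 4 * \<kappa>\<^sup>2 * soliton \<kappa> \<xi> - (soliton \<kappa> \<xi>)\<^sup>2 / 2) has_real_derivative
        4 * \<kappa>\<^sup>2 * soliton' \<kappa> \<xi> - soliton \<kappa> \<xi> * soliton' \<kappa> \<xi>) (at \<xi>)"
      by (auto intro!: derivative_eq_intros soliton_has_derivative)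
    from tower_Suc_eq_open[OF T _ soliton_deriv_2[OF assms(1)] _ this]
    show ?thesis using that by (simp add: eval_nat_numeral)
  qed
  have "tower {0<..} (\<lambda>n \<xi>. 4 * \<kappa>\<^sup>2 * soliton_deriv \<kappa> (n + 1) \<xi>
      - leib (\<lambda>j. soliton_deriv \<kappa> j \<xi>) (\<lambda>j. soliton_deriv \<kappa> (j + 1) \<xi>) n)"
    unfolding tower_def
    using leib_has_derivative[OF T tower_shift[OF T, of 1]] towerD[OF T]
    by (auto intro!: DERIV_diff DERIV_cmult)
  from tower_unique_open[OF tower_shift[OF T, of 3] this, of \<xi> n]
  show ?thesis
    using assms 3 soliton_deriv_0 soliton_deriv_1 by simp
qed

text \<open>Differentiating a product \<open>k + n\<close> times is the same as differentiating it
  first \<open>k\<close> and then \<open>n\<close> times.\<close>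

lemma leib_leib_binomial:
  "(\<Sum>i\<le>k. real (k choose i) * leib (\<lambda>j. f (i + j)) (\<lambda>j. g (k - i + j)) n) = leib f g (k + n)"
proof (induction n arbitrary: f g)
  case 0
  show ?case by (simp add: leib_def mult_ac)
next
  case (Suc n)
  have "(\<Sum>i\<le>k. real (k choose i) * leib (\<lambda>j. f (i + j)) (\<lambda>j. g (k - i + j)) (Suc n))
      = (\<Sum>i\<le>k. real (k choose i) * leib (\<lambda>j. f (Suc (i + j))) (\<lambda>j. g (k - i + j)) n)
      + (\<Sum>i\<le>k. real (k choose i) * leib (\<lambda>j. f (i + j)) (\<lambda>j. g (Suc (k - i + j))) n)"
    by (simp only: leib_Suc add_Suc_right sum.distrib distrib_left)
  then show ?case
    using Suc[of "\<lambda>j. f (Suc j)" g] Suc[of f "\<lambda>j. g (Suc j)"]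
    unfolding add_Suc_right leib_Suc[of f g "k + n"] by (simp only:)
qed

text \<open>The Taylor coefficients in \<open>X\<close> at \<open>X = 0\<close> of the travelling wave with profile \<open>soliton \<kappa>\<close>,
  whose speed is \<open>4 \<kappa>\<^sup>2\<close>.\<close>

lemma kdv_coeff_soliton:
  assumes "\<kappa> > 0" "\<xi> > 0"
    and c: "\<And>k n. k < 3 \<Longrightarrow> c k n = (- 4 * \<kappa>\<^sup>2) ^ n * soliton_deriv \<kappa> (k + n) \<xi> / fact k"
  shows "kdv_coeff c k n = (- 4 * \<kappa>\<^sup>2) ^ n * soliton_deriv \<kappa> (k + n) \<xi> / fact k"
proof -
  define a where "a = - 4 * \<kappa>\<^sup>2"
  define f where "f = (\<lambda>j. soliton_deriv \<kappa> j \<xi>)"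
  define Z where "Z = (\<lambda>k n. (1 / fact k) * a ^ n * f (k + n))"
  have rec: "f (n + 3) = - (a * f (n + 1) + leib f (\<lambda>j. f (j + 1)) n)" for n
    using soliton_deriv_rec[OF assms(1,2), of n] by (simp add: f_def a_def)
  have "kdv_coeff c k = Z k"
  proof (rule kdv_coeff_unique)
    fix k n :: nat assume "k < 3"
    then show "Z k n = c k n" by (simp add: c Z_def f_def a_def)
  next
    fix k n :: nat
    \<comment> \<open>The weight \<open>k + 1 - i\<close> cancels against a factorial and turns the
      Taylor coefficients into \<open>k choose i\<close>; the sum over \<open>i\<close> becomes a
      Leibniz rule of order \<open>k\<close> on top of one of order \<open>n\<close>.\<close>
    have "real (k + 1 - i) * leib (Z i) (Z (k + 1 - i)) n
        = a ^ n / fact k * (real (k choose i) * leib (\<lambda>j. f (i + j)) (\<lambda>j. f (Suc (k - i + j))) n)"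
      if i: "i \<le> k" for i
    proof -
      have fk: "fact (Suc (k - i)) = real (Suc (k - i)) * fact (k - i)" by simp
      have "leib (Z i) (Z (k + 1 - i)) n = (1 / fact i) * (1 / fact (Suc (k - i))) * a ^ n
          * leib (\<lambda>j. f (i + j)) (\<lambda>j. f (Suc (k - i + j))) n"
        using i unfolding Z_def by (subst leib_geometric) (simp add: Suc_diff_le)
      moreover have "real (k choose i) = fact k / (fact i * fact (k - i))"
        by (rule binomial_fact[OF i])
      ultimately show ?thesis
        unfolding fk using i by (simp add: Suc_diff_le del: of_nat_Suc)
    qed
    then have "(\<Sum>i\<le>k. real (k + 1 - i) * leib (Z i) (Z (k + 1 - i)) n)
        = a ^ n / fact k * (\<Sum>i\<le>k. real (k choose i) * leib (\<lambda>j. f (i + j)) (\<lambda>j. f (Suc (k - i + j))) n)"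
      by (simp add: sum_distrib_left)
    also have "\<dots> = a ^ n / fact k * leib f (\<lambda>j. f (j + 1)) (k + n)"
      using leib_leib_binomial[where f = f and g = "\<lambda>j. f (Suc j)"] by simp
    finally have s: "(\<Sum>i\<le>k. real (k + 1 - i) * leib (Z i) (Z (k + 1 - i)) n)
        = a ^ n / fact k * leib f (\<lambda>j. f (j + 1)) (k + n)" .
    have "(fact (k + 3) :: real) = real ((k + 3) * (k + 2) * (k + 1)) * fact k"
      by (simp add: eval_nat_numeral algebra_simps)
    then have "real ((k + 3) * (k + 2) * (k + 1)) * Z (k + 3) n = a ^ n / fact k * f (k + n + 3)"
      unfolding Z_def by (simp add: add_ac del: of_nat_mult of_nat_add)
    then show "real ((k + 3) * (k + 2) * (k + 1)) * Z (k + 3) n =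
      - (Z k (Suc n) + (\<Sum>i\<le>k. real (k + 1 - i) * leib (Z i) (Z (k + 1 - i)) n))"
      unfolding s rec[of "k + n"] by (simp add: Z_def algebra_simps)
  qed
  then show ?thesis by (simp add: Z_def f_def a_def)
qed

text \<open>A Cauchy estimate of radius \<open>s\<close>, obtained termwise: the powers of
  \<open>2 * \<kappa> * m\<close> are paid for by giving up a distance \<open>s\<close> of
  exponential decay. The factor \<open>192\<close> is \<open>48\<close> times the bound
  \<open>4\<close> for \<open>1 / (1 - r)\<^sup>2\<close>.\<close>

lemma soliton_deriv_bound:
  assumes "\<kappa> > 0" "s > 0" and r: "exp (- 2 * \<kappa> * (\<xi> - s)) \<le> 1/2"
  shows "\<bar>soliton_deriv \<kappa> j \<xi>\<bar> \<le> 192 * \<kappa>\<^sup>2 * exp (- 2 * \<kappa> * (\<xi> - s)) * fact j / s ^ j"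
proof -
  define r where "r = exp (- 2 * \<kappa> * (\<xi> - s))"
  define C where "C = 48 * \<kappa>\<^sup>2 * fact j / s ^ j"
  have r: "0 < r" "r \<le> 1/2" using assms(3) by (auto simp: r_def)
  have C: "C \<ge> 0" using assms by (simp add: C_def)
  have term_le: "norm (soliton_coeff \<kappa> j m * exp (- 2 * \<kappa> * \<xi>) ^ m) \<le> C * (real m * r ^ m)" for m
  proof -
    have "(2 * \<kappa> * real m) ^ j * s ^ j = (2 * \<kappa> * real m * s) ^ j" by (simp add: power_mult_distrib)
    also have "\<dots> \<le> fact j * exp (2 * \<kappa> * real m * s)"
      by (rule power_le_fact_exp) (use assms in simp)
    also have "exp (2 * \<kappa> * real m * s) = exp (2 * \<kappa> * s) ^ m"
      by (simp flip: exp_of_nat_mult add: mult_ac)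
    finally have "(2 * \<kappa> * real m) ^ j \<le> fact j * exp (2 * \<kappa> * s) ^ m / s ^ j"
      using assms by (simp add: field_simps)
    then have "48 * \<kappa>\<^sup>2 * real m * (2 * \<kappa> * real m) ^ j * exp (- 2 * \<kappa> * \<xi>) ^ m
        \<le> 48 * \<kappa>\<^sup>2 * real m * (fact j * exp (2 * \<kappa> * s) ^ m / s ^ j) * exp (- 2 * \<kappa> * \<xi>) ^ m"
      by (intro mult_right_mono mult_left_mono) auto
    also have "\<dots> = C * (real m * (exp (2 * \<kappa> * s) * exp (- 2 * \<kappa> * \<xi>)) ^ m)"
      by (simp add: C_def power_mult_distrib)
    also have "exp (2 * \<kappa> * s) * exp (- 2 * \<kappa> * \<xi>) = r"
      by (simp add: r_def algebra_simps flip: exp_add)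
    finally show ?thesis
      using assms by (simp add: soliton_coeff_def abs_mult power_abs)
  qed
  have "(\<lambda>m. real (Suc m) * r ^ m * r) sums (1 / (1 - r)\<^sup>2 * r)"
    using geometric_deriv_sums[of r] r by (intro sums_mult2) auto
  then have "(\<lambda>m. real (Suc m) * r ^ Suc m) sums (1 / (1 - r)\<^sup>2 * r)"
    by (simp add: mult_ac)
  from sums_Suc[of "\<lambda>m. real m * r ^ m", OF this]
  have "(\<lambda>m. real m * r ^ m) sums (1 / (1 - r)\<^sup>2 * r)" by simp
  from sums_mult[OF this, of C] have sm: "(\<lambda>m. C * (real m * r ^ m)) sums (C * (1 / (1 - r)\<^sup>2 * r))" .
  have "norm (soliton_deriv \<kappa> j \<xi>) \<le> C * (1 / (1 - r)\<^sup>2 * r)"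
    using norm_suminf_le[OF term_le sums_summable[OF sm]] sm
    by (simp add: soliton_deriv_def sums_iff)
  also have "\<dots> \<le> C * (4 * r)"
  proof (intro mult_left_mono mult_right_mono)
    have "(1/2)\<^sup>2 \<le> (1 - r)\<^sup>2" using r by (intro power_mono) auto
    then show "1 / (1 - r)\<^sup>2 \<le> 4" using r by (simp add: field_simps power2_eq_square)
  qed (use r C in auto)
  finally show ?thesis by (simp add: C_def r_def mult_ac)
qed

text \<open>With Cauchy radius \<open>s\<close> on the whole segment and
  \<open>\<bar>X\<bar>\<close> at most half of it, the Taylor remainder is bounded by a multiple of
  \<open>(1/2) ^ n\<close>.\<close>

lemma soliton_taylor:
  assumes \<kappa>: "\<kappa> > 0" and s: "s > 0" "2 * \<bar>X\<bar> \<le> s"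
    and r: "exp (- 2 * \<kappa> * (\<xi> - \<bar>X\<bar> - s)) \<le> 1/2"
  shows "(\<lambda>k. soliton_deriv \<kappa> k \<xi> / fact k * X ^ k) sums soliton \<kappa> (\<xi> + X)"
proof -
  have gt: "\<xi> - \<bar>X\<bar> > s"
  proof -
    have "exp (- 2 * \<kappa> * (\<xi> - \<bar>X\<bar> - s)) < 1" using r by linarith
    then have "0 < \<kappa> * (\<xi> - \<bar>X\<bar> - s)" by simp
    then show ?thesis using \<kappa> by (simp add: zero_less_mult_iff)
  qed
  show ?thesis
  proof (cases "X = 0")
    case True
    have "soliton \<kappa> (\<xi> + X) = soliton_deriv \<kappa> 0 \<xi> / fact 0"
      using True gt \<kappa> s by (simp add: soliton_deriv_0)
    then show ?thesis
      unfolding True using powser_sums_zero[of "\<lambda>k. soliton_deriv \<kappa> k \<xi> / fact k"] by simp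
  next
    case False
    define M where "M = 192 * \<kappa>\<^sup>2"
    have bnd: "\<bar>soliton_deriv \<kappa> n \<eta> / fact n * X ^ n\<bar> \<le> M * (1/2) ^ n" if "\<eta> \<ge> \<xi> - \<bar>X\<bar>" for n \<eta>
    proof -
      have le: "exp (- 2 * \<kappa> * (\<eta> - s)) \<le> 1/2"
      proof -
        have "exp (- 2 * \<kappa> * (\<eta> - s)) \<le> exp (- 2 * \<kappa> * (\<xi> - \<bar>X\<bar> - s))"
          using that \<kappa> by (simp add: mult_left_mono)
        then show ?thesis using r by linarith
      qed
      have "\<bar>soliton_deriv \<kappa> n \<eta>\<bar> \<le> M * exp (- 2 * \<kappa> * (\<eta> - s)) * fact n / s ^ n"
        unfolding M_def by (rule soliton_deriv_bound[OF \<kappa> s(1) le])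
      also have "\<dots> \<le> M * 1 * fact n / s ^ n"
        using order_trans[OF le, of 1] s by (intro divide_right_mono mult_right_mono mult_left_mono) (simp_all add: M_def)
      finally have le': "\<bar>soliton_deriv \<kappa> n \<eta>\<bar> \<le> M * fact n / s ^ n" by simp
      have "\<bar>soliton_deriv \<kappa> n \<eta> / fact n * X ^ n\<bar> = \<bar>soliton_deriv \<kappa> n \<eta>\<bar> / fact n * \<bar>X\<bar> ^ n"
        by (simp add: abs_mult power_abs)
      also have "\<dots> \<le> (M * fact n / s ^ n) / fact n * \<bar>X\<bar> ^ n"
        by (intro mult_right_mono divide_right_mono le') auto
      also have "\<dots> = M * (\<bar>X\<bar> / s) ^ n" by (simp add: power_divide)
      also have "\<dots> \<le> M * (1/2) ^ n"
        using s by (intro mult_left_mono power_mono) (auto simp: M_def field_simps)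
      finally show ?thesis .
    qed
    have rem: "norm ((\<Sum>k<n. soliton_deriv \<kappa> k \<xi> / fact k * X ^ k) - soliton \<kappa> (\<xi> + X)) \<le> M * (1/2) ^ n"
      if n: "n > 0" for n
    proof -
      have "\<exists>t. (if \<xi> + X < \<xi> then \<xi> + X < t \<and> t < \<xi> else \<xi> < t \<and> t < \<xi> + X) \<and>
          soliton_deriv \<kappa> 0 (\<xi> + X) =
          (\<Sum>m<n. soliton_deriv \<kappa> m \<xi> / fact m * (\<xi> + X - \<xi>) ^ m)
          + soliton_deriv \<kappa> n t / fact n * (\<xi> + X - \<xi>) ^ n"
      proof (rule Taylor[OF n refl, of "\<xi> - \<bar>X\<bar>" "\<xi> + \<bar>X\<bar>"])
        show "\<forall>m t. m < n \<and> \<xi> - \<bar>X\<bar> \<le> t \<and> t \<le> \<xi> + \<bar>X\<bar> \<longrightarrow>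
            (soliton_deriv \<kappa> m has_real_derivative soliton_deriv \<kappa> (Suc m) t) (at t)"
        proof (intro allI impI)
          fix m t assume "m < n \<and> \<xi> - \<bar>X\<bar> \<le> t \<and> t \<le> \<xi> + \<bar>X\<bar>"
          then have t: "t \<in> {0<..}" using gt s by auto
          show "(soliton_deriv \<kappa> m has_real_derivative soliton_deriv \<kappa> (Suc m) t) (at t)"
            using towerD[OF soliton_deriv_tower[OF \<kappa>] t, of m] at_within_open[OF t] by simp
        qed
      qed (use False in auto)
      then obtain t where t: "if \<xi> + X < \<xi> then \<xi> + X < t \<and> t < \<xi> else \<xi> < t \<and> t < \<xi> + X"
        "soliton_deriv \<kappa> 0 (\<xi> + X) = (\<Sum>m<n. soliton_deriv \<kappa> m \<xi> / fact m * X ^ m)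
          + soliton_deriv \<kappa> n t / fact n * X ^ n"
        by auto
      have "t \<ge> \<xi> - \<bar>X\<bar>" using t(1) by (auto split: if_splits)
      from bnd[OF this, of n] t(2) show ?thesis
        using soliton_deriv_0[OF \<kappa>, of "\<xi> + X"] gt s by (simp add: abs_minus_commute)
    qed
    have "(\<lambda>n. (\<Sum>k<n. soliton_deriv \<kappa> k \<xi> / fact k * X ^ k) - soliton \<kappa> (\<xi> + X)) \<longlonglongrightarrow> 0"
    proof (rule Lim_null_comparison)
      show "\<forall>\<^sub>F n in sequentially. norm ((\<Sum>k<n. soliton_deriv \<kappa> k \<xi> / fact k * X ^ k) - soliton \<kappa> (\<xi> + X))
          \<le> M * (1/2) ^ n"
        by (rule eventually_mono[OF eventually_gt_at_top[of 0] rem])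
      show "(\<lambda>n. M * (1/2 :: real) ^ n) \<longlonglongrightarrow> 0"
        by (intro tendsto_mult_right_zero LIMSEQ_power_zero) auto
    qed
    then show ?thesis unfolding sums_def by (simp add: LIM_zero_iff)
  qed
qed

section \<open>From rest to the soliton\<close>

definition wave :: "real \<Rightarrow> real \<Rightarrow> real \<Rightarrow> real \<Rightarrow> real \<Rightarrow> real" where
  "wave T L \<kappa> x t = soliton \<kappa> (x - L / 2 - (4 * \<kappa>\<^sup>2 + 1) * (t - T / 2))"

lemma classical_KdV_wave: "classical_KdV L a b (wave T M \<kappa>)"
proof -
  define z where "z = (\<lambda>x t. x - M / 2 - (4 * \<kappa>\<^sup>2 + 1) * (t - T / 2))"
  define S where "S = soliton \<kappa>"
  define S1 where "S1 = soliton' \<kappa>"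
  have zx: "((\<lambda>x. z x t) has_real_derivative 1) (at x within D)" for x t D
    unfolding z_def by (auto intro!: derivative_eq_intros)
  have zt: "((\<lambda>t. z x t) has_real_derivative - (4 * \<kappa>\<^sup>2 + 1)) (at t within D)" for x t D
    unfolding z_def by (auto intro!: derivative_eq_intros)
  have S: "(S has_real_derivative S1 \<xi>) (at \<xi>)" for \<xi>
    unfolding S_def S1_def by (rule soliton_has_derivative)
  have S1: "(S1 has_real_derivative 4 * \<kappa>\<^sup>2 * S \<xi> - (S \<xi>)\<^sup>2 / 2) (at \<xi>)" for \<xi>
    unfolding S_def S1_def by (rule soliton'_has_derivative)
  have S2: "((\<lambda>\<xi>. 4 * \<kappa>\<^sup>2 * S \<xi> - (S \<xi>)\<^sup>2 / 2) has_real_derivative (4 * \<kappa>\<^sup>2 - S \<xi>) * S1 \<xi>) (at \<xi>)" for \<xi>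
    by (auto intro!: derivative_eq_intros S simp: algebra_simps)
  have cS: "continuous_on UNIV S" and cS1: "continuous_on UNIV S1"
    using S S1 by (auto intro!: DERIV_continuous_on)
  have cz: "continuous_on D (\<lambda>p. z (fst p) (snd p))" for D
    unfolding z_def by (intro continuous_intros)
  note c = continuous_on_compose2[OF cS cz subset_UNIV] continuous_on_compose2[OF cS1 cz subset_UNIV]
  have y: "wave T M \<kappa> = (\<lambda>x t. S (z x t))"
    by (simp add: fun_eq_iff wave_def S_def z_def)
  have t: "((\<lambda>t. S (z x t)) has_real_derivative - S1 (z x t) - (4 * \<kappa>\<^sup>2 - S (z x t)) * S1 (z x t)
      - S (z x t) * S1 (z x t)) (at t within {a..b})" for x t
    using DERIV_chain2[OF S zt, of x t "{a..b}"] by (simp add: algebra_simps)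
  show ?thesis
    unfolding classical_KdV_def y
    by (rule exI[of _ "\<lambda>x t. S1 (z x t)"],
        rule exI[of _ "\<lambda>x t. 4 * \<kappa>\<^sup>2 * S (z x t) - (S (z x t))\<^sup>2 / 2"],
        rule exI[of _ "\<lambda>x t. (4 * \<kappa>\<^sup>2 - S (z x t)) * S1 (z x t)"])
       (auto simp: case_prod_beta intro!: continuous_intros c t
          DERIV_chain2[OF S zx, simplified] DERIV_chain2[OF S1 zx, simplified]
          DERIV_chain2[OF S2 zx, simplified])
qed

text \<open>All constants up to \<open>Q\<close> are fixed by \<open>T\<close>, \<open>L\<close> and
  the cutoff before \<kappa> is chosen large; only the amplitude \<open>e \<kappa>\<close> depends
  on \<kappa>.\<close>

lemma kdv_transition:
  fixes T L \<kappa>\<^sub>0 \<epsilon> :: real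
  assumes T: "T > 0" and L: "L > 0" and \<epsilon>: "\<epsilon> > 0"
  obtains \<kappa> y where "\<kappa> \<ge> 1" "\<kappa> \<ge> \<kappa>\<^sub>0" "classical_KdV L 0 (T / 4) y"
    "\<And>x. x \<in> {0..L} \<Longrightarrow> y x 0 = 0" "\<And>x. x \<in> {0..L} \<Longrightarrow> y x (T / 4) = wave T L \<kappa> x (T / 4)"
    "\<And>x t. x \<in> {0..L} \<Longrightarrow> t \<in> {0..T / 4} \<Longrightarrow> \<bar>y x t\<bar> * \<kappa> \<le> \<epsilon>"
proof -
  define \<tau> where "\<tau> = T / 4"
  have \<tau>: "\<tau> > 0" using T by (simp add: \<tau>_def)
  obtain \<theta> :: "nat \<Rightarrow> real \<Rightarrow> real" and K :: real where
    \<theta>: "tower {0..\<tau>} \<theta>" "\<And>n. \<theta> n 0 = 0" "\<theta> 0 \<tau> = 1" "\<And>n. \<theta> (Suc n) \<tau> = 0"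
    and K: "K > 0" "\<And>n t. t \<in> {0..\<tau>} \<Longrightarrow> \<bar>\<theta> n t\<bar> \<le> K * 4 ^ n * fact (2 * n)"
    using gevrey_cutoff[OF \<tau>] by blast
  define R where "R = L + T"
  have R: "R > 0" using T L by (simp add: R_def)
  \<comment> \<open>\<open>B\<close> and \<open>A\<close> attain equality in the conditions of
    \<open>classical_KdV_series\<close>, where \<open>R\<close> bounds \<open>x - t\<close> on the
    domain.\<close>
  define B where "B = 1 / (2 * R)"
  define A where "A = B ^ 3 / 2"
  have B: "B > 0" "2 * B * R \<le> 1" using R by (auto simp: B_def)
  have A: "A > 0" "2 * A \<le> B ^ 3" using B by (auto simp: A_def)
  define b where "b = min 1 (B\<^sup>2)"
  have b: "b > 0" using B by (simp add: b_def)
  \<comment> \<open>A common Gevrey constant for both factors of the data: \<open>4\<close> from the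
    cutoff, \<open>48 / T\<close> from the soliton tail.\<close>
  define \<rho> where "\<rho> = 4 + 48 / T"
  have \<rho>: "\<rho> \<ge> 4" "\<rho> \<ge> 48 / T" "\<rho> > 0" using T by (auto simp: \<rho>_def add_pos_pos)
  \<comment> \<open>The exponential pays for replacing \<open>(2 * \<rho>) ^ n\<close> by
    \<open>A ^ n * fact n\<close>; division by \<open>b\<close>, a lower bound of
    \<open>B ^ k\<close> for \<open>k < 3\<close>, pays for the decay in \<open>k\<close>.\<close>
  define Q where "Q = K * 384 * exp (2 * \<rho> / A) / b"
  have Q: "Q > 0" using K b by (simp add: Q_def)
  define e where "e = (\<lambda>\<kappa>. Q * \<kappa>\<^sup>2 * exp (- (\<kappa> ^ 3 * T)))"
  have lim1: "((\<lambda>\<kappa>. 2 * e \<kappa>) \<longlongrightarrow> 0) at_top" and lim2: "((\<lambda>\<kappa>. 2 * e \<kappa> * \<kappa>) \<longlongrightarrow> 0) at_top"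
    and lim3: "((\<lambda>\<kappa>::real. exp (- (\<kappa> ^ 3 * T))) \<longlongrightarrow> 0) at_top"
    unfolding e_def using T Q by real_asymp+
  have "B\<^sup>2 > 0" using B by simp
  \<comment> \<open>The strict inequalities make the majorant recursion, the drift of particles and
    the tail estimate work. The last two conditions give \<open>s \<ge> 2 * R\<close> and
    \<open>s \<ge> 1\<close> below.\<close>
  have "\<forall>\<^sub>F \<kappa> in at_top. \<kappa> \<ge> 1 \<and> \<kappa> \<ge> \<kappa>\<^sub>0 \<and> 2 * e \<kappa> < B\<^sup>2 \<and> 2 * e \<kappa> * \<kappa> < \<epsilon> \<and> exp (- (\<kappa> ^ 3 * T)) < 1/2
      \<and> \<kappa> \<ge> 8 * R / T \<and> \<kappa> \<ge> 4 / T"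
    by (intro eventually_conj eventually_ge_at_top order_tendstoD(2)[OF lim1 \<open>B\<^sup>2 > 0\<close>]
        order_tendstoD(2)[OF lim2 \<epsilon>] order_tendstoD(2)[OF lim3]) simp
  then obtain \<kappa> where \<kappa>: "\<kappa> \<ge> 1" "\<kappa> \<ge> \<kappa>\<^sub>0" "2 * e \<kappa> < B\<^sup>2" "2 * e \<kappa> * \<kappa> < \<epsilon>"
      "exp (- (\<kappa> ^ 3 * T)) < 1/2" "\<kappa> \<ge> 8 * R / T" "\<kappa> \<ge> 4 / T"
    using eventually_happens'[OF trivial_limit_at_top_linorder] by blast
  have k2: "\<kappa>\<^sup>2 * T \<ge> 8 * R" "\<kappa>\<^sup>2 * T \<ge> 4"
  proof -
    have "\<kappa> * 1 * T \<le> \<kappa> * \<kappa> * T" using \<kappa>(1) T by (intro mult_right_mono mult_left_mono) auto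
    then have "\<kappa> * T \<le> \<kappa>\<^sup>2 * T" by (simp only: power2_eq_square mult_1_right)
    moreover have "8 * R \<le> \<kappa> * T" "4 \<le> \<kappa> * T" using \<kappa>(6,7) T by (auto simp: field_simps)
    ultimately show "\<kappa>\<^sup>2 * T \<ge> 8 * R" "\<kappa>\<^sup>2 * T \<ge> 4" by auto
  qed
  have \<kappa>0: "\<kappa> > 0" using \<kappa> by simp
  define s where "s = \<kappa>\<^sup>2 * T / 4"
  have s: "s \<ge> 2 * R" "s \<ge> 1" "s > 0" using k2 R by (auto simp: s_def)
  \<comment> \<open>The argument of the soliton in \<open>wave\<close> at \<open>x = X + t\<close>
    is \<open>\<xi> t + X\<close>.\<close>
  define \<xi> where "\<xi> = (\<lambda>t. 2 * \<kappa>\<^sup>2 * T + (T - L) / 2 - 4 * \<kappa>\<^sup>2 * t)"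
  have far: "exp (- 2 * \<kappa> * (\<xi> t - X - s)) \<le> exp (- (\<kappa> ^ 3 * T))" if "t \<in> {0..\<tau>}" "\<bar>X\<bar> \<le> R" for t X
  proof -
    have "4 * \<kappa>\<^sup>2 * t \<le> 4 * \<kappa>\<^sup>2 * \<tau>" using that by (intro mult_left_mono) auto
    then have "4 * \<kappa>\<^sup>2 * t \<le> \<kappa>\<^sup>2 * T" by (simp add: \<tau>_def)
    then have "\<kappa>\<^sup>2 * T / 2 \<le> \<xi> t - X - s"
      using k2 that(2) T L unfolding \<xi>_def s_def R_def by (auto simp: field_simps abs_le_iff)
    then have "2 * \<kappa> * (\<kappa>\<^sup>2 * T / 2) \<le> 2 * \<kappa> * (\<xi> t - X - s)"
      using \<kappa>0 by (intro mult_left_mono) auto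
    then show ?thesis by (simp add: power3_eq_cube power2_eq_square mult_ac)
  qed
  have \<xi>_pos: "\<xi> t > 0" if "t \<in> {0..\<tau>}" for t
  proof -
    have "exp (- 2 * \<kappa> * (\<xi> t - 0 - s)) < 1" using far[OF that, of 0] R \<kappa>(5) by linarith
    then have "0 < \<kappa> * (\<xi> t - s)" by simp
    then show ?thesis using \<kappa>0 s by (simp add: zero_less_mult_iff)
  qed
  define D where "D = (\<lambda>k j t. (- 4 * \<kappa>\<^sup>2) ^ j * soliton_deriv \<kappa> (k + j) (\<xi> t) / fact k)"
  have D_tower: "tower {0..\<tau>} (D k)" for k
    unfolding tower_def
  proof (intro allI ballI)
    fix j t assume t: "t \<in> {0..\<tau>}"
    then have p: "\<xi> t \<in> {0<..}" using \<xi>_pos by simp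
    have "(soliton_deriv \<kappa> (k + j) has_real_derivative soliton_deriv \<kappa> (Suc (k + j)) (\<xi> t)) (at (\<xi> t))"
      using towerD[OF soliton_deriv_tower[OF \<kappa>0] p] at_within_open[OF p] by simp
    moreover have "(\<xi> has_real_derivative (- 4 * \<kappa>\<^sup>2)) (at t within {0..\<tau>})"
      unfolding \<xi>_def by (auto intro!: derivative_eq_intros)
    ultimately have "((\<lambda>t. soliton_deriv \<kappa> (k + j) (\<xi> t)) has_real_derivative
        soliton_deriv \<kappa> (Suc (k + j)) (\<xi> t) * (- 4 * \<kappa>\<^sup>2)) (at t within {0..\<tau>})"
      by (rule DERIV_chain2)
    from DERIV_cdivide[OF DERIV_cmult[OF this, of "(- 4 * \<kappa>\<^sup>2) ^ j"], of "fact k"]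
    show "(D k j has_real_derivative D k (Suc j) t) (at t within {0..\<tau>})"
      unfolding D_def by (simp add: mult_ac)
  qed
  define a where "a = 384 * \<kappa>\<^sup>2 * exp (- (\<kappa> ^ 3 * T))"
  have D_le: "\<bar>D k j t\<bar> \<le> a * \<rho> ^ j * fact (2 * j)" if k: "k < 3" and t: "t \<in> {0..\<tau>}" for k j t
  proof -
    have r: "exp (- 2 * \<kappa> * (\<xi> t - s)) \<le> exp (- (\<kappa> ^ 3 * T))"
      using far[OF t, of 0] R by simp
    then have "\<bar>soliton_deriv \<kappa> (k + j) (\<xi> t)\<bar>
        \<le> 192 * \<kappa>\<^sup>2 * exp (- 2 * \<kappa> * (\<xi> t - s)) * fact (k + j) / s ^ (k + j)"
      using \<kappa>(5) by (intro soliton_deriv_bound[OF \<kappa>0 s(3)]) linarith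
    \<comment> \<open>The at most two additional derivatives in \<open>X\<close> cost
      \<open>(j + 2) * (j + 1) \<le> 2 * 3 ^ j\<close>; their powers of \<open>s\<close> are
      dropped, as \<open>s \<ge> 1\<close>. The order is weakened to \<open>2\<close> to match the
      cutoff.\<close>
    also have "\<dots> \<le> 192 * \<kappa>\<^sup>2 * exp (- (\<kappa> ^ 3 * T)) * (2 * 3 ^ j * fact (2 * j)) / s ^ j"
    proof (intro frac_le mult_mono r)
      have "(fact (k + j) :: real) \<le> fact (j + 2)" using k by (intro fact_mono) auto
      also have "\<dots> = real ((j + 2) * (j + 1)) * fact j" by (simp add: algebra_simps)
      also have "\<dots> \<le> (2 * 3 ^ j) * fact (2 * j)"
      proof (intro mult_mono fact_mono)
        have "(j + 2) * (j + 1) \<le> 2 * 3 ^ j" by (induction j) auto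
        then have "real ((j + 2) * (j + 1)) \<le> real (2 * 3 ^ j)" by (simp only: of_nat_le_iff)
        then show "real ((j + 2) * (j + 1)) \<le> 2 * 3 ^ j" by simp
      qed auto
      finally show "(fact (k + j) :: real) \<le> 2 * 3 ^ j * fact (2 * j)" .
      show "s ^ j \<le> s ^ (k + j)" using s by (intro power_increasing) auto
    qed (use s in auto)
    finally have le: "\<bar>soliton_deriv \<kappa> (k + j) (\<xi> t)\<bar> \<le> a * (3 ^ j / s ^ j) * fact (2 * j)"
      by (simp add: a_def mult_ac)
    \<comment> \<open>The decisive cancellation: the speed and the radius \<open>s\<close> are both
      multiples of \<open>\<kappa>\<^sup>2\<close>, so the constant is free of \<kappa>.\<close>
    have e0: "(4 * \<kappa>\<^sup>2) ^ j * (3 ^ j / s ^ j) = (48 / T) ^ j"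
    proof -
      have "4 * \<kappa>\<^sup>2 * 3 / s = 48 / T" using \<kappa>0 T by (simp add: s_def)
      then have "(48 / T) ^ j = (4 * \<kappa>\<^sup>2 * 3 / s) ^ j" by (simp only:)
      then show ?thesis by (simp only: power_divide power_mult_distrib times_divide_eq_right)
    qed
    have e1: "(4 * \<kappa>\<^sup>2) ^ j * (a * (3 ^ j / s ^ j) * fact (2 * j)) = a * (48 / T) ^ j * fact (2 * j)"
      unfolding e0[symmetric] by (simp only: mult_ac)
    have "\<bar>D k j t\<bar> \<le> (4 * \<kappa>\<^sup>2) ^ j * \<bar>soliton_deriv \<kappa> (k + j) (\<xi> t)\<bar> / 1"
      unfolding D_def abs_divide abs_mult power_abs
      by (rule frac_le) (auto simp: fact_ge_1)
    also have "\<dots> \<le> (4 * \<kappa>\<^sup>2) ^ j * (a * (3 ^ j / s ^ j) * fact (2 * j))"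
      using mult_left_mono[OF le, of "(4 * \<kappa>\<^sup>2) ^ j"] by simp
    also have "\<dots> = a * (48 / T) ^ j * fact (2 * j)" by (rule e1)
    also have "\<dots> \<le> a * \<rho> ^ j * fact (2 * j)"
      using \<rho> T by (intro mult_right_mono mult_left_mono power_mono) (auto simp: a_def)
    finally show ?thesis .
  qed
  define c where "c = (\<lambda>t k n. leib (\<lambda>j. \<theta> j t) (\<lambda>j. D k j t) n)"
  have c_le: "\<bar>c t k n\<bar> \<le> kdv_majorant (e \<kappa>) A B k n" if k: "k < 3" and t: "t \<in> {0..\<tau>}" for t k n
  proof -
    have "\<bar>c t k n\<bar> \<le> K * a * (2 * \<rho>) ^ n * fact (2 * n)"
      unfolding c_def
    proof (rule leib_gevrey_le)
      show "\<bar>\<theta> j t\<bar> \<le> K * \<rho> ^ j * fact (2 * j)" for j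
        using K(2)[OF t, of j] K(1) \<rho>
        by (elim order_trans) (intro mult_right_mono mult_left_mono power_mono, auto)
    qed (use D_le[OF k t] \<rho> K in \<open>auto simp: a_def\<close>)
    \<comment> \<open>The gap between Gevrey orders \<open>2\<close> and \<open>3\<close>: the spare
      \<open>fact n\<close> allows the prescribed constant \<open>A\<close>.\<close>
    also have "\<dots> \<le> K * a * (exp (2 * \<rho> / A) * A ^ n * fact n) * fact (2 * n)"
    proof -
      have "(2 * \<rho> / A) ^ n \<le> fact n * exp (2 * \<rho> / A)"
        by (rule power_le_fact_exp) (use \<rho> A in simp)
      then have "(2 * \<rho>) ^ n \<le> exp (2 * \<rho> / A) * A ^ n * fact n"
        using A by (simp add: power_divide field_simps)
      then show ?thesis using K by (intro mult_right_mono mult_left_mono) (auto simp: a_def)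
    qed
    also have "\<dots> = e \<kappa> * b * A ^ n * (fact n * fact (2 * n))"
      using b by (simp add: e_def Q_def a_def)
    also have "\<dots> \<le> e \<kappa> * B ^ k * A ^ n * (fact (3 * n + k) / fact k)"
    proof (intro mult_mono mult_left_mono)
      have "k = 0 \<or> k = 1 \<or> k = 2" using k by auto
      moreover have "b \<le> B" using B by (cases "B \<le> 1") (auto simp: b_def power2_eq_square min_le_iff_disj mult_le_cancel_right2 mult_le_cancel_left1)
      ultimately show "b \<le> B ^ k" by (auto simp: b_def)
      have "fact n * fact (2 * n) * fact k \<le> (fact (3 * n + k) :: nat)"
      proof -
        have "fact n * fact (2 * n) \<le> (fact (3 * n) :: nat)"
          using fact_fact_dvd_fact[of n "2 * n", where 'a = nat] by (intro dvd_imp_le) (auto simp: algebra_simps)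
        then have "fact n * fact (2 * n) * fact k \<le> (fact (3 * n) * fact k :: nat)" by simp
        also have "\<dots> \<le> fact (3 * n + k)"
          using fact_fact_dvd_fact[of "3 * n" k, where 'a = nat] by (intro dvd_imp_le) auto
        finally show ?thesis .
      qed
      then have "real (fact n * fact (2 * n) * fact k) \<le> real (fact (3 * n + k))"
        by (simp only: of_nat_le_iff)
      then show "fact n * fact (2 * n) \<le> (fact (3 * n + k) / fact k :: real)"
        by (simp add: field_simps)
    qed (use Q A B b in \<open>auto simp: e_def\<close>)
    also have "\<dots> = kdv_majorant (e \<kappa>) A B k n" by (simp add: kdv_majorant_def)
    finally show ?thesis .
  qed
  have c_tower: "tower {0..\<tau>} (\<lambda>n t. c t k n)" for k
    unfolding c_def by (rule tower_leib[OF \<theta>(1) D_tower])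
  have box: "\<bar>x - t\<bar> \<le> R" if "x \<in> {0..L}" "t \<in> {0..\<tau>}" for x t
    using that T L by (auto simp: R_def \<tau>_def abs_le_iff)
  define y where "y = (\<lambda>x t. \<Sum>k. kdv_coeff (c t) k 0 * (x - t) ^ k)"
  have e0: "0 \<le> e \<kappa>" using Q by (simp add: e_def)
  note series = classical_KdV_series[where c = c,
      OF e0 less_imp_le[OF \<kappa>(3)] less_imp_le[OF A(1)] A(2) B R]
  have classical: "classical_KdV L 0 \<tau> y"
    unfolding y_def by (rule series(1)) (rule box c_tower c_le; assumption)+
  have small: "\<bar>y x t\<bar> \<le> 2 * e \<kappa>" if "x \<in> {0..L}" "t \<in> {0..\<tau>}" for x t
    unfolding y_def by (rule series(2)[OF _ _ _ that]) (rule box c_tower c_le; assumption)+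
  have "y x 0 = 0" for x
  proof -
    \<comment> \<open>The cutoff is flat at time \<open>0\<close>, so the Cauchy data vanish there
      together with all time derivatives.\<close>
    have "kdv_coeff (c 0) k = (\<lambda>n. 0)" for k
      by (rule kdv_coeff_unique) (auto simp: c_def leib_def \<theta>(2))
    then show ?thesis by (simp add: y_def)
  qed
  moreover have "y x \<tau> = wave T L \<kappa> x \<tau>" if x: "x \<in> {0..L}" for x
  proof -
    have \<tau>S: "\<tau> \<in> {0..\<tau>}" using \<tau> by simp
    have "c \<tau> k n = D k n \<tau>" for k n
    proof -
      \<comment> \<open>At the time \<tau> the cutoff is \<open>1\<close> with vanishing
        derivatives, and only the term \<open>j = 0\<close> of the Leibniz sum survives.\<close>
      have "c \<tau> k n = (\<Sum>j\<le>n. if j = 0 then D k n \<tau> else 0)"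
        unfolding c_def leib_def by (rule sum.cong) (auto simp: \<theta>(3) gr0_conv_Suc \<theta>(4))
      then show ?thesis by simp
    qed
    then have "kdv_coeff (c \<tau>) k 0 = soliton_deriv \<kappa> k (\<xi> \<tau>) / fact k" for k
      using kdv_coeff_soliton[OF \<kappa>0 \<xi>_pos[OF \<tau>S], of "c \<tau>" k 0] by (simp add: D_def)
    moreover have "(\<lambda>k. soliton_deriv \<kappa> k (\<xi> \<tau>) / fact k * (x - \<tau>) ^ k) sums soliton \<kappa> (\<xi> \<tau> + (x - \<tau>))"
    proof (rule soliton_taylor[OF \<kappa>0 s(3)])
      show "2 * \<bar>x - \<tau>\<bar> \<le> s" using box[OF x \<tau>S] s by simp
      show "exp (- 2 * \<kappa> * (\<xi> \<tau> - \<bar>x - \<tau>\<bar> - s)) \<le> 1 / 2"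
        using far[OF \<tau>S, of "\<bar>x - \<tau>\<bar>"] box[OF x \<tau>S] \<kappa>(5) by linarith
    qed
    ultimately have "y x \<tau> = soliton \<kappa> (\<xi> \<tau> + (x - \<tau>))"
      by (simp add: y_def sums_iff)
    also have "\<xi> \<tau> + (x - \<tau>) = x - L / 2 - (4 * \<kappa>\<^sup>2 + 1) * (\<tau> - T / 2)"
      by (simp add: \<xi>_def field_simps)
    finally show ?thesis by (simp add: wave_def)
  qed
  moreover have "\<bar>y x t\<bar> * \<kappa> \<le> \<epsilon>" if "x \<in> {0..L}" "t \<in> {0..\<tau>}" for x t
    using mult_right_mono[OF small[OF that], of \<kappa>] \<kappa>0 \<kappa>(4) by linarith
  ultimately show ?thesis
    using that[OF \<kappa>(1,2) classical[unfolded \<tau>_def]] by (simp add: \<tau>_def)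
qed

section \<open>Gluing and reflecting classical solutions\<close>

lemma has_field_derivative_union:
  assumes "(f has_field_derivative D) (at x within A)" "(f has_field_derivative D) (at x within B)"
  shows "(f has_field_derivative D) (at x within A \<union> B)"
  using assms unfolding has_field_derivative_iff by (rule Lim_Un)

text \<open>Away from \<open>b\<close>, one of the two closed intervals does not contain
  \<open>t\<close>; the filter within it is then trivial and imposes no condition.\<close>

lemma has_real_derivative_glue:
  fixes f g :: "real \<Rightarrow> real"
  assumes abc: "a < b" "b < c" "t \<in> {a..c}" and eq: "f b = g b"
    and f: "t \<le> b \<Longrightarrow> (f has_real_derivative D) (at t within {a..b})"
    and g: "b \<le> t \<Longrightarrow> (g has_real_derivative D) (at t within {b..c})"
  shows "((\<lambda>t. if t \<le> b then f t else g t) has_real_derivative D) (at t within {a..c})"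
proof -
  let ?h = "\<lambda>t. if t \<le> b then f t else g t"
  have "(?h has_real_derivative D) (at t within {a..b})"
  proof (cases "t \<le> b")
    case True
    then show ?thesis
      by (intro has_field_derivative_transform_within[OF f[OF True] zero_less_one]) (use abc in auto)
  next
    case False
    then have "at t within {a..b} = bot" using abc by (simp add: trivial_limit_within)
    then show ?thesis by (simp add: has_field_derivative_iff)
  qed
  moreover have "(?h has_real_derivative D) (at t within {b..c})"
  proof (cases "b \<le> t")
    case True
    then show ?thesis
      by (intro has_field_derivative_transform_within[OF g[OF True] zero_less_one]) (use abc eq in auto)
  next
    case False
    then have "at t within {b..c} = bot" using abc by (simp add: trivial_limit_within)
    then show ?thesis by (simp add: has_field_derivative_iff)
  qed
  moreover have "{a..b} \<union> {b..c} = {a..c}" using abc by auto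
  ultimately show ?thesis using has_field_derivative_union by metis
qed

lemma continuous_on_glue_time:
  fixes f g :: "real \<times> real \<Rightarrow> real"
  assumes "continuous_on (X \<times> {a..b}) f" "continuous_on (X \<times> {b..c}) g" "\<And>x. x \<in> X \<Longrightarrow> f (x, b) = g (x, b)"
  shows "continuous_on (X \<times> {a..c}) (\<lambda>p. if snd p \<le> b then f p else g p)"
proof (rule continuous_on_cases_le)
  show "continuous_on {p \<in> X \<times> {a..c}. snd p \<le> b} f"
    by (rule continuous_on_subset[OF assms(1)]) auto
  show "continuous_on {p \<in> X \<times> {a..c}. b \<le> snd p} g"
    by (rule continuous_on_subset[OF assms(2)]) auto
qed (auto intro!: continuous_intros assms(3))

lemma classical_KdVE:
  assumes "classical_KdV L a b y"
  obtains y1 y2 y3 where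
    "continuous_on ({0..L} \<times> {a..b}) (\<lambda>(x, t). y x t)" "continuous_on ({0..L} \<times> {a..b}) (\<lambda>(x, t). y1 x t)"
    "continuous_on ({0..L} \<times> {a..b}) (\<lambda>(x, t). y2 x t)" "continuous_on ({0..L} \<times> {a..b}) (\<lambda>(x, t). y3 x t)"
    "\<And>x t. x \<in> {0..L} \<Longrightarrow> t \<in> {a..b} \<Longrightarrow> ((\<lambda>x. y x t) has_real_derivative y1 x t) (at x within {0..L})"
    "\<And>x t. x \<in> {0..L} \<Longrightarrow> t \<in> {a..b} \<Longrightarrow> ((\<lambda>x. y1 x t) has_real_derivative y2 x t) (at x within {0..L})"
    "\<And>x t. x \<in> {0..L} \<Longrightarrow> t \<in> {a..b} \<Longrightarrow> ((\<lambda>x. y2 x t) has_real_derivative y3 x t) (at x within {0..L})"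
    "\<And>x t. x \<in> {0..L} \<Longrightarrow> t \<in> {a..b} \<Longrightarrow>
      (y x has_real_derivative - (y1 x t + y3 x t + y x t * y1 x t)) (at t within {a..b})"
  using assms unfolding classical_KdV_def
proof (elim exE conjE, goal_cases)
  case (1 y1 y2 y3)
  show ?case
    by (rule 1(1)[of y1 y2 y3]) (rule 1 | use 1(6) in blast)+
qed

text \<open>Equality of the values at time \<open>b\<close> on the whole interval forces equality of
  all space derivatives, and then the equation makes the one-sided time derivatives agree.\<close>

lemma classical_KdV_glue:
  assumes y: "classical_KdV L a b y" and z: "classical_KdV L b c z" and abc: "a < b" "b < c" and L: "L > 0"
    and yz: "\<And>x. x \<in> {0..L} \<Longrightarrow> y x b = z x b"
  shows "classical_KdV L a c (\<lambda>x t. if t \<le> b then y x t else z x t)"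
proof -
  obtain y1 y2 y3 where Y:
    "continuous_on ({0..L} \<times> {a..b}) (\<lambda>(x, t). y x t)" "continuous_on ({0..L} \<times> {a..b}) (\<lambda>(x, t). y1 x t)"
    "continuous_on ({0..L} \<times> {a..b}) (\<lambda>(x, t). y2 x t)" "continuous_on ({0..L} \<times> {a..b}) (\<lambda>(x, t). y3 x t)"
    and dY: "\<And>x t. x \<in> {0..L} \<Longrightarrow> t \<in> {a..b} \<Longrightarrow> ((\<lambda>x. y x t) has_real_derivative y1 x t) (at x within {0..L})"
    "\<And>x t. x \<in> {0..L} \<Longrightarrow> t \<in> {a..b} \<Longrightarrow> ((\<lambda>x. y1 x t) has_real_derivative y2 x t) (at x within {0..L})"
    "\<And>x t. x \<in> {0..L} \<Longrightarrow> t \<in> {a..b} \<Longrightarrow> ((\<lambda>x. y2 x t) has_real_derivative y3 x t) (at x within {0..L})"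
    "\<And>x t. x \<in> {0..L} \<Longrightarrow> t \<in> {a..b} \<Longrightarrow>
      (y x has_real_derivative - (y1 x t + y3 x t + y x t * y1 x t)) (at t within {a..b})"
    by (rule classical_KdVE[OF y]) (rule that)
  obtain z1 z2 z3 where Z:
    "continuous_on ({0..L} \<times> {b..c}) (\<lambda>(x, t). z x t)" "continuous_on ({0..L} \<times> {b..c}) (\<lambda>(x, t). z1 x t)"
    "continuous_on ({0..L} \<times> {b..c}) (\<lambda>(x, t). z2 x t)" "continuous_on ({0..L} \<times> {b..c}) (\<lambda>(x, t). z3 x t)"
    and dZ: "\<And>x t. x \<in> {0..L} \<Longrightarrow> t \<in> {b..c} \<Longrightarrow> ((\<lambda>x. z x t) has_real_derivative z1 x t) (at x within {0..L})"
    "\<And>x t. x \<in> {0..L} \<Longrightarrow> t \<in> {b..c} \<Longrightarrow> ((\<lambda>x. z1 x t) has_real_derivative z2 x t) (at x within {0..L})"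
    "\<And>x t. x \<in> {0..L} \<Longrightarrow> t \<in> {b..c} \<Longrightarrow> ((\<lambda>x. z2 x t) has_real_derivative z3 x t) (at x within {0..L})"
    "\<And>x t. x \<in> {0..L} \<Longrightarrow> t \<in> {b..c} \<Longrightarrow>
      (z x has_real_derivative - (z1 x t + z3 x t + z x t * z1 x t)) (at t within {b..c})"
    by (rule classical_KdVE[OF z]) (rule that)
  have b: "b \<in> {a..b}" "b \<in> {b..c}" using abc by auto
  have uniq: "f' = g'" if "x \<in> {0..L}" "(f has_real_derivative f') (at x within {0..L})"
    "(g has_real_derivative g') (at x within {0..L})" "\<And>x. x \<in> {0..L} \<Longrightarrow> f x = g x" for f g f' g' x
  proof (rule has_field_derivative_unique[OF that(2)])
    show "(f has_real_derivative g') (at x within {0..L})"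
      by (rule has_field_derivative_transform_within[OF that(3) zero_less_one that(1)]) (simp add: that(4))
    show "at x within {0..L} \<noteq> bot" using that(1) L by (simp add: trivial_limit_within)
  qed
  have eq1: "y1 x b = z1 x b" if "x \<in> {0..L}" for x
    by (rule uniq[OF that dY(1)[OF that b(1)] dZ(1)[OF that b(2)]]) (rule yz)
  have eq2: "y2 x b = z2 x b" if "x \<in> {0..L}" for x
    by (rule uniq[OF that dY(2)[OF that b(1)] dZ(2)[OF that b(2)]]) (rule eq1)
  have eq3: "y3 x b = z3 x b" if "x \<in> {0..L}" for x
    by (rule uniq[OF that dY(3)[OF that b(1)] dZ(3)[OF that b(2)]]) (rule eq2)
  let ?g = "\<lambda>f h x t. if t \<le> b then f x t else h x t"
  have cont: "continuous_on ({0..L} \<times> {a..c}) (\<lambda>(x, t). ?g f h x t)"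
    if "continuous_on ({0..L} \<times> {a..b}) (\<lambda>(x, t). f x t)" "continuous_on ({0..L} \<times> {b..c}) (\<lambda>(x, t). h x t)"
      "\<And>x. x \<in> {0..L} \<Longrightarrow> f x b = h x b" for f h :: "real \<Rightarrow> real \<Rightarrow> real"
    using continuous_on_glue_time[OF that(1,2)] that(3) by (simp add: case_prod_beta cong: if_cong)
  have dx: "((\<lambda>x. ?g f h x t) has_real_derivative ?g f1 h1 x t) (at x within {0..L})"
    if "t \<in> {a..c}" "t \<in> {a..b} \<Longrightarrow> ((\<lambda>x. f x t) has_real_derivative f1 x t) (at x within {0..L})"
      "t \<in> {b..c} \<Longrightarrow> ((\<lambda>x. h x t) has_real_derivative h1 x t) (at x within {0..L})" for f h f1 h1 x t
    using that by (cases "t \<le> b") auto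
  have dt: "((\<lambda>t. ?g y z x t) has_real_derivative
      - (?g y1 z1 x t + ?g y3 z3 x t + ?g y z x t * ?g y1 z1 x t)) (at t within {a..c})"
    if x: "x \<in> {0..L}" and t: "t \<in> {a..c}" for x t
  proof (rule has_real_derivative_glue[OF abc t, where f = "y x" and g = "z x", OF yz[OF x]])
    assume "t \<le> b"
    then show "(y x has_real_derivative - (?g y1 z1 x t + ?g y3 z3 x t + ?g y z x t * ?g y1 z1 x t)) (at t within {a..b})"
      using dY(4)[OF x, of t] t by simp
  next
    assume "b \<le> t"
    then have "- (?g y1 z1 x t + ?g y3 z3 x t + ?g y z x t * ?g y1 z1 x t)
        = - (z1 x t + z3 x t + z x t * z1 x t)"
      using yz[OF x] eq1[OF x] eq3[OF x] by (cases "t = b") auto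
    then show "(z x has_real_derivative - (?g y1 z1 x t + ?g y3 z3 x t + ?g y z x t * ?g y1 z1 x t)) (at t within {b..c})"
      using dZ(4)[OF x, of t] t \<open>b \<le> t\<close> by simp
  qed
  show ?thesis
    unfolding classical_KdV_def
  proof (rule exI[of _ "?g y1 z1"], rule exI[of _ "?g y2 z2"], rule exI[of _ "?g y3 z3"], intro conjI ballI)
    show "continuous_on ({0..L} \<times> {a..c}) (\<lambda>(x, t). ?g y z x t)" by (rule cont[OF Y(1) Z(1) yz])
    show "continuous_on ({0..L} \<times> {a..c}) (\<lambda>(x, t). ?g y1 z1 x t)" by (rule cont[OF Y(2) Z(2) eq1])
    show "continuous_on ({0..L} \<times> {a..c}) (\<lambda>(x, t). ?g y2 z2 x t)" by (rule cont[OF Y(3) Z(3) eq2])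
    show "continuous_on ({0..L} \<times> {a..c}) (\<lambda>(x, t). ?g y3 z3 x t)" by (rule cont[OF Y(4) Z(4) eq3])
    fix x t assume xt: "x \<in> {0..L}" "t \<in> {a..c}"
    show "((\<lambda>x. ?g y z x t) has_real_derivative ?g y1 z1 x t) (at x within {0..L})"
      by (rule dx[OF xt(2) dY(1) dZ(1)]) (use xt in auto)
    show "((\<lambda>x. ?g y1 z1 x t) has_real_derivative ?g y2 z2 x t) (at x within {0..L})"
      by (rule dx[OF xt(2) dY(2) dZ(2)]) (use xt in auto)
    show "((\<lambda>x. ?g y2 z2 x t) has_real_derivative ?g y3 z3 x t) (at x within {0..L})"
      by (rule dx[OF xt(2) dY(3) dZ(3)]) (use xt in auto)
    show "(?g y z x has_real_derivative - (?g y1 z1 x t + ?g y3 z3 x t + ?g y z x t * ?g y1 z1 x t))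
        (at t within {a..c})"
      by (rule dt[OF xt])
  qed
qed

text \<open>Each term of the equation contains an odd number of derivatives, so reversing space and
  time together changes all signs at once.\<close>

lemma classical_KdV_reflect:
  assumes "classical_KdV L a b y"
  shows "classical_KdV L (c - b) (c - a) (\<lambda>x t. y (L - x) (c - t))"
proof -
  obtain y1 y2 y3 where Y:
    "continuous_on ({0..L} \<times> {a..b}) (\<lambda>(x, t). y x t)" "continuous_on ({0..L} \<times> {a..b}) (\<lambda>(x, t). y1 x t)"
    "continuous_on ({0..L} \<times> {a..b}) (\<lambda>(x, t). y2 x t)" "continuous_on ({0..L} \<times> {a..b}) (\<lambda>(x, t). y3 x t)"
    and dY: "\<And>x t. x \<in> {0..L} \<Longrightarrow> t \<in> {a..b} \<Longrightarrow> ((\<lambda>x. y x t) has_real_derivative y1 x t) (at x within {0..L})"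
    "\<And>x t. x \<in> {0..L} \<Longrightarrow> t \<in> {a..b} \<Longrightarrow> ((\<lambda>x. y1 x t) has_real_derivative y2 x t) (at x within {0..L})"
    "\<And>x t. x \<in> {0..L} \<Longrightarrow> t \<in> {a..b} \<Longrightarrow> ((\<lambda>x. y2 x t) has_real_derivative y3 x t) (at x within {0..L})"
    "\<And>x t. x \<in> {0..L} \<Longrightarrow> t \<in> {a..b} \<Longrightarrow>
      (y x has_real_derivative - (y1 x t + y3 x t + y x t * y1 x t)) (at t within {a..b})"
    by (rule classical_KdVE[OF assms]) (rule that)
  have refl: "((\<lambda>s. f (r - s)) has_real_derivative - D) (at s within {r - v..r - u})"
    if "(f has_real_derivative D) (at (r - s) within {u..v})" for f r s u v D
  proof -
    have "((\<lambda>s. r - s) has_real_derivative - 1) (at s within {r - v..r - u})"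
      by (auto intro!: derivative_eq_intros)
    moreover have "(\<lambda>s. r - s) ` {r - v..r - u} = {u..v}"
      by (auto simp: image_iff intro!: bexI[of _ "r - _"])
    ultimately show ?thesis
      using DERIV_image_chain[of f D "\<lambda>s. r - s" s "{r - v..r - u}" "- 1"] that by (simp add: o_def)
  qed
  have rx: "((\<lambda>x. f (L - x)) has_real_derivative - D) (at x within {0..L})"
    if "(f has_real_derivative D) (at (L - x) within {0..L})" for f D x
    using refl[OF that] by simp
  have cont: "continuous_on ({0..L} \<times> {c - b..c - a}) (\<lambda>p. f (L - fst p) (c - snd p))"
    if "continuous_on ({0..L} \<times> {a..b}) (\<lambda>(x, t). f x t)" for f :: "real \<Rightarrow> real \<Rightarrow> real"
  proof -
    have "continuous_on ({0..L} \<times> {c - b..c - a}) (\<lambda>p. (\<lambda>(x, t). f x t) (L - fst p, c - snd p))"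
      by (rule continuous_on_compose2[OF that]) (auto intro!: continuous_intros)
    then show ?thesis by simp
  qed
  have cs: "- (- y1 (L - x) s + - y3 (L - x) s + y (L - x) s * - y1 (L - x) s)
      = - (- (y1 (L - x) s + y3 (L - x) s + y (L - x) s * y1 (L - x) s))" for x s
    by simp
  show ?thesis
    unfolding classical_KdV_def
  proof (rule exI[of _ "\<lambda>x t. - y1 (L - x) (c - t)"], rule exI[of _ "\<lambda>x t. y2 (L - x) (c - t)"],
      rule exI[of _ "\<lambda>x t. - y3 (L - x) (c - t)"], intro conjI ballI)
    fix x t assume "x \<in> {0..L}" "t \<in> {c - b..c - a}"
    then have xt: "L - x \<in> {0..L}" "c - t \<in> {a..b}" by auto
    show "((\<lambda>x. y (L - x) (c - t)) has_real_derivative - y1 (L - x) (c - t)) (at x within {0..L})"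
      by (rule rx[OF dY(1)[OF xt]])
    show "((\<lambda>x. - y1 (L - x) (c - t)) has_real_derivative y2 (L - x) (c - t)) (at x within {0..L})"
      using DERIV_minus[OF rx[OF dY(2)[OF xt]]] by simp
    show "((\<lambda>x. y2 (L - x) (c - t)) has_real_derivative - y3 (L - x) (c - t)) (at x within {0..L})"
      by (rule rx[OF dY(3)[OF xt]])
    show "((\<lambda>t. y (L - x) (c - t)) has_real_derivative - (- y1 (L - x) (c - t) + - y3 (L - x) (c - t)
        + y (L - x) (c - t) * - y1 (L - x) (c - t))) (at t within {c - b..c - a})"
      unfolding cs by (rule refl[OF dY(4)[OF xt]])
  qed (use cont[OF Y(1)] cont[OF Y(2)] cont[OF Y(3)] cont[OF Y(4)] in
      \<open>auto simp: case_prod_beta intro!: continuous_on_minus\<close>)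
qed

lemma kdv_control_solution:
  fixes T L \<kappa>\<^sub>0 \<epsilon> :: real
  assumes T: "T > 0" and L: "L > 0" and \<epsilon>: "\<epsilon> > 0"
  obtains \<kappa> y where "\<kappa> \<ge> 1" "\<kappa> \<ge> \<kappa>\<^sub>0" "classical_KdV L 0 T y" "\<And>x. x \<in> {0..L} \<Longrightarrow> y x 0 = 0"
    "\<And>x t. y (L - x) (T - t) = y x t"
    "\<And>x t. x \<in> {0..L} \<Longrightarrow> t \<in> {T / 4..T / 2} \<Longrightarrow> y x t = wave T L \<kappa> x t"
    "\<And>x t. x \<in> {0..L} \<Longrightarrow> t \<in> {0..T / 4} \<Longrightarrow> \<bar>y x t\<bar> * \<kappa> \<le> \<epsilon>"
proof -
  obtain \<kappa> q where \<kappa>: "\<kappa> \<ge> 1" "\<kappa> \<ge> \<kappa>\<^sub>0" and q: "classical_KdV L 0 (T / 4) q"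
    "\<And>x. x \<in> {0..L} \<Longrightarrow> q x 0 = 0" "\<And>x. x \<in> {0..L} \<Longrightarrow> q x (T / 4) = wave T L \<kappa> x (T / 4)"
    "\<And>x t. x \<in> {0..L} \<Longrightarrow> t \<in> {0..T / 4} \<Longrightarrow> \<bar>q x t\<bar> * \<kappa> \<le> \<epsilon>"
    by (rule kdv_transition[OF assms, of \<kappa>\<^sub>0]) (rule that)
  define h where "h = (\<lambda>x t. if t \<le> T / 4 then q x t else wave T L \<kappa> x t)"
  have h: "classical_KdV L 0 (T / 2) h"
    unfolding h_def by (rule classical_KdV_glue[OF q(1) classical_KdV_wave]) (use T L q(3) in auto)
  \<comment> \<open>At \<open>T / 2\<close> the crest is at the midpoint, so evenness of the soliton
    makes the two halves fit.\<close>
  have mid: "h (L - x) (T / 2) = h x (T / 2)" for x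
    using soliton_even[of \<kappa> "x - L / 2"] T by (simp add: h_def wave_def)
  define y where "y = (\<lambda>x t. if t \<le> T / 2 then h x t else h (L - x) (T - t))"
  have y: "classical_KdV L 0 T y"
    unfolding y_def
  proof (rule classical_KdV_glue[OF h])
    show "classical_KdV L (T / 2) T (\<lambda>x t. h (L - x) (T - t))"
      using classical_KdV_reflect[OF h, of T] by simp
  qed (use T L mid in auto)
  show ?thesis
  proof (rule that[OF \<kappa> y])
    show "y (L - x) (T - t) = y x t" for x t
    \<comment> \<open>Otherwise exactly one of \<open>t\<close> and \<open>T - t\<close> lies in the
      branch \<open>\<le> T / 2\<close>. At \<open>t = T / 2\<close> both do, and the symmetry of
      the middle profile is needed.\<close>
    proof (cases "t = T / 2")
      case True
      have "T - T / 2 = T / 2" by simp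
      then show ?thesis
        unfolding True y_def using mid[of x] by (simp only: order_refl if_True)
    qed (auto simp: y_def field_simps)
    show "y x t = wave T L \<kappa> x t" if "x \<in> {0..L}" "t \<in> {T / 4..T / 2}" for x t
      using that q(3) by (cases "t = T / 4") (auto simp: y_def h_def)
  qed (use T q in \<open>auto simp: y_def h_def\<close>)
qed

section \<open>Weak derivatives\<close>

lemma continuous_box_integral:
  fixes f :: "'a::euclidean_space \<Rightarrow> real"
  assumes "continuous_on (cbox a b) f"
  shows "integrable (lebesgue_on (box a b)) f"
    and "integral\<^sup>L (lebesgue_on (box a b)) f = integral (cbox a b) f"
proof -
  have "f absolutely_integrable_on cbox a b"
    by (rule absolutely_integrable_continuous[OF assms])
  then have "f absolutely_integrable_on box a b"
    by (simp add: absolutely_integrable_on_open_interval)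
  then show int: "integrable (lebesgue_on (box a b)) f"
    by (rule absolutely_integrable_imp_integrable) simp
  have "integral\<^sup>L (lebesgue_on (box a b)) f = integral (box a b) f"
    by (rule lebesgue_integral_eq_integral[OF int]) simp
  then show "integral\<^sup>L (lebesgue_on (box a b)) f = integral (cbox a b) f"
    by (simp add: integral_open_interval)
qed

text \<open>The factor \<open>c\<close> is carried along because a derivative in direction
  \<open>v\<close> multiplies it by \<open>v\<close>.\<close>

lemma C_k_tower:
  assumes "tower UNIV F"
  shows "C_k k (\<lambda>z. c * F n z)"
proof (induction k arbitrary: c n)
  have der: "((\<lambda>z. c * F n z) has_derivative (\<lambda>v. c * F (Suc n) z * v)) (at z)" for c n z
  proof -
    have "((\<lambda>z. c * F n z) has_real_derivative c * F (Suc n) z) (at z)"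
      using towerD[OF assms, of z n] by (intro DERIV_cmult) simp
    then show ?thesis by (simp add: has_field_derivative_def)
  qed
  {
    case 0
    have "continuous (at z) (\<lambda>z. c * F n z)" for z
      by (rule has_derivative_continuous[OF der])
    then show ?case by (simp add: continuous_at_imp_continuous_on)
  next
    case (Suc k)
    have "(\<lambda>z. c * F n z) differentiable (at z)" for z
      using der unfolding differentiable_def by blast
    moreover have "(\<lambda>z. frechet_derivative (\<lambda>z. c * F n z) (at z) v) = (\<lambda>z. (c * v) * F (Suc n) z)" for v
      by (simp add: frechet_derivative_at[OF der, symmetric] mult_ac)
    ultimately show ?case using Suc by simp
  }
qed

lemma tower_affine:
  assumes "tower UNIV F"
  shows "tower UNIV (\<lambda>n x. a ^ n * F n (a * x + b))"
  unfolding tower_def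
proof (intro allI ballI)
  fix n x
  have "((\<lambda>x. a * x + b) has_real_derivative a) (at x)"
    by (auto intro!: derivative_eq_intros)
  moreover have "(F n has_real_derivative F (Suc n) (a * x + b)) (at (a * x + b))"
    using towerD[OF assms] by simp
  ultimately have "((\<lambda>x. F n (a * x + b)) has_real_derivative F (Suc n) (a * x + b) * a) (at x)"
    by (rule DERIV_chain2[rotated])
  from DERIV_cmult[OF this, of "a ^ n"]
  show "((\<lambda>x. a ^ n * F n (a * x + b)) has_real_derivative a ^ Suc n * F (Suc n) (a * x + b)) (at x)"
    by (simp add: mult_ac)
qed

text \<open>Test functions supported in \<open>[1 / n, m - 1 / n]\<close> and bounded by
  \<open>1\<close>; they tend pointwise to the indicator of the interval from \<open>0\<close> to
  \<open>m\<close>.\<close>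

definition bump :: "real \<Rightarrow> nat \<Rightarrow> real \<Rightarrow> real" where
  "bump m n x = flat 0 0 (real n * x - 1) * flat 0 0 (real n * (m - x) - 1)"

lemma bump_le_1: "\<bar>bump m n x\<bar> \<le> 1"
  using flat_bound[of 0 0] mult_mono[of "\<bar>flat 0 0 (real n * x - 1)\<bar>" 1 "\<bar>flat 0 0 (real n * (m - x) - 1)\<bar>" 1]
  unfolding bump_def abs_mult by simp

lemma test_function_bump:
  assumes "n > 0" "m \<le> L"
  shows "test_function {0<..<L} (bump m n)"
proof -
  have "tower UNIV (\<lambda>n. flat n 0)"
    by (simp add: tower_def flat_has_derivative del: flat.simps)
  note t = tower_affine[OF this]
  define F where "F = (\<lambda>k x. leib (\<lambda>j. real n ^ j * flat j 0 (real n * x + - 1))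
      (\<lambda>j. (- real n) ^ j * flat j 0 (- real n * x + (real n * m - 1))) k)"
  have "tower UNIV F" unfolding F_def by (intro tower_leib t)
  from C_k_tower[OF this, of _ 1 0]
  have "C_k k (\<lambda>z. F 0 z)" for k by simp
  moreover have "F 0 = bump m n" by (simp add: F_def bump_def fun_eq_iff algebra_simps del: flat.simps)
  ultimately have C: "C_k k (bump m n)" for k by simp
  have "{z. bump m n z \<noteq> 0} \<subseteq> {1 / real n..m - 1 / real n}"
  proof
    fix z assume "z \<in> {z. bump m n z \<noteq> 0}"
    then have "flat 0 0 (real n * z - 1) \<noteq> 0" "flat 0 0 (real n * (m - z) - 1) \<noteq> 0"
      by (auto simp: bump_def)
    then have "real n * z - 1 > 0" "real n * (m - z) - 1 > 0"
      by (meson flat_nonpos not_less)+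
    then show "z \<in> {1 / real n..m - 1 / real n}"
      using assms by (auto simp: field_simps)
  qed
  then have cl: "closure {z. bump m n z \<noteq> 0} \<subseteq> {1 / real n..m - 1 / real n}"
    by (rule closure_minimal) simp
  moreover have "{1 / real n..m - 1 / real n} \<subseteq> {0<..<L}"
  proof
    fix z assume z: "z \<in> {1 / real n..m - 1 / real n}"
    have "1 / real n > 0" using assms by simp
    then show "z \<in> {0<..<L}" using z assms(2) by (smt (verit) atLeastAtMost_iff greaterThanLessThan_iff)
  qed
  moreover have "compact (closure {z. bump m n z \<noteq> 0})"
    using cl by (meson bounded_closed_interval bounded_subset closed_closure compact_eq_bounded_closed)
  ultimately show ?thesis using C by (auto simp: test_function_def)
qed

lemma bump_limit:
  "(\<lambda>n. bump m (Suc n) x) \<longlonglongrightarrow> indicator {0<..<m} x"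
proof (cases "x \<in> {0<..<m}")
  case True
  have lim: "(\<lambda>n. flat 0 0 (real (Suc n) * c - 1)) \<longlonglongrightarrow> 1" if "c > 0" for c :: real
  proof -
    have "filterlim (\<lambda>n. real (Suc n) * c - 1) at_top sequentially"
      using that by real_asymp
    moreover have "(flat 0 0 \<longlongrightarrow> 1) at_top"
    proof (rule Lim_transform_eventually)
      show "((\<lambda>t::real. exp (- inverse t)) \<longlongrightarrow> 1) at_top" by real_asymp
      show "\<forall>\<^sub>F t in at_top. exp (- inverse t) = flat 0 0 t"
        using eventually_gt_at_top[of 0] by eventually_elim simp
    qed
    ultimately show ?thesis by (rule filterlim_compose[rotated])
  qed
  have "(\<lambda>n. bump m (Suc n) x) \<longlonglongrightarrow> 1 * 1"
    unfolding bump_def by (intro tendsto_mult lim) (use True in auto)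
  then show ?thesis using True by simp
next
  case False
  have "bump m (Suc n) x = 0" for n
  proof -
    have "real (Suc n) * x - 1 \<le> 0 \<or> real (Suc n) * (m - x) - 1 \<le> 0"
    proof (cases "x \<le> 0")
      case True
      then show ?thesis using mult_nonneg_nonpos[of "real (Suc n)" x] by simp
    next
      case f: False
      then show ?thesis using False mult_nonneg_nonpos[of "real (Suc n)" "m - x"] by simp
    qed
    then show ?thesis unfolding bump_def using flat_nonpos by (metis mult_zero_left mult_zero_right)
  qed
  then show ?thesis using False by simp
qed

text \<open>Half-lines are closed under intersection and generate the Borel sets, so the integral
  vanishes over every Borel set; the vanishing total integral handles complements. A Lebesgue set
  differs from a Borel set by a null set.\<close>

lemma AE_zero_if_null_initial_integrals:
  fixes U :: "real \<Rightarrow> real"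
  assumes U: "integrable lebesgue U" and null: "\<And>a. (LINT x:{..<a}|lebesgue. U x) = 0"
    and total: "(LINT x|lebesgue. U x) = 0"
  shows "AE x in lebesgue. U x = 0"
proof (rule density_unique_real[OF U, of "\<lambda>x. 0", simplified])
  have si: "set_integrable lebesgue A U" if "A \<in> sets lebesgue" for A
    unfolding set_integrable_def by (rule integrable_mult_indicator[OF that U])
  have leb: "A \<in> sets lebesgue" if "A \<in> sets borel" for A :: "real set"
    using that by (simp add: sets_completionI_sets)
  have borel: "(LINT x:A|lebesgue. U x) = 0" if "A \<in> sets borel" for A
  proof -
    have eq: "sets borel = sigma_sets UNIV (range (lessThan :: real \<Rightarrow> real set))"
      by (subst borel_Iio) simp
    have stable: "Int_stable (range (lessThan :: real \<Rightarrow> real set))"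
    proof -
      have "{..<a} \<inter> {..<b} = {..<min a b}" for a b :: real by auto
      then show ?thesis by (auto simp: Int_stable_def)
    qed
    from that have "A \<in> sigma_sets UNIV (range lessThan)" unfolding eq .
    with stable subset_Pow_Union[of "range lessThan", THEN order_trans, OF Pow_mono[OF subset_UNIV]]
    show ?thesis
    proof (induction rule: sigma_sets_induct_disjoint)
      case (basic A)
      then show ?case using null by auto
    next
      case empty
      then show ?case by (simp add: set_lebesgue_integral_def)
    next
      case (compl A)
      then have A: "A \<in> sets lebesgue" using leb eq by blast
      have "(LINT x:A \<union> (UNIV - A)|lebesgue. U x) = (LINT x:A|lebesgue. U x) + (LINT x:UNIV - A|lebesgue. U x)"
        by (rule set_integral_Un[OF Diff_disjoint si[OF A] si]) (use sets.Diff[OF sets.top A] in simp)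
      moreover have "A \<union> (UNIV - A) = UNIV" by auto
      ultimately show ?case
        using compl total by (simp add: set_lebesgue_integral_def)
    next
      case (union A)
      then have A: "A i \<in> sets lebesgue" for i using leb eq by blast
      have "(LINT x:(\<Union>i. A i)|lebesgue. U x) = (\<Sum>i. LINT x:A i|lebesgue. U x)"
        by (rule lebesgue_integral_countable_add)
           (use A si union in \<open>auto simp: disjoint_family_on_def intro!: si\<close>)
      then show ?case using union by simp
    qed
  qed
  show "(LINT x:A|lebesgue. U x) = 0" if A: "A \<in> sets lebesgue" for A
  proof -
    obtain S N N' where S: "A = S \<union> N" "N \<subseteq> N'" "N' \<in> null_sets lborel" "S \<in> sets lborel"
      using sets_completionE[OF A] by blast
    have "N' \<in> null_sets lebesgue" using S(3) by (simp add: null_sets_completionI)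
    then have "AE x in lebesgue. x \<notin> N'" by (rule AE_not_in)
    then have "(LINT x:A|lebesgue. U x) = (LINT x:S|lebesgue. U x)"
      unfolding set_lebesgue_integral_def
    proof (intro integral_cong_AE)
      have "S \<in> sets lebesgue" using S(4) leb by simp
      then show "(\<lambda>x. indicat_real A x *\<^sub>R U x) \<in> borel_measurable lebesgue"
        "(\<lambda>x. indicat_real S x *\<^sub>R U x) \<in> borel_measurable lebesgue"
        using si A unfolding set_integrable_def by (auto intro: borel_measurable_integrable)
      show "AE x in lebesgue. indicat_real A x *\<^sub>R U x = indicat_real S x *\<^sub>R U x"
        using \<open>AE x in lebesgue. x \<notin> N'\<close> by eventually_elim (use S in \<open>auto simp: indicator_def\<close>)
    qed
    also have "\<dots> = 0" using borel S(4) by simp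
    finally show ?thesis by simp
  qed
qed

lemma L2_integrable:
  assumes "L2 {0<..<L} u"
  shows "integrable (lebesgue_on {0<..<L}) u"
proof (rule Bochner_Integration.integrable_bound)
  have "integrable (lebesgue_on {0<..<L}) (\<lambda>x. 1 :: real)"
    using continuous_box_integral(1)[of 0 L "\<lambda>x. 1"] by simp
  then show "integrable (lebesgue_on {0<..<L}) (\<lambda>x. 1 + (u x)\<^sup>2)"
    using assms by (intro Bochner_Integration.integrable_add) (auto simp: L2_def)
  show "u \<in> borel_measurable (lebesgue_on {0<..<L})" using assms by (simp add: L2_def)
  have "\<bar>a\<bar> \<le> 1 + a\<^sup>2" for a :: real
    using zero_le_power2[of "\<bar>a\<bar> - 1"] abs_ge_zero[of a] unfolding power2_diff power2_abs
    by (simp only: power_one mult_1_right)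
  then show "AE x in lebesgue_on {0<..<L}. norm (u x) \<le> norm (1 + (u x)\<^sup>2)"
    by (auto simp: abs_of_nonneg add_nonneg_nonneg)
qed

text \<open>Testing with \<open>bump\<close> and passing to the limit by dominated convergence gives
  vanishing integrals over all initial intervals.\<close>

lemma fundamental_lemma_of_variations:
  fixes L :: real and u :: "real \<Rightarrow> real"
  assumes u: "integrable (lebesgue_on {0<..<L}) u"
    and test: "\<And>\<phi>. test_function {0<..<L} \<phi> \<Longrightarrow> regular_distr {0<..<L} u \<phi> = 0"
  shows "AE x in lebesgue_on {0<..<L}. u x = 0"
proof -
  let ?M = "lebesgue_on {0<..<L}"
  have initial: "(\<integral>x. indicator {0<..<m} x * u x \<partial>?M) = 0" if "m \<le> L" for m :: real
  proof -
    have "(\<lambda>n. \<integral>x. u x * bump m (Suc n) x \<partial>?M) \<longlonglongrightarrow> (\<integral>x. u x * indicator {0<..<m} x \<partial>?M)"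
    proof (rule integral_dominated_convergence)
      show "(\<lambda>x. u x * indicator {0<..<m} x) \<in> borel_measurable ?M"
      proof -
        have "{0<..<m} \<in> sets ?M"
          by (subst sets_restrict_space_iff) (use that in auto)
        then show ?thesis by (intro borel_measurable_times borel_measurable_integrable[OF u] borel_measurable_indicator)
      qed
      show "(\<lambda>x. u x * bump m (Suc n) x) \<in> borel_measurable ?M" for n
      proof -
        have "C_k 0 (bump m (Suc n))"
          using test_function_bump[of "Suc n" m L] that unfolding test_function_def by blast
        then have "continuous_on UNIV (bump m (Suc n))" by simp
        then have "bump m (Suc n) \<in> borel_measurable ?M"
          by (rule continuous_imp_measurable_on_sets_lebesgue[OF continuous_on_subset]) auto
        then show ?thesis by (rule borel_measurable_times[OF borel_measurable_integrable[OF u]])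
      qed
      show "integrable ?M (\<lambda>x. \<bar>u x\<bar>)" using u by simp
      show "AE x in ?M. (\<lambda>n. u x * bump m (Suc n) x) \<longlonglongrightarrow> u x * indicator {0<..<m} x"
        by (intro AE_I2 tendsto_mult tendsto_const bump_limit)
      show "AE x in ?M. norm (u x * bump m (Suc n) x) \<le> \<bar>u x\<bar>" for n
        using bump_le_1 by (auto simp: abs_mult intro!: mult_left_le)
    qed
    moreover have "(\<integral>x. u x * bump m (Suc n) x \<partial>?M) = 0" for n
      using test[OF test_function_bump[of "Suc n" m L]] that by (simp add: regular_distr_def)
    ultimately show ?thesis by (simp add: LIMSEQ_const_iff mult.commute)
  qed
  define U where "U = (\<lambda>x. indicator {0<..<L} x *\<^sub>R u x)"
  have U: "integrable lebesgue U"
    unfolding U_def by (subst integrable_restrict_space[symmetric]) (use u in auto)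
  have int_eq: "(LINT x|lebesgue. indicator A x *\<^sub>R U x) = (\<integral>x. indicator A x * u x \<partial>?M)" for A
    by (subst integral_restrict_space) (auto simp: U_def mult_ac)
  have "AE x in lebesgue. U x = 0"
  proof (rule AE_zero_if_null_initial_integrals[OF U])
    show "(LINT x:{..<a}|lebesgue. U x) = 0" for a
    proof -
      have "(LINT x:{..<a}|lebesgue. U x) = (\<integral>x. indicator {0<..<min a L} x * u x \<partial>?M)"
        unfolding set_lebesgue_integral_def int_eq
        by (rule Bochner_Integration.integral_cong) (auto simp: indicator_def)
      then show ?thesis by (simp add: initial)
    qed
    show "(LINT x|lebesgue. U x) = 0"
    proof -
      have "(LINT x|lebesgue. U x) = (LINT x|lebesgue. indicator {0<..<L} x *\<^sub>R U x)"
        by (rule Bochner_Integration.integral_cong) (auto simp: U_def indicator_def)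
      then show ?thesis unfolding int_eq using initial[of L] by simp
    qed
  qed
  then show ?thesis
    by (subst AE_restrict_space_iff) (auto simp: U_def)
qed

lemma test_function_frechet_derivative:
  assumes "test_function \<Omega> \<phi>"
  shows "test_function \<Omega> (\<lambda>z. frechet_derivative \<phi> (at z) v)"
proof -
  have C: "C_k (Suc k) \<phi>" for k using assms unfolding test_function_def by blast
  have "{z. frechet_derivative \<phi> (at z) v \<noteq> 0} \<subseteq> closure {z. \<phi> z \<noteq> 0}"
  proof
    fix z assume z: "z \<in> {z. frechet_derivative \<phi> (at z) v \<noteq> 0}"
    show "z \<in> closure {z. \<phi> z \<noteq> 0}"
    proof (rule ccontr)
      assume n: "z \<notin> closure {z. \<phi> z \<noteq> 0}"
      have "((\<lambda>z. 0) has_derivative (\<lambda>v. 0)) (at z)" by simp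
      then have "(\<phi> has_derivative (\<lambda>v. 0)) (at z)"
        by (rule has_derivative_transform_within_open[of _ _ _ _ "- closure {z. \<phi> z \<noteq> 0}"])
           (use n closure_subset[of "{z. \<phi> z \<noteq> 0}"] in auto)
      from fun_cong[OF frechet_derivative_at[OF this], of v] show False using z by simp
    qed
  qed
  then have cl: "closure {z. frechet_derivative \<phi> (at z) v \<noteq> 0} \<subseteq> closure {z. \<phi> z \<noteq> 0}"
    by (rule closure_minimal) simp
  then have "compact (closure {z. frechet_derivative \<phi> (at z) v \<noteq> 0})"
    using assms unfolding test_function_def compact_eq_bounded_closed
    by (meson bounded_subset closed_closure)
  then show ?thesis using C cl assms by (auto simp: test_function_def)
qed

lemma test_function_has_derivative:
  assumes "test_function \<Omega> \<phi>"
  shows "(\<phi> has_derivative frechet_derivative \<phi> (at z)) (at z)"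
proof -
  have "C_k (Suc 0) \<phi>" using assms unfolding test_function_def by blast
  then show ?thesis by (simp add: frechet_derivative_works)
qed

lemma test_function_continuous: "test_function \<Omega> \<phi> \<Longrightarrow> continuous_on S \<phi>"
  using continuous_on_subset[of UNIV \<phi> S] unfolding test_function_def by (metis C_k.simps(1) subset_UNIV)

lemma test_function_zero: "test_function \<Omega> \<phi> \<Longrightarrow> z \<notin> \<Omega> \<Longrightarrow> \<phi> z = 0"
  using closure_subset[of "{z. \<phi> z \<noteq> 0}"] unfolding test_function_def by auto

section \<open>Classical solutions are solutions in \<open>C([0,T]; H\<^sup>2(0,L))\<close>\<close>

lemma regular_distr_continuous:
  fixes f \<phi> :: "'a::euclidean_space \<Rightarrow> real"
  assumes "continuous_on (cbox a b) f" "test_function \<Omega> \<phi>"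
  shows "regular_distr (box a b) f \<phi> = integral (cbox a b) (\<lambda>z. f z * \<phi> z)"
  unfolding regular_distr_def
  by (intro continuous_box_integral(2) continuous_on_mult assms(1) test_function_continuous[OF assms(2)])

lemma distr_deriv_classical:
  fixes f g :: "real \<Rightarrow> real"
  assumes L: "L > 0" and f: "\<And>x. x \<in> {0..L} \<Longrightarrow> (f has_real_derivative g x) (at x within {0..L})"
    and g: "continuous_on {0..L} g" and \<phi>: "test_function {0<..<L} \<phi>"
  shows "distr_deriv 1 (regular_distr {0<..<L} f) \<phi> = regular_distr {0<..<L} g \<phi>"
proof -
  define \<phi>' where "\<phi>' = (\<lambda>z. frechet_derivative \<phi> (at z) 1)"
  have \<phi>': "test_function {0<..<L} \<phi>'"
    unfolding \<phi>'_def by (rule test_function_frechet_derivative[OF \<phi>])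
  have der: "(\<phi> has_real_derivative \<phi>' x) (at x within S)" for x S
  proof -
    have "frechet_derivative \<phi> (at x) = (*) (\<phi>' x)"
    proof
      fix h
      have "bounded_linear (frechet_derivative \<phi> (at x))"
        using test_function_has_derivative[OF \<phi>] by (rule has_derivative_bounded_linear)
      from linear_scale[OF bounded_linear.linear[OF this], of h 1]
      show "frechet_derivative \<phi> (at x) h = \<phi>' x * h" by (simp add: \<phi>'_def mult.commute)
    qed
    then have "(\<phi> has_real_derivative \<phi>' x) (at x)"
      using test_function_has_derivative[OF \<phi>, of x] by (simp add: has_field_derivative_def)
    then show ?thesis by (rule has_field_derivative_at_within)
  qed
  have cf: "continuous_on {0..L} f" by (rule DERIV_continuous_on[OF f])
  have "((\<lambda>x. f x * \<phi>' x + g x * \<phi> x) has_integral f L * \<phi> L - f 0 * \<phi> 0) {0..L}"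
  proof (rule fundamental_theorem_of_calculus)
    show "((\<lambda>x. f x * \<phi> x) has_vector_derivative f x * \<phi>' x + g x * \<phi> x) (at x within {0..L})"
      if "x \<in> {0..L}" for x
      using DERIV_mult[OF f[OF that] der[of x "{0..L}"]]
      by (simp add: has_real_derivative_iff_has_vector_derivative algebra_simps)
  qed (use L in simp)
  moreover have "\<phi> L = 0" "\<phi> 0 = 0" using test_function_zero[OF \<phi>] by auto
  ultimately have "integral {0..L} (\<lambda>x. f x * \<phi>' x + g x * \<phi> x) = 0"
    by (simp add: integral_unique)
  moreover have "integral {0..L} (\<lambda>x. f x * \<phi>' x + g x * \<phi> x)
      = integral {0..L} (\<lambda>x. f x * \<phi>' x) + integral {0..L} (\<lambda>x. g x * \<phi> x)"
    by (intro Henstock_Kurzweil_Integration.integral_add integrable_continuous_real continuous_on_mult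
        cf g test_function_continuous[OF \<phi>] test_function_continuous[OF \<phi>'])
  ultimately show ?thesis
    using regular_distr_continuous[of 0 L f, OF _ \<phi>'] regular_distr_continuous[of 0 L g, OF _ \<phi>] cf g
    by (simp add: distr_deriv_def \<phi>'_def)
qed

lemma L2_continuous:
  assumes "continuous_on {0..L} f"
  shows "L2 {0<..<L} f"
  unfolding L2_def
proof
  show "f \<in> borel_measurable (lebesgue_on {0<..<L})"
    using continuous_box_integral(1)[of 0 L f] assms by (auto intro: borel_measurable_integrable)
  show "integrable (lebesgue_on {0<..<L}) (\<lambda>x. (f x)\<^sup>2)"
    using continuous_box_integral(1)[of 0 L "\<lambda>x. (f x)\<^sup>2"] assms by (auto intro: continuous_intros)
qed

text \<open>\<open>weak_deriv\<close> is an arbitrary choice; the fundamental lemma identifies it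
  almost everywhere with a known continuous weak derivative, which makes the Sobolev norm
  computable.\<close>

lemma weak_deriv_square_integral:
  assumes h: "continuous_on {0..L} h" and w: "has_weak_deriv {0<..<L} j f h"
  shows "integral\<^sup>L (lebesgue_on {0<..<L}) (\<lambda>x. (weak_deriv {0<..<L} j f x)\<^sup>2)
    = integral {0..L} (\<lambda>x. (h x)\<^sup>2)"
proof -
  let ?M = "lebesgue_on {0<..<L}"
  define g where "g = weak_deriv {0<..<L} j f"
  have "\<exists>g. L2 {0<..<L} g \<and> has_weak_deriv {0<..<L} j f g"
    using L2_continuous[OF h] w by blast
  then have "L2 {0<..<L} g \<and> has_weak_deriv {0<..<L} j f g"
    unfolding g_def weak_deriv_def by (rule someI_ex)
  then have g: "L2 {0<..<L} g" "has_weak_deriv {0<..<L} j f g" by auto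
  have ig: "integrable ?M g" and ih: "integrable ?M h"
    by (rule L2_integrable[OF g(1)], rule L2_integrable[OF L2_continuous[OF h]])
  have "AE x in ?M. g x - h x = 0"
  proof (rule fundamental_lemma_of_variations)
    show "integrable ?M (\<lambda>x. g x - h x)" using ig ih by simp
    fix \<phi> assume \<phi>: "test_function {0<..<L} \<phi>"
    have bdd: "\<exists>B. \<forall>x\<in>{0..L}. \<bar>\<phi> x\<bar> \<le> B"
    proof -
      have "compact (\<phi> ` {0..L})"
        by (rule compact_continuous_image[OF test_function_continuous[OF \<phi>]]) simp
      then show ?thesis using compact_imp_bounded bounded_real by fastforce
    qed
    then obtain B where B: "\<And>x. x \<in> {0..L} \<Longrightarrow> \<bar>\<phi> x\<bar> \<le> B" by blast
    have int: "integrable ?M (\<lambda>x. k x * \<phi> x)" if k: "integrable ?M k" for k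
    proof (rule Bochner_Integration.integrable_bound)
      show "integrable ?M (\<lambda>x. k x * B)" using k by simp
      have "\<phi> \<in> borel_measurable ?M"
        by (rule continuous_imp_measurable_on_sets_lebesgue[OF test_function_continuous[OF \<phi>]]) simp
      then show "(\<lambda>x. k x * \<phi> x) \<in> borel_measurable ?M"
        by (rule borel_measurable_times[OF borel_measurable_integrable[OF k]])
      show "AE x in ?M. norm (k x * \<phi> x) \<le> norm (k x * B)"
      proof (rule AE_I2)
        fix x assume "x \<in> space ?M"
        then have "x \<in> {0..L}" by simp
        from B[OF this] have "\<bar>\<phi> x\<bar> \<le> \<bar>B\<bar>" by linarith
        then show "norm (k x * \<phi> x) \<le> norm (k x * B)" by (simp add: abs_mult mult_left_mono)
      qed
    qed
    have "regular_distr {0<..<L} g \<phi> = regular_distr {0<..<L} h \<phi>"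
      using g(2) w \<phi> by (simp add: has_weak_deriv_def)
    then show "regular_distr {0<..<L} (\<lambda>x. g x - h x) \<phi> = 0"
      unfolding regular_distr_def left_diff_distrib
      by (subst Bochner_Integration.integral_diff[OF int[OF ig] int[OF ih]]) simp
  qed
  then have "AE x in ?M. (g x)\<^sup>2 = (h x)\<^sup>2" by eventually_elim simp
  then have "integral\<^sup>L ?M (\<lambda>x. (g x)\<^sup>2) = integral\<^sup>L ?M (\<lambda>x. (h x)\<^sup>2)"
    by (intro integral_cong_AE borel_measurable_power borel_measurable_integrable ig ih)
  also have "\<dots> = integral {0..L} (\<lambda>x. (h x)\<^sup>2)"
    using continuous_box_integral(2)[of 0 L "\<lambda>x. (h x)\<^sup>2"] h by (simp add: continuous_on_power)
  finally show ?thesis by (simp add: g_def)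
qed

lemma sobolev_classical:
  fixes f f1 f2 :: "real \<Rightarrow> real"
  assumes L: "L > 0" and f: "\<And>x. x \<in> {0..L} \<Longrightarrow> (f has_real_derivative f1 x) (at x within {0..L})"
    and f1: "\<And>x. x \<in> {0..L} \<Longrightarrow> (f1 has_real_derivative f2 x) (at x within {0..L})"
    and f2: "continuous_on {0..L} f2"
  shows "sobolev {0<..<L} 2 f"
    and "sobolev_norm {0<..<L} 2 f = sqrt (integral {0..L} (\<lambda>x. (f x)\<^sup>2)
      + integral {0..L} (\<lambda>x. (f1 x)\<^sup>2) + integral {0..L} (\<lambda>x. (f2 x)\<^sup>2))"
proof -
  have c0: "continuous_on {0..L} f" by (rule DERIV_continuous_on[OF f])
  have c1: "continuous_on {0..L} f1" by (rule DERIV_continuous_on[OF f1])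
  have w0: "has_weak_deriv {0<..<L} 0 f f" by (simp add: has_weak_deriv_def)
  have w1: "has_weak_deriv {0<..<L} 1 f f1"
    using distr_deriv_classical[OF L f c1] by (simp add: has_weak_deriv_def)
  have w2: "has_weak_deriv {0<..<L} 2 f f2"
    unfolding has_weak_deriv_def
  proof (intro allI impI)
    fix \<phi> :: "real \<Rightarrow> real" assume \<phi>: "test_function {0<..<L} \<phi>"
    have "(distr_deriv 1 ^^ 2) (regular_distr {0<..<L} f) \<phi>
        = - distr_deriv 1 (regular_distr {0<..<L} f) (\<lambda>z. frechet_derivative \<phi> (at z) 1)"
      by (simp add: numeral_2_eq_2 distr_deriv_def)
    also have "\<dots> = - regular_distr {0<..<L} f1 (\<lambda>z. frechet_derivative \<phi> (at z) 1)"
      using distr_deriv_classical[OF L f c1 test_function_frechet_derivative[OF \<phi>]] by simp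
    also have "\<dots> = distr_deriv 1 (regular_distr {0<..<L} f1) \<phi>"
      by (simp add: distr_deriv_def)
    also have "\<dots> = regular_distr {0<..<L} f2 \<phi>"
      by (rule distr_deriv_classical[OF L f1 f2 \<phi>])
    finally show "(distr_deriv 1 ^^ 2) (regular_distr {0<..<L} f) \<phi> = regular_distr {0<..<L} f2 \<phi>" .
  qed
  note L2s = L2_continuous[OF c0] L2_continuous[OF c1] L2_continuous[OF f2]
  have "\<exists>g. L2 {0<..<L} g \<and> has_weak_deriv {0<..<L} j f g" if "j \<le> 2" for j
  proof -
    consider "j = 0" | "j = 1" | "j = 2" using \<open>j \<le> 2\<close> by linarith
    then show ?thesis using L2s w0 w1 w2 by cases blast+
  qed
  then show "sobolev {0<..<L} 2 f" using L2s(1) by (simp add: sobolev_def)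
  have "{..2::nat} = {0, 1, 2}" by auto
  then show "sobolev_norm {0<..<L} 2 f = sqrt (integral {0..L} (\<lambda>x. (f x)\<^sup>2)
      + integral {0..L} (\<lambda>x. (f1 x)\<^sup>2) + integral {0..L} (\<lambda>x. (f2 x)\<^sup>2))"
    unfolding sobolev_norm_def
    using weak_deriv_square_integral[OF c0 w0] weak_deriv_square_integral[OF c1 w1]
      weak_deriv_square_integral[OF f2 w2]
    by (simp add: add_ac)
qed

text \<open>Continuity of \<open>y\<close>, \<open>y1\<close> and \<open>y2\<close> on the closed
  rectangle suffices: the squared norm is a sum of integrals depending continuously on the parameter
  \<open>t\<close>.\<close>

lemma C_H2_classical:
  assumes L: "L > 0" and y: "classical_KdV L 0 T y"
  shows "C_H2 T L y"
proof -
  obtain y1 y2 y3 where Y: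
    "continuous_on ({0..L} \<times> {0..T}) (\<lambda>(x, t). y x t)" "continuous_on ({0..L} \<times> {0..T}) (\<lambda>(x, t). y1 x t)"
    "continuous_on ({0..L} \<times> {0..T}) (\<lambda>(x, t). y2 x t)"
    and dY: "\<And>x t. x \<in> {0..L} \<Longrightarrow> t \<in> {0..T} \<Longrightarrow> ((\<lambda>x. y x t) has_real_derivative y1 x t) (at x within {0..L})"
    "\<And>x t. x \<in> {0..L} \<Longrightarrow> t \<in> {0..T} \<Longrightarrow> ((\<lambda>x. y1 x t) has_real_derivative y2 x t) (at x within {0..L})"
    by (rule classical_KdVE[OF y]) (rule that)
  have slice: "continuous_on {0..L} (\<lambda>x. f x t)"
    if "continuous_on ({0..L} \<times> {0..T}) (\<lambda>(x, t). f x t)" "t \<in> {0..T}" for f :: "real \<Rightarrow> real \<Rightarrow> real" and t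
  proof -
    have "continuous_on {0..L} (\<lambda>x. (\<lambda>(x, t). f x t) (x, t))"
      by (rule continuous_on_compose2[OF that(1)]) (use that(2) in \<open>auto intro!: continuous_intros\<close>)
    then show ?thesis by simp
  qed
  have "continuous_on {0..L} (\<lambda>x. y x t) \<and> sobolev {0<..<L} 2 (\<lambda>x. y x t)" if t: "t \<in> {0..T}" for t
    using slice[OF Y(1) t] sobolev_classical(1)[OF L dY(1)[OF _ t] dY(2)[OF _ t] slice[OF Y(3) t]] by simp
  moreover have "((\<lambda>t. sobolev_norm {0<..<L} 2 (\<lambda>x. y x t - y x s)) \<longlongrightarrow> 0) (at s within {0..T})"
    if s: "s \<in> {0..T}" for s
  proof -
    define I where "I = (\<lambda>f t. integral {0..L} (\<lambda>x. (f x t - f x s)\<^sup>2) :: real)"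
    have I: "(I f \<longlongrightarrow> 0) (at s within {0..T})"
      if f: "continuous_on ({0..L} \<times> {0..T}) (\<lambda>(x, t). f x t)" for f
    proof -
      have "continuous_on ({0..T} \<times> cbox 0 L) (\<lambda>p. (\<lambda>(x, t). f x t) (snd p, fst p))"
        by (rule continuous_on_compose2[OF f]) (auto intro!: continuous_intros)
      moreover have "continuous_on ({0..T} \<times> cbox 0 L) (\<lambda>p. (\<lambda>(x, t). f x t) (snd p, s))"
        by (rule continuous_on_compose2[OF f]) (use s in \<open>auto intro!: continuous_intros\<close>)
      ultimately have "continuous_on ({0..T} \<times> cbox 0 L) (\<lambda>(t, x). (f x t - f x s)\<^sup>2)"
        by (auto simp: case_prod_beta intro!: continuous_intros)
      then have "continuous_on {0..T} (\<lambda>t. integral (cbox 0 L) (\<lambda>x. (f x t - f x s)\<^sup>2))"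
        by (rule integral_continuous_on_param)
      then have "continuous_on {0..T} (I f)" by (simp add: I_def)
      then have "(I f \<longlongrightarrow> I f s) (at s within {0..T})" using s by (simp add: continuous_on_def)
      then show ?thesis by (simp add: I_def)
    qed
    have "((\<lambda>t. sqrt (I y t + I y1 t + I y2 t)) \<longlongrightarrow> sqrt (0 + 0 + 0)) (at s within {0..T})"
      by (intro tendsto_real_sqrt tendsto_add I Y)
    then have lim: "((\<lambda>t. sqrt (I y t + I y1 t + I y2 t)) \<longlongrightarrow> 0) (at s within {0..T})" by simp
    have eq: "sqrt (I y t + I y1 t + I y2 t) = sobolev_norm {0<..<L} 2 (\<lambda>x. y x t - y x s)"
      if t: "t \<in> {0..T}" for t
      unfolding I_def
      by (rule sobolev_classical(2)[OF L, symmetric])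
         (intro DERIV_diff dY continuous_on_diff slice[OF Y(3)] s t; assumption)+
    have "\<forall>\<^sub>F t in at s within {0..T}.
        sqrt (I y t + I y1 t + I y2 t) = sobolev_norm {0<..<L} 2 (\<lambda>x. y x t - y x s)"
      unfolding eventually_at_filter using eq by simp
    from Lim_transform_eventually[OF lim this] show ?thesis .
  qed
  ultimately show ?thesis unfolding C_H2_def by blast
qed

lemma has_real_derivative_line:
  fixes \<phi> :: "real \<times> real \<Rightarrow> real"
  assumes "test_function \<Omega> \<phi>"
  shows "((\<lambda>x. \<phi> (x, t)) has_real_derivative frechet_derivative \<phi> (at (x, t)) (1, 0)) (at x within S)"
    and "((\<lambda>t. \<phi> (x, t)) has_real_derivative frechet_derivative \<phi> (at (x, t)) (0, 1)) (at t within S)"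
proof -
  let ?D = "frechet_derivative \<phi> (at (x, t))"
  note D = test_function_has_derivative[OF assms, of "(x, t)"]
  have lin: "?D (h *\<^sub>R v) = h *\<^sub>R ?D v" for h v
    by (rule linear_scale[OF bounded_linear.linear[OF has_derivative_bounded_linear[OF D]]])
  have "((\<lambda>x. (x, t)) has_derivative (\<lambda>h. (h, 0))) (at x within S)"
    by (auto intro!: derivative_eq_intros)
  from has_derivative_compose[OF this D]
  have "((\<lambda>x. \<phi> (x, t)) has_derivative (\<lambda>h. ?D (h, 0))) (at x within S)" .
  moreover have "(\<lambda>h. ?D (h, 0)) = (*) (?D (1, 0))"
  proof
    fix h
    show "?D (h, 0) = ?D (1, 0) * h" using lin[of h "(1, 0)"] by (simp add: mult.commute)
  qed
  ultimately show "((\<lambda>x. \<phi> (x, t)) has_real_derivative ?D (1, 0)) (at x within S)"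
    by (simp add: has_field_derivative_def)
  have "((\<lambda>t. (x, t)) has_derivative (\<lambda>h. (0, h))) (at t within S)"
    by (auto intro!: derivative_eq_intros)
  from has_derivative_compose[OF this D]
  have "((\<lambda>t. \<phi> (x, t)) has_derivative (\<lambda>h. ?D (0, h))) (at t within S)" .
  moreover have "(\<lambda>h. ?D (0, h)) = (*) (?D (0, 1))"
  proof
    fix h
    show "?D (0, h) = ?D (0, 1) * h" using lin[of h "(0, 1)"] by (simp add: mult.commute)
  qed
  ultimately show "((\<lambda>t. \<phi> (x, t)) has_real_derivative ?D (0, 1)) (at t within S)"
    by (simp add: has_field_derivative_def)
qed

lemma integral_derivative_zero:
  fixes F f :: "real \<Rightarrow> real"
  assumes "a \<le> b" "\<And>x. x \<in> {a..b} \<Longrightarrow> (F has_real_derivative f x) (at x within {a..b})" "F a = 0" "F b = 0"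
  shows "integral {a..b} f = 0"
  using fundamental_theorem_of_calculus[OF assms(1), of F f] assms(2-4)
  by (auto simp: has_real_derivative_iff_has_vector_derivative integral_unique)

text \<open>Up to the equation, the integrand of the weak formulation is
  \<open>\<partial>\<^sub>t (y \<phi>) + \<partial>\<^sub>x (y \<phi> + y \<phi>\<^sub>x\<^sub>x - y\<^sub>x \<phi>\<^sub>x + y\<^sub>x\<^sub>x \<phi>)\<close>.\<close>

lemma KdV_classical:
  assumes L: "L > 0" and T: "T > 0" and y: "classical_KdV L 0 T y"
  shows "KdV T L y"
proof -
  let ?\<Omega> = "{0<..<L} \<times> {0<..<T}"
  let ?C = "cbox (0, 0) (L, T)"
  obtain y1 y2 y3 where Y:
    "continuous_on ({0..L} \<times> {0..T}) (\<lambda>(x, t). y x t)" "continuous_on ({0..L} \<times> {0..T}) (\<lambda>(x, t). y1 x t)"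
    "continuous_on ({0..L} \<times> {0..T}) (\<lambda>(x, t). y2 x t)" "continuous_on ({0..L} \<times> {0..T}) (\<lambda>(x, t). y3 x t)"
    and dY: "\<And>x t. x \<in> {0..L} \<Longrightarrow> t \<in> {0..T} \<Longrightarrow> ((\<lambda>x. y x t) has_real_derivative y1 x t) (at x within {0..L})"
    "\<And>x t. x \<in> {0..L} \<Longrightarrow> t \<in> {0..T} \<Longrightarrow> ((\<lambda>x. y1 x t) has_real_derivative y2 x t) (at x within {0..L})"
    "\<And>x t. x \<in> {0..L} \<Longrightarrow> t \<in> {0..T} \<Longrightarrow> ((\<lambda>x. y2 x t) has_real_derivative y3 x t) (at x within {0..L})"
    "\<And>x t. x \<in> {0..L} \<Longrightarrow> t \<in> {0..T} \<Longrightarrow>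
      (y x has_real_derivative - (y1 x t + y3 x t + y x t * y1 x t)) (at t within {0..T})"
    by (rule classical_KdVE[OF y]) (rule that)
  have C: "?C = {0..L} \<times> {0..T}" by (simp add: cbox_Pair_eq)
  have \<Omega>: "?\<Omega> = box (0, 0) (L, T)" by (auto simp: box_def Basis_prod_def inner_Pair)
  have Yc: "continuous_on ?C (\<lambda>p. y (fst p) (snd p))" "continuous_on ?C (\<lambda>p. y1 (fst p) (snd p))"
    "continuous_on ?C (\<lambda>p. y3 (fst p) (snd p))"
    using Y unfolding C by (simp_all add: case_prod_beta)
  have dy1: "deriv (\<lambda>\<xi>. y \<xi> t) x = y1 x t" if "(x, t) \<in> ?\<Omega>" for x t
  proof -
    have "((\<lambda>x. y x t) has_real_derivative y1 x t) (at x)"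
      using dY(1)[of x t] that at_within_Icc_at[of 0 x L] by simp
    then show ?thesis by (rule DERIV_imp_deriv)
  qed
  have "distr_deriv (0, 1) (regular_distr ?\<Omega> (\<lambda>(x, t). y x t)) \<phi>
      + distr_deriv (1, 0) (regular_distr ?\<Omega> (\<lambda>(x, t). y x t)) \<phi>
      + distr_deriv (1, 0) (distr_deriv (1, 0) (distr_deriv (1, 0) (regular_distr ?\<Omega> (\<lambda>(x, t). y x t)))) \<phi>
      + regular_distr ?\<Omega> (\<lambda>(x, t). y x t * deriv (\<lambda>\<xi>. y \<xi> t) x) \<phi> = 0"
    if \<phi>: "test_function ?\<Omega> \<phi>" for \<phi>
  proof -
    define D where "D = (\<lambda>(\<phi> :: real \<times> real \<Rightarrow> real) v z. frechet_derivative \<phi> (at z) v)"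
    define a where "a = D \<phi> (1, 0)"
    define b where "b = D a (1, 0)"
    define c where "c = D b (1, 0)"
    define d where "d = D \<phi> (0, 1)"
    have tD: "test_function ?\<Omega> (D \<psi> v)" if "test_function ?\<Omega> \<psi>" for \<psi> v
      unfolding D_def by (rule test_function_frechet_derivative[OF that])
    have a: "test_function ?\<Omega> a" unfolding a_def by (rule tD[OF \<phi>])
    have b: "test_function ?\<Omega> b" unfolding b_def by (rule tD[OF a])
    have c: "test_function ?\<Omega> c" unfolding c_def by (rule tD[OF b])
    have d: "test_function ?\<Omega> d" unfolding d_def by (rule tD[OF \<phi>])
    have dx: "((\<lambda>x. \<phi> (x, t)) has_real_derivative a (x, t)) (at x within S)"
      "((\<lambda>x. a (x, t)) has_real_derivative b (x, t)) (at x within S)"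
      "((\<lambda>x. b (x, t)) has_real_derivative c (x, t)) (at x within S)"
      "((\<lambda>t. \<phi> (x, t)) has_real_derivative d (x, t)) (at t within S)" for x t S
      using has_real_derivative_line[OF \<phi>] has_real_derivative_line[OF a] has_real_derivative_line[OF b]
      by (simp_all add: a_def b_def c_def d_def D_def)
    have R: "regular_distr ?\<Omega> (\<lambda>(x, t). f x t) \<psi> = integral ?C (\<lambda>p. f (fst p) (snd p) * \<psi> p)"
      if "continuous_on ?C (\<lambda>p. f (fst p) (snd p))" "test_function ?\<Omega> \<psi>" for f \<psi>
      using regular_distr_continuous[OF that] unfolding \<Omega> case_prod_unfold .
    have cy1: "continuous_on ?C (\<lambda>p. y (fst p) (snd p) * y1 (fst p) (snd p))"
      by (intro continuous_on_mult Yc)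
    have NL: "regular_distr ?\<Omega> (\<lambda>(x, t). y x t * deriv (\<lambda>\<xi>. y \<xi> t) x) \<phi>
        = integral ?C (\<lambda>p. y (fst p) (snd p) * y1 (fst p) (snd p) * \<phi> p)"
    proof -
      have "regular_distr ?\<Omega> (\<lambda>(x, t). y x t * deriv (\<lambda>\<xi>. y \<xi> t) x) \<phi>
          = regular_distr ?\<Omega> (\<lambda>(x, t). y x t * y1 x t) \<phi>"
        unfolding regular_distr_def
        by (rule Bochner_Integration.integral_cong) (use dy1 in auto)
      also have "\<dots> = integral ?C (\<lambda>p. y (fst p) (snd p) * y1 (fst p) (snd p) * \<phi> p)"
        by (rule R[OF cy1 \<phi>])
      finally show ?thesis .
    qed
    note tc = test_function_continuous[OF \<phi>] test_function_continuous[OF a] test_function_continuous[OF b]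
      test_function_continuous[OF c] test_function_continuous[OF d]
    \<comment> \<open>\<open>P\<close> is the time derivative of \<open>y \<phi>\<close> with
      \<open>y_t\<close> replaced by means of the equation; \<open>Q\<close> is the space derivative
      of the flux. Each has integral \<open>0\<close>, since test functions vanish on the
      boundary.\<close>
    define P where "P = (\<lambda>p. y (fst p) (snd p) * d p
        - (y1 (fst p) (snd p) + y3 (fst p) (snd p) + y (fst p) (snd p) * y1 (fst p) (snd p)) * \<phi> p)"
    define Q where "Q = (\<lambda>p. y1 (fst p) (snd p) * \<phi> p + y (fst p) (snd p) * a p
        + y (fst p) (snd p) * c p + y3 (fst p) (snd p) * \<phi> p)"
    have cP: "continuous_on ?C P" and cQ: "continuous_on ?C Q"
      unfolding P_def Q_def by (intro continuous_intros Yc tc)+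
    have "integral ?C P = integral (cbox 0 L) (\<lambda>x. integral (cbox 0 T) (\<lambda>t. P (x, t)))"
      by (rule integral_prod_continuous[OF cP])
    also have "\<dots> = integral (cbox 0 L) (\<lambda>x. 0)"
    proof (rule Henstock_Kurzweil_Integration.integral_cong)
      fix x assume x: "x \<in> cbox 0 L"
      have "integral {0..T} (\<lambda>t. P (x, t)) = 0"
      proof (rule integral_derivative_zero)
        show "((\<lambda>t. y x t * \<phi> (x, t)) has_real_derivative P (x, t)) (at t within {0..T})"
          if "t \<in> {0..T}" for t
          using DERIV_mult[OF dY(4)[of x t] dx(4)] x that by (simp add: P_def algebra_simps)
      qed (use T test_function_zero[OF \<phi>] in auto)
      then show "integral (cbox 0 T) (\<lambda>t. P (x, t)) = 0" by simp
    qed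
    finally have P0: "integral ?C P = 0" by simp
    have "integral ?C Q = integral (cbox 0 L) (\<lambda>x. integral (cbox 0 T) (\<lambda>t. Q (x, t)))"
      by (rule integral_prod_continuous[OF cQ])
    also have "\<dots> = integral (cbox 0 T) (\<lambda>t. integral (cbox 0 L) (\<lambda>x. Q (x, t)))"
      by (rule integral_swap_continuous[of 0 0 L T "\<lambda>x t. Q (x, t)"]) (use cQ in simp)
    also have "\<dots> = integral (cbox 0 T) (\<lambda>t. 0)"
    proof (rule Henstock_Kurzweil_Integration.integral_cong)
      fix t assume t: "t \<in> cbox 0 T"
      have "integral {0..L} (\<lambda>x. Q (x, t)) = 0"
      proof (rule integral_derivative_zero)
        show "((\<lambda>x. y x t * \<phi> (x, t) + y x t * b (x, t) - y1 x t * a (x, t) + y2 x t * \<phi> (x, t))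
            has_real_derivative Q (x, t)) (at x within {0..L})" if x: "x \<in> {0..L}" for x
        proof -
          have t': "t \<in> {0..T}" using t by simp
          have "((\<lambda>x. y x t * \<phi> (x, t) + y x t * b (x, t) - y1 x t * a (x, t) + y2 x t * \<phi> (x, t))
            has_real_derivative (y1 x t * \<phi> (x, t) + a (x, t) * y x t) + (y1 x t * b (x, t) + c (x, t) * y x t)
              - (y2 x t * a (x, t) + b (x, t) * y1 x t) + (y3 x t * \<phi> (x, t) + a (x, t) * y2 x t))
            (at x within {0..L})"
            by (intro DERIV_add DERIV_diff DERIV_mult dY[OF x t'] dx)
          then show ?thesis by (simp add: Q_def algebra_simps)
        qed
      qed (use L test_function_zero[OF \<phi>] test_function_zero[OF a] test_function_zero[OF b] in auto)
      then show "integral (cbox 0 L) (\<lambda>x. Q (x, t)) = 0" by simp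
    qed
    finally have Q0: "integral ?C Q = 0" by simp
    define J where "J = (\<lambda>\<psi>. integral ?C (\<lambda>p. y (fst p) (snd p) * \<psi> p))"
    define N where "N = integral ?C (\<lambda>p. y (fst p) (snd p) * y1 (fst p) (snd p) * \<phi> p)"
    have int: "(\<lambda>p. y (fst p) (snd p) * \<psi> p) integrable_on ?C" if "test_function ?\<Omega> \<psi>" for \<psi>
      by (intro integrable_continuous continuous_on_mult Yc test_function_continuous[OF that])
    have intN: "(\<lambda>p. y (fst p) (snd p) * y1 (fst p) (snd p) * \<phi> p) integrable_on ?C"
      by (intro integrable_continuous continuous_on_mult Yc tc)
    have "J d + J a + J c - N = integral ?C (\<lambda>p. y (fst p) (snd p) * d p + y (fst p) (snd p) * a p
        + y (fst p) (snd p) * c p - y (fst p) (snd p) * y1 (fst p) (snd p) * \<phi> p)"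
      unfolding J_def N_def
      by (simp add: Henstock_Kurzweil_Integration.integral_add Henstock_Kurzweil_Integration.integral_diff
          integrable_add int a c d intN)
    also have "\<dots> = integral ?C (\<lambda>p. P p + Q p)"
      by (rule arg_cong[where f = "integral ?C"]) (auto simp: P_def Q_def algebra_simps)
    also have "\<dots> = integral ?C P + integral ?C Q"
      by (intro Henstock_Kurzweil_Integration.integral_add integrable_continuous cP cQ)
    finally have "J d + J a + J c - N = 0" using P0 Q0 by simp
    moreover have "regular_distr ?\<Omega> (\<lambda>(x, t). y x t) \<psi> = J \<psi>" if "test_function ?\<Omega> \<psi>" for \<psi>
      using R[OF Yc(1) that] by (simp add: J_def)
    moreover note NL
    ultimately show ?thesis
      using a c d by (simp add: distr_deriv_def a_def b_def c_def d_def D_def N_def)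
  qed
  then show ?thesis by (simp add: KdV_def Let_def)
qed

section \<open>The flow\<close>

lemma at_within_Icc_atLeast:
  fixes a b t :: real
  assumes "t \<in> {a..<b}"
  shows "at t within {a..b} = at t within {a..}"
  by (rule at_within_nhd[of t "{..<b}"]) (use assms in auto)

lemma integral_exp_le:
  fixes K s :: real
  assumes "K > 0" "s \<ge> 0"
  shows "integral {0..s} (\<lambda>r. exp (2 * K * r)) = (exp (2 * K * s) - 1) / (2 * K)"
proof -
  have "((\<lambda>r. exp (2 * K * r)) has_integral exp (2 * K * s) / (2 * K) - exp (2 * K * 0) / (2 * K)) {0..s}"
  proof (rule fundamental_theorem_of_calculus[OF assms(2)])
    show "((\<lambda>r. exp (2 * K * r) / (2 * K)) has_vector_derivative exp (2 * K * x)) (at x within {0..s})" for x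
      unfolding has_real_derivative_iff_has_vector_derivative[symmetric]
      using assms(1) by (auto intro!: derivative_eq_intros)
  qed
  then show ?thesis by (simp add: integral_unique diff_divide_distrib)
qed

text \<open>Picard iteration in the weighted norm \<open>sup exp (- 2 K t) \<bar>p t\<bar>\<close>, in which it contracts on
  the whole half-line.\<close>

lemma global_trajectory_exists:
  fixes F :: "real \<Rightarrow> real \<Rightarrow> real"
  assumes K: "K > 0" and cont: "continuous_on (UNIV \<times> {0..}) (\<lambda>(x, t). F x t)"
    and lip: "\<And>x x' t. t \<ge> 0 \<Longrightarrow> \<bar>F x t - F x' t\<bar> \<le> K * \<bar>x - x'\<bar>"
    and bdd: "\<And>x t. t \<ge> 0 \<Longrightarrow> \<bar>F x t\<bar> \<le> M"
  shows "\<exists>p. p 0 = x0 \<and> (\<forall>t\<ge>0. (p has_real_derivative F (p t) t) (at t within {0..}))"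
proof -
  \<comment> \<open>The unknown is \<open>z t = exp (- 2 * K * t) * (p t - x0)\<close>, so that the
    weighted norm becomes the supremum norm.\<close>
  define g where "g = (\<lambda>(z :: real \<Rightarrow>\<^sub>C real) r. F (x0 + exp (2 * K * r) * z r) r)"
  define J where "J = (\<lambda>z s. integral {0..s} (g z))"
  have cg: "continuous_on S (g z)" if "S \<subseteq> {0..}" for S z
  proof -
    have "continuous_on S (\<lambda>r. (\<lambda>(x, t). F x t) (x0 + exp (2 * K * r) * z r, r))"
      by (rule continuous_on_compose2[OF cont]) (use that in \<open>auto intro!: continuous_intros\<close>)
    then show ?thesis by (simp add: g_def)
  qed
  have ig: "g z integrable_on {0..s}" for z s
    by (rule integrable_continuous_real[OF cg]) auto
  have J: "(J z has_real_derivative g z t) (at t within {0..})" if "t \<ge> 0" for z t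
  proof -
    have "(J z has_real_derivative g z t) (at t within {0..t + 1})"
      unfolding J_def by (rule integral_has_real_derivative[OF cg]) (use that in auto)
    then show ?thesis using at_within_Icc_atLeast[of t 0 "t + 1"] that by simp
  qed
  have J_le: "\<bar>J z s\<bar> \<le> M * s" if "s \<ge> 0" for z s
  proof -
    have "norm (integral {0..s} (g z)) \<le> integral {0..s} (\<lambda>r. M)"
      by (rule integral_norm_bound_integral[OF ig]) (use bdd in \<open>auto simp: g_def\<close>)
    then show ?thesis using that by (simp add: J_def mult.commute)
  qed
  have M: "M \<ge> 0" using bdd[of 0 0] by linarith
  \<comment> \<open>Bounded continuous functions live on the whole line; \<open>max 0 t\<close>
    continues the iterate constantly to negative times.\<close>
  define W where "W = (\<lambda>z t. exp (- (2 * K * max 0 t)) * J z (max 0 t))"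
  have W: "W z \<in> bcontfun" for z
  proof (rule bcontfun_normI)
    have "continuous_on {0..} (J z)" by (rule DERIV_continuous_on[OF J]) simp
    then have "continuous_on UNIV (\<lambda>t. J z (max 0 t))"
      by (rule continuous_on_compose2) (auto intro!: continuous_intros)
    then show "continuous_on UNIV (W z)" unfolding W_def by (intro continuous_intros)
    show "norm (W z t) \<le> M / (2 * K)" for t
    proof -
      define s where "s = max 0 t"
      have s: "s \<ge> 0" by (simp add: s_def)
      have "2 * K * s \<le> exp (2 * K * s)" using exp_ge_add_one_self[of "2 * K * s"] by linarith
      then have se: "s \<le> exp (2 * K * s) / (2 * K)" using K by (simp add: field_simps)
      have "norm (W z t) = exp (- (2 * K * s)) * \<bar>J z s\<bar>"
        by (simp add: W_def s_def abs_mult)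
      also have "\<dots> \<le> exp (- (2 * K * s)) * (M * s)"
        by (rule mult_left_mono[OF J_le[OF s]]) simp
      also have "\<dots> \<le> exp (- (2 * K * s)) * (M * (exp (2 * K * s) / (2 * K)))"
        by (intro mult_left_mono se M) auto
      also have "\<dots> = M / (2 * K) * (exp (- (2 * K * s)) * exp (2 * K * s))" by simp
      also have "\<dots> = M / (2 * K)" by (simp flip: exp_add)
      finally show ?thesis .
    qed
  qed
  define \<Psi> where "\<Psi> = (\<lambda>z. Bcontfun (W z))"
  have \<Psi>: "apply_bcontfun (\<Psi> z) t = W z t" for z t
    by (simp add: \<Psi>_def Bcontfun_inverse[OF W])
  have contract: "dist (\<Psi> z) (\<Psi> w) \<le> 1/2 * dist z w" for z w
  proof (rule dist_bound)
    fix t :: real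
    define s where "s = max 0 t"
    have s: "s \<ge> 0" by (simp add: s_def)
    have "\<bar>g z r - g w r\<bar> \<le> K * dist z w * exp (2 * K * r)" if "r \<in> {0..s}" for r
    proof -
      have "\<bar>g z r - g w r\<bar> \<le> K * \<bar>exp (2 * K * r) * z r - exp (2 * K * r) * w r\<bar>"
        using lip[of r "x0 + exp (2 * K * r) * z r" "x0 + exp (2 * K * r) * w r"] that by (simp add: g_def)
      also have "\<dots> = K * (exp (2 * K * r) * \<bar>z r - w r\<bar>)"
        by (simp add: abs_mult flip: right_diff_distrib)
      also have "\<dots> \<le> K * (exp (2 * K * r) * dist z w)"
        using dist_bounded[of z r w] K by (intro mult_left_mono) (auto simp: dist_real_def)
      finally show ?thesis by (simp add: mult_ac)
    qed
    then have "norm (integral {0..s} (\<lambda>r. g z r - g w r)) \<le> integral {0..s} (\<lambda>r. K * dist z w * exp (2 * K * r))"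
      by (intro integral_norm_bound_integral integrable_diff ig integrable_continuous_real continuous_intros) auto
    then have "\<bar>J z s - J w s\<bar> \<le> K * dist z w * ((exp (2 * K * s) - 1) / (2 * K))"
      using integral_exp_le[OF K s] by (simp add: J_def Henstock_Kurzweil_Integration.integral_diff[OF ig ig])
    also have "\<dots> \<le> dist z w / 2 * exp (2 * K * s)"
      using K by (simp add: field_simps)
    finally have le: "\<bar>J z s - J w s\<bar> \<le> dist z w / 2 * exp (2 * K * s)" .
    have "dist (\<Psi> z t) (\<Psi> w t) = exp (- (2 * K * s)) * \<bar>J z s - J w s\<bar>"
      by (simp add: \<Psi> W_def dist_real_def s_def abs_mult flip: right_diff_distrib)
    also have "\<dots> \<le> exp (- (2 * K * s)) * (dist z w / 2 * exp (2 * K * s))"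
      by (rule mult_left_mono[OF le]) simp
    also have "\<dots> = dist z w / 2 * (exp (- (2 * K * s)) * exp (2 * K * s))" by simp
    also have "\<dots> = 1/2 * dist z w" by (simp flip: exp_add)
    finally show "dist (\<Psi> z t) (\<Psi> w t) \<le> 1/2 * dist z w" .
  qed
  have "\<exists>!z. \<Psi> z = z"
    by (rule banach_fix_type[of "1/2"]) (use contract in auto)
  then obtain z where z: "\<Psi> z = z" by blast
  define p where "p = (\<lambda>t. x0 + J z t)"
  have p: "p t = x0 + exp (2 * K * t) * z t" if "t \<ge> 0" for t
  proof -
    have "apply_bcontfun z t = exp (- (2 * K * t)) * J z t"
      using \<Psi>[of z t] z that by (simp add: W_def)
    then have "exp (2 * K * t) * z t = (exp (2 * K * t) * exp (- (2 * K * t))) * J z t" by simp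
    also have "exp (2 * K * t) * exp (- (2 * K * t)) = 1" by (simp flip: exp_add)
    finally show ?thesis by (simp add: p_def)
  qed
  show ?thesis
  proof (intro exI conjI allI impI)
    show "p 0 = x0" by (simp add: p_def J_def)
    fix t :: real assume t: "t \<ge> 0"
    have "(p has_real_derivative 0 + g z t) (at t within {0..})"
      unfolding p_def by (intro DERIV_add DERIV_const J t)
    moreover have "g z t = F (p t) t" using p[OF t] by (simp add: g_def)
    ultimately show "(p has_real_derivative F (p t) t) (at t within {0..})" by simp
  qed
qed

text \<open>Constant continuation is composition with the projection onto \<open>[0, L]\<close>,
  which does not increase distances and commutes with the reflection
  \<open>x \<mapsto> L - x\<close>.\<close>

lemma y_hat_clamp:
  assumes "L > 0" "t \<le> T"
  shows "y_hat T L y x t = y (max 0 (min L x)) t"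
  using assms by (auto simp: y_hat_def max_def min_def)

text \<open>Rest at time \<open>T\<close> makes the continued field continuous across
  \<open>T\<close>; its Lipschitz constant is a bound for the space derivative of
  \<open>y\<close>.\<close>

lemma flow_exists:
  assumes L: "L > 0" and T: "T > 0" and y: "classical_KdV L 0 T y"
    and rest: "\<And>x. x \<in> {0..L} \<Longrightarrow> y x T = 0"
  shows "\<exists>\<Phi>. is_flow T L y \<Phi>"
proof -
  obtain y1 y2 y3 where Y:
    "continuous_on ({0..L} \<times> {0..T}) (\<lambda>(x, t). y x t)" "continuous_on ({0..L} \<times> {0..T}) (\<lambda>(x, t). y1 x t)"
    and dY: "\<And>x t. x \<in> {0..L} \<Longrightarrow> t \<in> {0..T} \<Longrightarrow> ((\<lambda>x. y x t) has_real_derivative y1 x t) (at x within {0..L})"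
    by (rule classical_KdVE[OF y]) (rule that)
  have bound: "\<exists>B>0. \<forall>x\<in>{0..L}. \<forall>t\<in>{0..T}. \<bar>f x t\<bar> \<le> B"
    if "continuous_on ({0..L} \<times> {0..T}) (\<lambda>(x, t). f x t)" for f :: "real \<Rightarrow> real \<Rightarrow> real"
  proof -
    have "compact ((\<lambda>(x, t). f x t) ` ({0..L} \<times> {0..T}))"
      by (rule compact_continuous_image[OF that]) (intro compact_Times compact_Icc)
    then have "bounded ((\<lambda>(x, t). f x t) ` ({0..L} \<times> {0..T}))" by (rule compact_imp_bounded)
    then obtain B where "B > 0" "\<forall>v\<in>(\<lambda>(x, t). f x t) ` ({0..L} \<times> {0..T}). norm v \<le> B"
      using bounded_pos by blast
    then show ?thesis by auto
  qed
  obtain M where M: "M > 0" "\<And>x t. x \<in> {0..L} \<Longrightarrow> t \<in> {0..T} \<Longrightarrow> \<bar>y x t\<bar> \<le> M"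
    using bound[OF Y(1)] by blast
  obtain K where K: "K > 0" "\<And>x t. x \<in> {0..L} \<Longrightarrow> t \<in> {0..T} \<Longrightarrow> \<bar>y1 x t\<bar> \<le> K"
    using bound[OF Y(2)] by blast
  define cl where "cl = (\<lambda>x. max 0 (min L x))"
  have cl: "cl x \<in> {0..L}" for x using L by (auto simp: cl_def)
  have hat: "y_hat T L y x t = y (cl x) t" if "t \<le> T" for x t
    unfolding cl_def by (rule y_hat_clamp[OF L that])
  have hat0: "y_hat T L y x t = 0" if "T < t" for x t
    using that by (simp add: y_hat_def)
  have "continuous_on (UNIV \<times> {0..}) (\<lambda>p. if snd p \<le> T then y (cl (fst p)) (snd p) else 0)"
  proof (rule continuous_on_cases_le)
    have "continuous_on {p \<in> UNIV \<times> {0..}. snd p \<le> T} (\<lambda>p. (\<lambda>(x, t). y x t) (cl (fst p), snd p))"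
      by (rule continuous_on_compose2[OF Y(1)]) (use cl in \<open>auto simp: cl_def intro!: continuous_intros\<close>)
    then show "continuous_on {p \<in> UNIV \<times> {0..}. snd p \<le> T} (\<lambda>p. y (cl (fst p)) (snd p))" by simp
  qed (use rest cl in \<open>auto intro!: continuous_intros\<close>)
  moreover have "(\<lambda>p. if snd p \<le> T then y (cl (fst p)) (snd p) else 0) = (\<lambda>(x, t). y_hat T L y x t)"
    using hat hat0 by (auto simp: fun_eq_iff)
  ultimately have cont: "continuous_on (UNIV \<times> {0..}) (\<lambda>(x, t). y_hat T L y x t)" by (simp only:)
  have lip: "\<bar>y_hat T L y x t - y_hat T L y x' t\<bar> \<le> K * \<bar>x - x'\<bar>" if t: "t \<ge> 0" for x x' t
  proof (cases "t \<le> T")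
    case True
    have "norm (y (cl x) t - y (cl x') t) \<le> K * norm (cl x - cl x')"
      by (rule field_differentiable_bound[of "{0..L}" _ "\<lambda>x. y1 x t"])
         (use dY K(2) cl t True in auto)
    also have "\<dots> \<le> K * \<bar>x - x'\<bar>"
    proof (rule mult_left_mono)
      show "norm (cl x - cl x') \<le> \<bar>x - x'\<bar>" by (auto simp: cl_def max_def min_def)
    qed (use K in simp)
    finally show ?thesis using True by (simp add: hat)
  next
    case False
    then show ?thesis using K(1) by (simp add: hat0)
  qed
  have bdd: "\<bar>y_hat T L y x t\<bar> \<le> M" if "t \<ge> 0" for x t
  proof (cases "t \<le> T")
    case True
    then show ?thesis using M(2)[OF cl, of t x] that by (simp add: hat)
  next
    case False
    then show ?thesis using M(1) by (simp add: hat0)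
  qed
  have "\<forall>x0. \<exists>p. p 0 = x0 \<and> (\<forall>t\<ge>0. (p has_real_derivative y_hat T L y (p t) t) (at t within {0..}))"
    by (intro allI global_trajectory_exists[OF K(1) cont lip bdd])
  then obtain \<Phi> where "\<forall>x0. \<Phi> x0 0 = x0 \<and>
      (\<forall>t\<ge>0. (\<Phi> x0 has_real_derivative y_hat T L y (\<Phi> x0 t) t) (at t within {0..}))"
    by (rule choice[THEN exE])
  then have "is_flow T L y \<Phi>" unfolding is_flow_def by blast
  then show ?thesis by blast
qed

text \<open>A particle ahead of the crest of the soliton stays ahead of it: at the crest it would move with
  velocity at least \<open>soliton \<kappa> \<xi>\<close> for some \<open>\<xi>\<close> close to \<open>0\<close>, which exceeds the velocity
  \<open>4 \<kappa>\<^sup>2 + 1\<close> of the crest.\<close>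

lemma trajectory_ahead_of_crest:
  fixes p :: "real \<Rightarrow> real"
  assumes T: "T > 0" and L: "L > 0" and \<kappa>: "\<kappa> \<ge> 1" "\<kappa> \<ge> (L / 2 + 1) / T"
    and wave: "\<And>x t. x \<in> {0..L} \<Longrightarrow> t \<in> {T / 4..T / 2} \<Longrightarrow> y x t = wave T L \<kappa> x t"
    and small: "\<And>x t. x \<in> {0..L} \<Longrightarrow> t \<in> {0..T / 4} \<Longrightarrow> \<bar>y x t\<bar> * \<kappa> \<le> 2 / T"
    and p0: "p 0 \<ge> 0"
    and p: "\<And>t. t \<in> {0..T / 2} \<Longrightarrow> (p has_real_derivative y_hat T L y (p t) t) (at t within {0..T / 2})"
  shows "p (T / 2) > L / 2"
proof -
  define cl where "cl = (\<lambda>x. max 0 (min L x))"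
  have cl: "cl x \<in> {0..L}" for x using L by (auto simp: cl_def)
  have hat: "y_hat T L y x t = y (cl x) t" if "t \<le> T / 2" for x t
    unfolding cl_def by (rule y_hat_clamp[OF L]) (use that T in simp)
  have p_int: "(p has_real_derivative y (cl (p t)) t) (at t)" if "0 < t" "t < T / 2" for t
    using p[of t] that at_within_Icc_at[of 0 t "T / 2"] by (simp add: hat)
  have cont: "continuous_on {0..T / 2} p" by (rule DERIV_continuous_on[OF p])
  \<comment> \<open>A velocity bound. Over the time \<open>T / 4\<close> it permits a drift of at
    most \<open>1 / (2 * \<kappa>)\<close>, the distance from the crest tolerated by
    \<open>soliton_gt\<close>.\<close>
  define d where "d = 2 / T / \<kappa>"
  have "p 0 + d * 0 \<le> p (T / 4) + d * (T / 4)"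
  proof (rule DERIV_nonneg_imp_increasing_open[of 0 "T / 4" "\<lambda>t. p t + d * t"])
    fix t assume t: "0 < t" "t < T / 4"
    have "((\<lambda>t. p t + d * t) has_real_derivative y (cl (p t)) t + d) (at t)"
      using p_int[of t] t T by (auto intro!: derivative_eq_intros)
    moreover have "\<bar>y (cl (p t)) t\<bar> \<le> d"
      using small[OF cl, of t "p t"] t \<kappa>(1) by (simp add: d_def pos_le_divide_eq mult_ac)
    ultimately show "\<exists>D. ((\<lambda>t. p t + d * t) has_real_derivative D) (at t) \<and> 0 \<le> D"
      by (intro exI[of _ "y (cl (p t)) t + d"]) auto
  next
    show "continuous_on {0..T / 4} (\<lambda>t. p t + d * t)"
      by (intro continuous_intros continuous_on_subset[OF cont]) (use T in auto)
  qed (use T in auto)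
  moreover have "d * (T / 4) = 1 / (2 * \<kappa>)" using T by (simp add: d_def)
  ultimately have start: "p (T / 4) \<ge> - (1 / (2 * \<kappa>))" using p0 by simp
  \<comment> \<open>After \<open>T / 4\<close> the field is the positive soliton, so the particle no
    longer moves to the left.\<close>
  have low: "p t \<ge> - (1 / (2 * \<kappa>))" if t: "t \<in> {T / 4..T / 2}" for t
  proof -
    have "p (T / 4) \<le> p t"
    proof (rule DERIV_nonneg_imp_increasing_open[of "T / 4" t p])
      fix s assume s: "T / 4 < s" "s < t"
      have "y (cl (p s)) s > 0"
        using wave[OF cl, of s] soliton_pos[of \<kappa>] s t \<kappa> by (simp add: wave_def)
      then show "\<exists>D. (p has_real_derivative D) (at s) \<and> 0 \<le> D"
        using p_int[of s] s t T by (intro exI[of _ "y (cl (p s)) s"]) auto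
    next
      show "continuous_on {T / 4..t} p" by (rule continuous_on_subset[OF cont]) (use t T in auto)
    qed (use t in simp)
    then show ?thesis using start by simp
  qed
  define v where "v = 4 * \<kappa>\<^sup>2 + 1"
  define c where "c = (\<lambda>t. L / 2 + v * (t - T / 2))"
  have ck: "1 / (2 * \<kappa>) \<le> 1 / 2" using \<kappa> by (simp add: field_simps)
  \<comment> \<open>At \<open>T / 4\<close> the crest is at most at \<open>- 1\<close>, because
    \<kappa> is large, while the particle is at least at \<open>- 1/2\<close>.\<close>
  have c0: "c (T / 4) < p (T / 4)"
  proof -
    have "\<kappa> * 1 \<le> \<kappa> * \<kappa>" using \<kappa>(1) by (intro mult_left_mono) auto
    then have "4 * \<kappa> \<le> v" by (simp add: v_def power2_eq_square)
    then have "4 * \<kappa> * (T / 4) \<le> v * (T / 4)" using T by (intro mult_right_mono) auto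
    moreover have "L / 2 + 1 \<le> \<kappa> * T" using \<kappa>(2) T by (simp add: pos_divide_le_eq)
    ultimately have "c (T / 4) \<le> - 1" by (simp add: c_def field_simps)
    then show ?thesis using start ck by linarith
  qed
  define h where "h = (\<lambda>t. p t - c t)"
  have ch: "continuous_on {T / 4..T / 2} h"
    unfolding h_def c_def by (intro continuous_intros continuous_on_subset[OF cont]) (use T in auto)
  have "h (T / 2) > 0"
  proof (rule ccontr)
    assume "\<not> h (T / 2) > 0"
    then have neg: "h (T / 2) \<le> 0" by simp
    \<comment> \<open>The meeting times of particle and crest; the contradiction is drawn at the
      first of them.\<close>
    define Z where "Z = {t \<in> {T / 4..T / 2}. h t = 0}"
    have "\<exists>t\<ge>T / 4. t \<le> T / 2 \<and> h t = 0"
      by (rule IVT2'[of h "T / 2" 0 "T / 4"]) (use neg c0 T ch in \<open>auto simp: h_def\<close>)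
    then have "Z \<noteq> {}" by (auto simp: Z_def)
    moreover have "compact Z"
    proof -
      have "closed ({T / 4..T / 2} \<inter> h -` {0})"
        by (rule continuous_closed_preimage[OF ch]) auto
      moreover have Z: "{T / 4..T / 2} \<inter> h -` {0} = Z" by (auto simp: Z_def)
      ultimately have "compact ({T / 4..T / 2} \<inter> Z)" by (intro compact_Int_closed) auto
      moreover have "{T / 4..T / 2} \<inter> Z = Z" by (auto simp: Z_def)
      ultimately show ?thesis by simp
    qed
    ultimately obtain s where s: "s \<in> Z" "\<And>t. t \<in> Z \<Longrightarrow> s \<le> t"
      using compact_attains_inf[of Z] by blast
    have hs: "h s = 0" and sI: "s \<in> {T / 4..T / 2}" using s(1) by (auto simp: Z_def)
    have s0: "s > T / 4" using hs c0 sI by (cases "s = T / 4") (auto simp: h_def)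
    have ps: "p s = c s" using hs by (simp add: h_def)
    have cs: "c s \<le> L / 2"
      using sI mult_nonneg_nonpos[of v "s - T / 2"] by (simp add: c_def v_def mult.commute)
    \<comment> \<open>The particle sits on the crest. If it is inside the domain, the field is
      evaluated exactly there; otherwise it is evaluated at \<open>0\<close>, at most the drift
      away.\<close>
    have "\<kappa> * \<bar>cl (p s) - c s\<bar> \<le> 1 / 2"
    proof (cases "p s \<ge> 0")
      case True
      then have "cl (p s) = c s" using ps cs L by (simp add: cl_def)
      then show ?thesis by simp
    next
      case False
      then have "\<bar>cl (p s) - c s\<bar> \<le> 1 / (2 * \<kappa>)"
        using ps low[OF sI] L by (simp add: cl_def)
      then have "\<kappa> * \<bar>cl (p s) - c s\<bar> \<le> \<kappa> * (1 / (2 * \<kappa>))" using \<kappa>(1) by (intro mult_left_mono) auto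
      also have "\<dots> = 1 / 2" using \<kappa>(1) by simp
      finally show ?thesis .
    qed
    from soliton_gt[OF \<kappa>(1) this] have "v < soliton \<kappa> (cl (p s) - c s)" by (simp add: v_def)
    also have "soliton \<kappa> (cl (p s) - c s) = y (cl (p s)) s"
      using wave[OF cl sI, of "p s"] by (simp add: wave_def c_def v_def algebra_simps)
    finally have pos: "0 < y (cl (p s)) s - v" by simp
    have "(p has_real_derivative y (cl (p s)) s) (at s within {0..T / 2})"
      using p[of s] sI T by (simp add: hat)
    then have "(h has_real_derivative y (cl (p s)) s - v) (at s within {0..T / 2})"
      unfolding h_def c_def by (auto intro!: derivative_eq_intros)
    \<comment> \<open>The lead \<open>h\<close> grows at \<open>s\<close>, so it was negative just
      before, and has an even earlier zero after its positive start.\<close>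
    from has_real_derivative_pos_inc_left[OF this pos]
    obtain e where e: "e > 0" "\<And>r. r > 0 \<Longrightarrow> s - r \<in> {0..T / 2} \<Longrightarrow> r < e \<Longrightarrow> h (s - r) < h s" by blast
    define r where "r = min (e / 2) (s - T / 4)"
    have r: "r > 0" "r < e" "r \<le> s - T / 4" using e s0 by (auto simp: r_def)
    have hr: "h (s - r) < 0" using e(2)[OF r(1) _ r(2)] r sI T hs by auto
    have "\<exists>t\<ge>T / 4. t \<le> s - r \<and> h t = 0"
      by (rule IVT2'[of h "s - r" 0 "T / 4"])
         (use hr c0 r sI in \<open>auto simp: h_def intro!: continuous_on_subset[OF ch[unfolded h_def]]\<close>)
    then obtain t where t: "T / 4 \<le> t" "t \<le> s - r" "h t = 0" by blast
    then have "t \<in> Z" using sI r by (auto simp: Z_def)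
    from s(2)[OF this] t r show False by simp
  qed
  then show ?thesis by (simp add: h_def c_def)
qed

theorem theorem1p3:
  fixes T L :: real
  assumes "T > 0" and "L > 0"
  shows "\<exists>(u :: real \<Rightarrow> real) (v :: real \<Rightarrow> real) (w :: real \<Rightarrow> real) (y :: real \<Rightarrow> real \<Rightarrow> real).
     C_H2 T L y \<and>
     KdV T L y \<and>
     (\<forall>t\<in>{0..T}. y 0 t = u t \<and> y L t = v t \<and>
        ((\<lambda>x. y x t) has_real_derivative w t) (at L within {0..L})) \<and>
     (\<forall>x\<in>{0..L}. y x 0 = 0) \<and>
     (\<forall>x\<in>{0..L}. y x T = 0) \<and>
     (\<exists>\<Phi>. is_flow T L y \<Phi> \<and>
        (\<forall>x\<in>{0..L}. (\<Phi> x has_real_derivative 0) (at 0 within {0..})) \<and>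
        (\<forall>x\<in>{0..L}. (\<Phi> x has_real_derivative 0) (at T)) \<and>
        (\<forall>x\<in>{0..L}. \<forall>t\<ge>T. \<Phi> x t \<ge> L))"
proof -
  note T = assms(1) and L = assms(2)
  obtain \<kappa> y where \<kappa>: "\<kappa> \<ge> 1" "\<kappa> \<ge> (L / 2 + 1) / T" and y: "classical_KdV L 0 T y"
    and y0: "\<And>x. x \<in> {0..L} \<Longrightarrow> y x 0 = 0" and sym: "\<And>x t. y (L - x) (T - t) = y x t"
    and wave: "\<And>x t. x \<in> {0..L} \<Longrightarrow> t \<in> {T / 4..T / 2} \<Longrightarrow> y x t = wave T L \<kappa> x t"
    and small: "\<And>x t. x \<in> {0..L} \<Longrightarrow> t \<in> {0..T / 4} \<Longrightarrow> \<bar>y x t\<bar> * \<kappa> \<le> 2 / T"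
    by (rule kdv_control_solution[OF T L, of "2 / T" "(L / 2 + 1) / T"]) (use T in simp, rule that)
  have yT: "y x T = 0" if "x \<in> {0..L}" for x
    using sym[of "L - x" 0] y0[of "L - x"] that by simp
  obtain y1 where y1: "\<And>x t. x \<in> {0..L} \<Longrightarrow> t \<in> {0..T} \<Longrightarrow>
      ((\<lambda>x. y x t) has_real_derivative y1 x t) (at x within {0..L})"
    by (rule classical_KdVE[OF y]) (rule that)
  obtain \<Phi> where \<Phi>: "is_flow T L y \<Phi>"
    using flow_exists[OF L T y yT] by blast
  have \<Phi>0: "\<Phi> x 0 = x" and d\<Phi>: "t \<ge> 0 \<Longrightarrow> (\<Phi> x has_real_derivative y_hat T L y (\<Phi> x t) t) (at t within {0..})"
    for x t using \<Phi> by (auto simp: is_flow_def)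
  have d\<Phi>': "(\<Phi> x has_real_derivative y_hat T L y (\<Phi> x t) t) (at t)" if "t > 0" for x t
  proof -
    have "t \<in> interior {0..}" using that by simp
    from at_within_interior[OF this] show ?thesis using d\<Phi>[of t x] that by simp
  qed
  have cl: "max 0 (min L x) \<in> {0..L}" for x using L by auto
  have hatT: "y_hat T L y x T = 0" for x
    using y_hat_clamp[OF L order_refl] yT[OF cl] by simp
  have \<Phi>T: "\<Phi> x T \<ge> L" if x: "x \<in> {0..L}" for x
  proof (rule ccontr)
    assume "\<not> \<Phi> x T \<ge> L"
    have "\<Phi> x (T / 2) > L / 2"
    proof (rule trajectory_ahead_of_crest[OF T L \<kappa> wave small])
      show "(\<Phi> x has_real_derivative y_hat T L y (\<Phi> x t) t) (at t within {0..T / 2})" if "t \<in> {0..T / 2}" for t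
        by (rule DERIV_subset[OF d\<Phi>]) (use that in auto)
    qed (use x \<Phi>0 in auto)
    \<comment> \<open>The path reflected in space and time is again a trajectory of the same field,
      and it starts to the right of \<open>0\<close> if the particle ends to the left of
      \<open>L\<close>.\<close>
    moreover have "L - \<Phi> x (T - T / 2) > L / 2"
    proof (rule trajectory_ahead_of_crest[OF T L \<kappa> wave small, where p = "\<lambda>t. L - \<Phi> x (T - t)"])
      show "0 \<le> L - \<Phi> x (T - 0)" using \<open>\<not> \<Phi> x T \<ge> L\<close> by simp
      fix t assume t: "t \<in> {0..T / 2}"
      have "((\<lambda>t. T - t) has_real_derivative - 1) (at t within {0..T / 2})"
        by (auto intro!: derivative_eq_intros)
      moreover have "(\<Phi> x has_real_derivative y_hat T L y (\<Phi> x (T - t)) (T - t)) (at (T - t))"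
        by (rule d\<Phi>') (use t T in simp)
      ultimately have "((\<lambda>t. \<Phi> x (T - t)) has_real_derivative
          y_hat T L y (\<Phi> x (T - t)) (T - t) * - 1) (at t within {0..T / 2})"
        by (rule DERIV_chain2[rotated])
      from DERIV_diff[OF DERIV_const this, of L]
      have "((\<lambda>t. L - \<Phi> x (T - t)) has_real_derivative y_hat T L y (\<Phi> x (T - t)) (T - t))
          (at t within {0..T / 2})" by simp
      \<comment> \<open>Reflection commutes with the projection onto \<open>[0, L]\<close>, so the
        symmetry of \<open>y\<close> passes to the continued field.\<close>
      moreover have "y_hat T L y (\<Phi> x (T - t)) (T - t) = y_hat T L y (L - \<Phi> x (T - t)) t"
      proof -
        have "max 0 (min L (L - \<Phi> x (T - t))) = L - max 0 (min L (\<Phi> x (T - t)))"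
          using L by (auto simp: max_def min_def)
        then show ?thesis
          using t T sym[of "L - max 0 (min L (\<Phi> x (T - t)))" t]
          by (simp add: y_hat_clamp[OF L])
      qed
      ultimately show "((\<lambda>t. L - \<Phi> x (T - t)) has_real_derivative y_hat T L y (L - \<Phi> x (T - t)) t)
          (at t within {0..T / 2})" by simp
    qed auto
    moreover have "T - T / 2 = T / 2" by simp
    ultimately show False by simp
  qed
  have after: "\<Phi> x t = \<Phi> x T" if t: "t \<ge> T" for x t
  proof (cases "t = T")
    case False
    then have "T < t" using t by simp
    then show ?thesis
    proof (rule DERIV_isconst_end)
      show "continuous_on {T..t} (\<Phi> x)"
        by (rule DERIV_continuous_on[OF DERIV_subset[OF d\<Phi>]]) (use T in auto)
      show "(\<Phi> x has_real_derivative 0) (at s)" if "T < s" "s < t" for s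
        using d\<Phi>'[of s x] that T by (simp add: y_hat_def)
    qed
  qed simp
  have "(\<Phi> x has_real_derivative 0) (at 0 within {0..})" if "x \<in> {0..L}" for x
    using d\<Phi>[of 0 x] \<Phi>0[of x] y_hat_clamp[OF L, of 0 T y x] y0[OF cl] T by simp
  moreover have "(\<Phi> x has_real_derivative 0) (at T)" for x
    using d\<Phi>'[OF T, of x] by (simp add: hatT)
  moreover have "\<Phi> x t \<ge> L" if "x \<in> {0..L}" "t \<ge> T" for x t
    using after[OF that(2)] \<Phi>T[OF that(1)] by simp
  moreover have "L \<in> {0..L}" using L by simp
  ultimately show ?thesis
    using C_H2_classical[OF L y] KdV_classical[OF L T y] y1 y0 yT \<Phi>
    by (intro exI[of _ "y 0"] exI[of _ "y L"] exI[of _ "y1 L"] exI[of _ y]) blast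
qed

end
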